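(* Let $\rho$ be a unitary representation of $\overline{\mathrm{GL}}$ in a Hilbert space $H$. For $\alpha,\beta\in\mathcal A$ and $\mathfrak a\in\overline Q_\alpha\backslash\overline{\mathrm{GL}}/\overline Q_\beta$ let $\widehat\rho_{\alpha,\beta}(\mathfrak a):=P_\alpha\,\rho(A)\big|_{H_\beta}:H_\beta\to H_\alpha$, where $A\in\mathfrak a$ (this does not depend on the choice of $A\in\mathfrak a$). Then: (a) for any $\alpha,\beta,\gamma\in\mathcal A$ and any $\mathfrak a\in\overline Q_\alpha\backslash\overline{\mathrm{GL}}/\overline Q_\beta$, $\mathfrak b\in\overline Q_\beta\backslash\overline{\mathrm{GL}}/\overline Q_\gamma$ one has $\widehat\rho_{\alpha,\beta}(\mathfrak a)\,\widehat\rho_{\beta,\gamma}(\mathfrak b)=\widehat\rho_{\alpha,\gamma}(\mathfrak a\star\mathfrak b)$; (b) for any $\alpha,\beta$ and any $\mathfrak a\in\overline Q_\alpha\backslash\overline{\mathrm{GL}}/\overline Q_\beta$ one has $\widehat\rho_{\alpha,\beta}(\mathfrak a)^*=\widehat\rho_{\beta,\alpha}(\mathfrak a^* )$; (c) $\|\widehat\rho_{\alpha,\beta}(\mathfrak a)\|\le1$.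
   Context: Let $\mathbb F$ be a finite field. $\mathbb V$ is the space of two-sided sequences $(v_j)_{j\in\mathbb Z}$ over $\mathbb F$ with $v_j=0$ for all sufficiently large $j$; $W_m=\{v\in\mathbb V: v_j=0\text{ for }j>m\}$. Each $W_m$ is compact with the product topology, and $\mathbb V$ is a locally compact group in which every $W_m$ is an open compact subgroup. $\overline{\mathrm{GL}}$ is the group of all invertible continuous linear operators in $\mathbb V$ (with continuous inverse) preserving the Haar measure on $\mathbb V$, with the topology of uniform convergence on compact sets. $\mathcal A$ is the set of pairs $\alpha=(\alpha_-,\alpha_+)$ of integers with $\alpha_-\le\alpha_+$, $|\alpha|=\alpha_+-\alpha_-$. $\overline Q_\alpha\subset\overline{\mathrm{GL}}$ is the subgroup of all $g$ with $gW_{\alpha_+}=W_{\alpha_+}$, $gW_{\alpha_-}=W_{\alpha_-}$ inducing the identity on $W_{\alpha_+}/W_{\alpha_-}$; these subgroups form a fundamental system of open neighborhoods of the unit. Unitary representations are (strongly) continuous, in separable Hilbert spaces. For a unitary representation in $H$, $H_\alpha$ is the subspace of $\overline Q_\alpha$-fixed vectors, $P_\alpha:H\to H_\alpha$ the orthogonal projection. $\mathfrak a^*\in\overline Q_\beta\backslash\overline{\mathrm{GL}}/\overline Q_\alpha$ is the double coset of $A^{-1}$, $A\in\mathfrak a$. Let $\mathrm{GL}(2\infty,\mathbb F)\subset\overline{\mathrm{GL}}$ be the group of invertible matrices $g=(g_{ij})_{i,j\in\mathbb Z}$ such that $g-1$ has finitely many nonzero entries. Put $Q_\alpha=\overline Q_\alpha\cap\mathrm{GL}(2\infty,\mathbb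 F)$. Every double coset in $\overline Q_\alpha\backslash\overline{\mathrm{GL}}/\overline Q_\beta$ contains an element of $\mathrm{GL}(2\infty,\mathbb F)$, and $\overline Q_\alpha\backslash\overline{\mathrm{GL}}/\overline Q_\beta$ is identified with $Q_\alpha\backslash\mathrm{GL}(2\infty,\mathbb F)/Q_\beta$. Product $\star$. Let $A\in\mathfrak a$, $B\in\mathfrak b$ be elements of $\mathrm{GL}(2\infty,\mathbb F)$, where $\mathfrak a\in\overline Q_\alpha\backslash\overline{\mathrm{GL}}/\overline Q_\beta$, $\mathfrak b\in\overline Q_\beta\backslash\overline{\mathrm{GL}}/\overline Q_\gamma$. Choose integers $N_\pm,M_\pm,K_\pm\ge0$ with $\alpha_--N_-=\beta_--M_-=\gamma_--K_-=:s$ and $\alpha_++N_+=\beta_++M_+=\gamma_++K_+=:t$, such that all entries of $A$ and $B$ outside the square $s<i,j\le t$ are those of the identity matrix. Write the finite square part of $A$ as $(a_{ij})_{1\le i,j\le 3}$ with row sizes $N_-,|\alpha|,N_+$ and column sizes $M_-,|\beta|,M_+$, and that of $B$ as $(b_{ij})$ with row sizes $M_-,|\beta|,M_+$ and column sizes $K_-,|\gamma|,K_+$. Put $$A^\circ=\begin{pmatrix} 1_{M_-} & 0 & 0 & 0 & 0 \\ 0 & a_{11} & a_{12} & a_{13} & 0 \\ 0 & a_{21} & a_{22} & a_{23} & 0 \\ 0 & a_{31} & a_{32} & a_{33} & 0 \\ 0 & 0 & 0 & 0 & 1_{M_+} \end{pmatrix},\qquad B^\lozenge=\begin{pmatrix}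 b_{11} & 0 & b_{12} & 0 & b_{13} \\ 0 & 1_{M_-} & 0 & 0 & 0 \\ b_{21} & 0 & b_{22} & 0 & b_{23} \\ 0 & 0 & 0 & 1_{M_+} & 0 \\ b_{31} & 0 & b_{32} & 0 & b_{33} \end{pmatrix}.$$ Then $\mathfrak a\star\mathfrak b\in\overline Q_\alpha\backslash\overline{\mathrm{GL}}/\overline Q_\gamma$ is the double coset of the matrix obtained by placing $A^\circ B^\lozenge$ at the index range $s-M_-<i,j\le t+M_+$ and completing it by the identity outside; it is independent of the choices. *)

theory Defs
  imports
    "HOL-Analysis.Analysis"
    "Jordan_Normal_Form.Matrix"
begin

section \<open>The space \<open>\<bbbV>\<close>\<close>

typedef (overloaded) 'f lseq = "{v :: int \<Rightarrow> 'f::zero. \<exists>m. \<forall>j>m. v j = 0}"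
  morphisms coord Abs_lseq
  by (rule exI[of _ "\<lambda>_. 0"]) simp

lemma coord_eventually_zero: "\<exists>m. \<forall>j>m. coord v j = 0"
  using coord[of v] by simp

lemma lseq_eqI: "(\<And>j. coord v j = coord w j) \<Longrightarrow> v = w"
  by (metis coord_inject ext)

definition W :: "int \<Rightarrow> 'f::zero lseq set" where
  "W m = {v. \<forall>j>m. coord v j = 0}"

instantiation lseq :: (ab_group_add) ab_group_add
begin

definition zero_lseq :: "'a lseq" where
  "0 = Abs_lseq (\<lambda>_. 0)"
definition plus_lseq :: "'a lseq \<Rightarrow> 'a lseq \<Rightarrow> 'a lseq" where
  "v + w = Abs_lseq (\<lambda>j. coord v j + coord w j)"
definition uminus_lseq :: "'a lseq \<Rightarrow> 'a lseq" where
  "- v = Abs_lseq (\<lambda>j. - coord v j)"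
definition minus_lseq :: "'a lseq \<Rightarrow> 'a lseq \<Rightarrow> 'a lseq" where
  "v - w = Abs_lseq (\<lambda>j. coord v j - coord w j)"

lemma coord_zero [simp]: "coord (0 :: 'a lseq) j = 0"
  unfolding zero_lseq_def by (subst Abs_lseq_inverse) auto

lemma coord_plus [simp]: "coord (v + w :: 'a lseq) j = coord v j + coord w j"
proof -
  obtain m n where "\<forall>j>m. coord v j = 0" "\<forall>j>n. coord w j = 0"
    using coord_eventually_zero by meson
  then have "\<forall>j>max m n. coord v j + coord w j = 0" by simp
  then have "\<exists>k. \<forall>j>k. coord v j + coord w j = 0" by blast
  then show ?thesis unfolding plus_lseq_def by (subst Abs_lseq_inverse) auto
qed

lemma coord_uminus [simp]: "coord (- v :: 'a lseq) j = - coord v j"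
  unfolding uminus_lseq_def
  by (subst Abs_lseq_inverse) (use coord_eventually_zero[of v] in auto)

lemma coord_minus [simp]: "coord (v - w :: 'a lseq) j = coord v j - coord w j"
proof -
  obtain m n where "\<forall>j>m. coord v j = 0" "\<forall>j>n. coord w j = 0"
    using coord_eventually_zero by meson
  then have "\<forall>j>max m n. coord v j - coord w j = 0" by simp
  then have "\<exists>k. \<forall>j>k. coord v j - coord w j = 0" by blast
  then show ?thesis unfolding minus_lseq_def by (subst Abs_lseq_inverse) auto
qed

instance
  by standard (auto intro!: lseq_eqI simp: algebra_simps)

end

definition vscale :: "'f::field \<Rightarrow> 'f lseq \<Rightarrow> 'f lseq" where
  "vscale c v = Abs_lseq (\<lambda>j. c * coord v j)"

lemma coord_vscale [simp]: "coord (vscale c v) j = c * coord v j"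
  unfolding vscale_def
  by (subst Abs_lseq_inverse) (use coord_eventually_zero[of v] in auto)

lemma vector_space_vscale: "vector_space (vscale :: 'f::field \<Rightarrow> 'f lseq \<Rightarrow> 'f lseq)"
  by unfold_locales (auto intro!: lseq_eqI simp: algebra_simps)

text \<open>The topology is that of the union of the spaces \<open>W m\<close>, each carrying the product topology
  (\<open>\<bbbF>\<close> being discrete). It is the only group topology in which every \<open>W m\<close> is open and has the
  product topology as its subspace topology.\<close>

abbreviation prod_topology :: "(int \<Rightarrow> 'f) topology" where
  "prod_topology \<equiv> product_topology (\<lambda>_. discrete_topology UNIV) UNIV"

instantiation lseq :: (zero) topological_space
begin

definition open_lseq :: "'a lseq set \<Rightarrow> bool" where
  "open_lseq U \<longleftrightarrow>
     (\<forall>m. openin (subtopology prod_topology (coord ` (W m :: 'a lseq set))) (coord ` (U \<inter> W m)))"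

instance
proof
  show "open (UNIV :: 'a lseq set)"
    unfolding open_lseq_def
  proof
    fix m
    have "coord ` (W m :: 'a lseq set) \<subseteq> topspace prod_topology" by simp
    then show "openin (subtopology prod_topology (coord ` (W m :: 'a lseq set)))
        (coord ` (UNIV \<inter> W m))"
      by (metis Int_UNIV_left openin_topspace topspace_subtopology_subset)
  qed
next
  fix S T :: "'a lseq set"
  assume S: "open S" and T: "open T"
  show "open (S \<inter> T)"
    unfolding open_lseq_def
  proof
    fix m
    have "coord ` (S \<inter> T \<inter> W m) = coord ` (S \<inter> W m) \<inter> coord ` (T \<inter> W m)"
      by (auto simp: coord_inject)
    then show "openin (subtopology prod_topology (coord ` (W m :: 'a lseq set)))
        (coord ` (S \<inter> T \<inter> W m))"
      using S T unfolding open_lseq_def by (simp add: openin_Int)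
  qed
next
  fix K :: "'a lseq set set"
  assume K: "\<forall>S\<in>K. open S"
  show "open (\<Union>K)"
    unfolding open_lseq_def
  proof
    fix m
    have "coord ` (\<Union>K \<inter> W m) = (\<Union>S\<in>K. coord ` (S \<inter> W m))" by auto
    then show "openin (subtopology prod_topology (coord ` (W m :: 'a lseq set)))
        (coord ` (\<Union>K \<inter> W m))"
      using K unfolding open_lseq_def by auto
  qed
qed

end


section \<open>The group \<open>GLbar\<close>\<close>

text \<open>Haar measures of a second countable group: Borel measures on such a group that are finite on
  compact sets are automatically regular.\<close>

definition haar_measure :: "'a::{topological_space, ab_group_add} measure \<Rightarrow> bool" where
  "haar_measure M \<longleftrightarrow>
     sets M = sets borel \<and>
     (\<forall>x. \<forall>E\<in>sets borel. emeasure M ((+) x ` E) = emeasure M E) \<and>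
     (\<forall>K. compact K \<longrightarrow> emeasure M K < \<infinity>) \<and>
     (\<forall>U. open U \<and> U \<noteq> {} \<longrightarrow> emeasure M U > 0)"

definition GLbar :: "('f::field lseq \<Rightarrow> 'f lseq) set" where
  "GLbar = {g. Vector_Spaces.linear vscale vscale g \<and> bij g \<and>
     continuous_on UNIV g \<and> continuous_on UNIV (inv_into UNIV g) \<and>
     (\<forall>M. haar_measure M \<longrightarrow> (\<forall>E\<in>sets borel. emeasure M (g ` E) = emeasure M E))}"

text \<open>Uniform convergence on compact sets, for the uniform structure of the additive group.\<close>

definition GL_nbhd ::
  "('f::field lseq \<Rightarrow> 'f lseq) \<Rightarrow> 'f lseq set \<Rightarrow> 'f lseq set \<Rightarrow> ('f lseq \<Rightarrow> 'f lseq) set" where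
  "GL_nbhd g K U = {h \<in> GLbar. \<forall>x\<in>K. h x - g x \<in> U}"

definition GL_open :: "('f::field lseq \<Rightarrow> 'f lseq) set \<Rightarrow> bool" where
  "GL_open S \<longleftrightarrow> S \<subseteq> GLbar \<and>
     (\<forall>g\<in>S. \<exists>K U. compact K \<and> open U \<and> 0 \<in> U \<and> GL_nbhd g K U \<subseteq> S)"

definition GL_topology :: "('f::field lseq \<Rightarrow> 'f lseq) topology" where
  "GL_topology = topology GL_open"

lemma istopology_GL_open: "istopology GL_open"
  unfolding istopology_def
proof (intro conjI allI impI)
  fix S T :: "('f::field lseq \<Rightarrow> 'f lseq) set"
  assume S: "GL_open S" and T: "GL_open T"
  show "GL_open (S \<inter> T)"
    unfolding GL_open_def
  proof (intro conjI ballI)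
    show "S \<inter> T \<subseteq> GLbar" using S unfolding GL_open_def by blast
    fix g assume g: "g \<in> S \<inter> T"
    obtain K U where 1: "compact K" "open U" "0 \<in> U" "GL_nbhd g K U \<subseteq> S"
      using S g unfolding GL_open_def by blast
    obtain L V where 2: "compact L" "open V" "0 \<in> V" "GL_nbhd g L V \<subseteq> T"
      using T g unfolding GL_open_def by blast
    have "GL_nbhd g (K \<union> L) (U \<inter> V) \<subseteq> S \<inter> T"
      using 1(4) 2(4) unfolding GL_nbhd_def by blast
    moreover have "compact (K \<union> L)" "open (U \<inter> V)" "0 \<in> U \<inter> V"
      using 1 2 by (auto intro: compact_Un)
    ultimately show "\<exists>K U. compact K \<and> open U \<and> 0 \<in> U \<and> GL_nbhd g K U \<subseteq> S \<inter> T" by blast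
  qed
next
  fix \<K> :: "('f::field lseq \<Rightarrow> 'f lseq) set set"
  assume K: "\<forall>S\<in>\<K>. GL_open S"
  show "GL_open (\<Union>\<K>)"
    unfolding GL_open_def
  proof (intro conjI ballI)
    show "\<Union>\<K> \<subseteq> GLbar" using K unfolding GL_open_def by blast
    fix g assume "g \<in> \<Union>\<K>"
    then obtain S where S: "S \<in> \<K>" "g \<in> S" by blast
    then obtain K U where "compact K" "open U" "0 \<in> U" "GL_nbhd g K U \<subseteq> S"
      using K unfolding GL_open_def by meson
    then show "\<exists>K U. compact K \<and> open U \<and> 0 \<in> U \<and> GL_nbhd g K U \<subseteq> \<Union>\<K>"
      using S(1) by blast
  qed
qed

lemma openin_GL_topology: "openin GL_topology = GL_open"
  unfolding GL_topology_def by (rule topology_inverse'[OF istopology_GL_open])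


section \<open>Subgroups and double cosets\<close>

text \<open>A pair \<open>\<alpha>\<close> stands for \<open>(\<alpha>\<^sub>-, \<alpha>\<^sub>+) = (fst \<alpha>, snd \<alpha>)\<close>.\<close>

definition idx :: "(int \<times> int) set" where
  "idx = {\<alpha>. fst \<alpha> \<le> snd \<alpha>}"

definition Qbar :: "int \<times> int \<Rightarrow> ('f::field lseq \<Rightarrow> 'f lseq) set" where
  "Qbar \<alpha> = {g \<in> GLbar. g ` W (snd \<alpha>) = W (snd \<alpha>) \<and> g ` W (fst \<alpha>) = W (fst \<alpha>) \<and>
     (\<forall>v\<in>W (snd \<alpha>). g v - v \<in> W (fst \<alpha>))}"

definition dcoset ::
  "int \<times> int \<Rightarrow> int \<times> int \<Rightarrow> ('f::field lseq \<Rightarrow> 'f lseq) \<Rightarrow> ('f lseq \<Rightarrow> 'f lseq) set" where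
  "dcoset \<alpha> \<beta> g = {p \<circ> g \<circ> q | p q. p \<in> Qbar \<alpha> \<and> q \<in> Qbar \<beta>}"

definition dcosets :: "int \<times> int \<Rightarrow> int \<times> int \<Rightarrow> ('f::field lseq \<Rightarrow> 'f lseq) set set" where
  "dcosets \<alpha> \<beta> = dcoset \<alpha> \<beta> ` GLbar"

text \<open>\<open>coset_adj \<alpha> \<beta> \<aa>\<close> is \<open>\<aa>\<^sup>*\<close>, the double coset of \<open>A\<^sup>-\<^sup>1\<close> for any \<open>A \<in> \<aa>\<close>.\<close>

definition coset_adj ::
  "int \<times> int \<Rightarrow> int \<times> int \<Rightarrow> ('f::field lseq \<Rightarrow> 'f lseq) set \<Rightarrow> ('f lseq \<Rightarrow> 'f lseq) set" where
  "coset_adj \<alpha> \<beta> \<aa> = dcoset \<beta> \<alpha> (inv_into UNIV (SOME A. A \<in> \<aa>))"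


section \<open>Finitary matrices\<close>

definition id_mat :: "int \<Rightarrow> int \<Rightarrow> 'f::field" where
  "id_mat i j = (if i = j then 1 else 0)"

definition finitary :: "(int \<Rightarrow> int \<Rightarrow> 'f::field) \<Rightarrow> bool" where
  "finitary A \<longleftrightarrow> finite {(i, j). A i j \<noteq> id_mat i j}"

text \<open>The sums below are finite for finitary \<open>A\<close>.\<close>

definition mat_mult ::
  "(int \<Rightarrow> int \<Rightarrow> 'f::field) \<Rightarrow> (int \<Rightarrow> int \<Rightarrow> 'f) \<Rightarrow> (int \<Rightarrow> int \<Rightarrow> 'f)" where
  "mat_mult A B = (\<lambda>i k. \<Sum>j | A i j \<noteq> 0. A i j * B j k)"

definition mat_op :: "(int \<Rightarrow> int \<Rightarrow> 'f::field) \<Rightarrow> 'f lseq \<Rightarrow> 'f lseq" where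
  "mat_op A v = Abs_lseq (\<lambda>i. \<Sum>j | A i j \<noteq> 0. A i j * coord v j)"

definition GL2inf :: "(int \<Rightarrow> int \<Rightarrow> 'f::field) set" where
  "GL2inf = {A. finitary A \<and>
     (\<exists>B. finitary B \<and> mat_mult A B = id_mat \<and> mat_mult B A = id_mat)}"

definition id_outside :: "int \<Rightarrow> int \<Rightarrow> (int \<Rightarrow> int \<Rightarrow> 'f::field) \<Rightarrow> bool" where
  "id_outside s t A \<longleftrightarrow>
     (\<forall>i j. \<not> (s < i \<and> i \<le> t \<and> s < j \<and> j \<le> t) \<longrightarrow> A i j = id_mat i j)"


section \<open>The product of double cosets\<close>

definition append_cols :: "'f::zero mat \<Rightarrow> 'f mat \<Rightarrow> 'f mat" where
  "append_cols A B = four_block_mat A B (0\<^sub>m 0 (dim_col A)) (0\<^sub>m 0 (dim_col B))"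

text \<open>The matrix with the given rows of blocks; blocks in one row have equally many rows, and blocks
  in one column have equally many columns.\<close>

definition block_row :: "'f::zero mat list \<Rightarrow> 'f mat" where
  "block_row Bs = foldr append_cols Bs (0\<^sub>m (dim_row (hd Bs)) 0)"

definition block_mat :: "'f::zero mat list list \<Rightarrow> 'f mat" where
  "block_mat Bss = foldr append_rows (map block_row Bss) (0\<^sub>m 0 0)"

text \<open>For increasing lists \<open>R = [r\<^sub>0, r\<^sub>1, \<dots>]\<close> and \<open>C = [c\<^sub>0, c\<^sub>1, \<dots>]\<close>, the block \<open>(p, q)\<close>, numbered
  from 1, consists of the entries in the rows \<open>r\<^sub>p\<^sub>-\<^sub>1 < i \<le> r\<^sub>p\<close> and the columns
  \<open>c\<^sub>q\<^sub>-\<^sub>1 < j \<le> c\<^sub>q\<close>.\<close>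

definition block :: "(int \<Rightarrow> int \<Rightarrow> 'f) \<Rightarrow> int list \<Rightarrow> int list \<Rightarrow> nat \<Rightarrow> nat \<Rightarrow> 'f mat" where
  "block A R C p q =
     mat (nat (R ! p - R ! (p - 1))) (nat (C ! q - C ! (q - 1)))
       (\<lambda>(x, y). A (R ! (p - 1) + 1 + int x) (C ! (q - 1) + 1 + int y))"

text \<open>Places a finite square matrix at the index range \<open>l < i, j \<le> l + dim_row X\<close>.\<close>

definition complete_mat :: "int \<Rightarrow> 'f::field mat \<Rightarrow> int \<Rightarrow> int \<Rightarrow> 'f" where
  "complete_mat l X i j =
     (if l < i \<and> i \<le> l + int (dim_row X) \<and> l < j \<and> j \<le> l + int (dim_col X)
      then X $$ (nat (i - l - 1), nat (j - l - 1)) else id_mat i j)"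

definition A_circ ::
  "int \<times> int \<Rightarrow> int \<times> int \<Rightarrow> int \<Rightarrow> int \<Rightarrow> (int \<Rightarrow> int \<Rightarrow> 'f::field) \<Rightarrow> 'f mat" where
  "A_circ \<alpha> \<beta> s t A =
     (let a = block A [s, fst \<alpha>, snd \<alpha>, t] [s, fst \<beta>, snd \<beta>, t];
          Nm = nat (fst \<alpha> - s); n = nat (snd \<alpha> - fst \<alpha>); Np = nat (t - snd \<alpha>);
          Mm = nat (fst \<beta> - s); m = nat (snd \<beta> - fst \<beta>); Mp = nat (t - snd \<beta>)
      in block_mat
        [[1\<^sub>m Mm,    0\<^sub>m Mm Mm, 0\<^sub>m Mm m, 0\<^sub>m Mm Mp, 0\<^sub>m Mm Mp],
         [0\<^sub>m Nm Mm, a 1 1,    a 1 2,   a 1 3,    0\<^sub>m Nm Mp],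
         [0\<^sub>m n Mm,  a 2 1,    a 2 2,   a 2 3,    0\<^sub>m n Mp],
         [0\<^sub>m Np Mm, a 3 1,    a 3 2,   a 3 3,    0\<^sub>m Np Mp],
         [0\<^sub>m Mp Mm, 0\<^sub>m Mp Mm, 0\<^sub>m Mp m, 0\<^sub>m Mp Mp, 1\<^sub>m Mp]])"

definition B_lozenge ::
  "int \<times> int \<Rightarrow> int \<times> int \<Rightarrow> int \<Rightarrow> int \<Rightarrow> (int \<Rightarrow> int \<Rightarrow> 'f::field) \<Rightarrow> 'f mat" where
  "B_lozenge \<beta> \<gamma> s t B =
     (let b = block B [s, fst \<beta>, snd \<beta>, t] [s, fst \<gamma>, snd \<gamma>, t];
          Mm = nat (fst \<beta> - s); m = nat (snd \<beta> - fst \<beta>); Mp = nat (t - snd \<beta>);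
          Km = nat (fst \<gamma> - s); k = nat (snd \<gamma> - fst \<gamma>); Kp = nat (t - snd \<gamma>)
      in block_mat
        [[b 1 1,    0\<^sub>m Mm Mm, b 1 2,   0\<^sub>m Mm Mp, b 1 3],
         [0\<^sub>m Mm Km, 1\<^sub>m Mm,    0\<^sub>m Mm k, 0\<^sub>m Mm Mp, 0\<^sub>m Mm Kp],
         [b 2 1,    0\<^sub>m m Mm,  b 2 2,   0\<^sub>m m Mp,  b 2 3],
         [0\<^sub>m Mp Km, 0\<^sub>m Mp Mm, 0\<^sub>m Mp k, 1\<^sub>m Mp,    0\<^sub>m Mp Kp],
         [b 3 1,    0\<^sub>m Mp Mm, b 3 2,   0\<^sub>m Mp Mp, b 3 3]])"

text \<open>\<open>\<cc>\<close> is the double coset obtained from some admissible choice of \<open>A\<close>, \<open>B\<close>, \<open>s\<close>, \<open>t\<close>; the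
  numbers \<open>N\<^sub>\<plusminus>, M\<^sub>\<plusminus>, K\<^sub>\<plusminus>\<close> are determined by \<open>s\<close> and \<open>t\<close>. The coset \<open>\<cc>\<close> does not depend on the
  choice.\<close>

definition is_star ::
  "int \<times> int \<Rightarrow> int \<times> int \<Rightarrow> int \<times> int \<Rightarrow> ('f::field lseq \<Rightarrow> 'f lseq) set \<Rightarrow>
   ('f lseq \<Rightarrow> 'f lseq) set \<Rightarrow> ('f lseq \<Rightarrow> 'f lseq) set \<Rightarrow> bool" where
  "is_star \<alpha> \<beta> \<gamma> \<aa> \<bb> \<cc> \<longleftrightarrow>
     (\<exists>A B s t. A \<in> GL2inf \<and> B \<in> GL2inf \<and> mat_op A \<in> \<aa> \<and> mat_op B \<in> \<bb> \<and>
        s \<le> fst \<alpha> \<and> s \<le> fst \<beta> \<and> s \<le> fst \<gamma> \<and> snd \<alpha> \<le> t \<and> snd \<beta> \<le> t \<and> snd \<gamma> \<le> t \<and>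
        id_outside s t A \<and> id_outside s t B \<and>
        \<cc> = dcoset \<alpha> \<gamma>
              (mat_op (complete_mat (s - (fst \<beta> - s)) (A_circ \<alpha> \<beta> s t A * B_lozenge \<beta> \<gamma> s t B))))"

definition star ::
  "int \<times> int \<Rightarrow> int \<times> int \<Rightarrow> int \<times> int \<Rightarrow> ('f::field lseq \<Rightarrow> 'f lseq) set \<Rightarrow>
   ('f lseq \<Rightarrow> 'f lseq) set \<Rightarrow> ('f lseq \<Rightarrow> 'f lseq) set" where
  "star \<alpha> \<beta> \<gamma> \<aa> \<bb> = (SOME \<cc>. is_star \<alpha> \<beta> \<gamma> \<aa> \<bb> \<cc>)"


section \<open>Complex Hilbert spaces\<close>

text \<open>\<open>cinner\<close> is linear in its first argument.\<close>

class complex_hilbert = banach +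
  fixes scaleC :: "complex \<Rightarrow> 'a \<Rightarrow> 'a"
    and cinner :: "'a \<Rightarrow> 'a \<Rightarrow> complex"
  assumes scaleC_add_right: "scaleC c (x + y) = scaleC c x + scaleC c y"
    and scaleC_add_left: "scaleC (c + d) x = scaleC c x + scaleC d x"
    and scaleC_scaleC: "scaleC c (scaleC d x) = scaleC (c * d) x"
    and scaleC_of_real: "scaleC (complex_of_real r) x = scaleR r x"
    and cinner_commute: "cinner x y = cnj (cinner y x)"
    and cinner_add_left: "cinner (x + y) z = cinner x z + cinner y z"
    and cinner_scaleC_left: "cinner (scaleC c x) y = c * cinner x y"
    and cinner_norm: "cinner x x = complex_of_real ((norm x)\<^sup>2)"

definition orth_proj :: "'h::complex_hilbert set \<Rightarrow> 'h \<Rightarrow> 'h" where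
  "orth_proj S x = (THE y. y \<in> S \<and> (\<forall>z\<in>S. cinner (x - y) z = 0))"

definition adjoint_on ::
  "'h::complex_hilbert set \<Rightarrow> 'h set \<Rightarrow> ('h \<Rightarrow> 'h) \<Rightarrow> ('h \<Rightarrow> 'h)" where
  "adjoint_on S T f = (\<lambda>w\<in>T. THE u. u \<in> S \<and> (\<forall>v\<in>S. cinner (f v) w = cinner v u))"

text \<open>The operator norm of the restriction of \<open>f\<close> to \<open>S\<close>, with value \<open>\<infinity>\<close> if it is unbounded.\<close>

definition onorm_on :: "'h::real_normed_vector set \<Rightarrow> ('h \<Rightarrow> 'h) \<Rightarrow> ereal" where
  "onorm_on S f = (SUP v\<in>S. ereal (norm (f v) / norm v))"

definition unitary_op :: "('h::complex_hilbert \<Rightarrow> 'h) \<Rightarrow> bool" where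
  "unitary_op U \<longleftrightarrow>
     (\<forall>x y. U (x + y) = U x + U y) \<and> (\<forall>c x. U (scaleC c x) = scaleC c (U x)) \<and>
     surj U \<and> (\<forall>x y. cinner (U x) (U y) = cinner x y)"


section \<open>Representations\<close>

definition unitary_rep ::
  "(('f::field lseq \<Rightarrow> 'f lseq) \<Rightarrow> 'h::complex_hilbert \<Rightarrow> 'h) \<Rightarrow> bool" where
  "unitary_rep \<rho> \<longleftrightarrow>
     (\<forall>g\<in>GLbar. unitary_op (\<rho> g)) \<and>
     (\<forall>g\<in>GLbar. \<forall>h\<in>GLbar. \<rho> (g \<circ> h) = \<rho> g \<circ> \<rho> h) \<and>
     (\<forall>v. continuous_map GL_topology euclidean (\<lambda>g. \<rho> g v))"

definition fixed_space ::
  "(('f::field lseq \<Rightarrow> 'f lseq) \<Rightarrow> 'h \<Rightarrow> 'h) \<Rightarrow> int \<times> int \<Rightarrow> 'h set" where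
  "fixed_space \<rho> \<alpha> = {v. \<forall>g\<in>Qbar \<alpha>. \<rho> g v = v}"

definition rho_op ::
  "(('f::field lseq \<Rightarrow> 'f lseq) \<Rightarrow> 'h::complex_hilbert \<Rightarrow> 'h) \<Rightarrow> int \<times> int \<Rightarrow> int \<times> int \<Rightarrow>
   ('f lseq \<Rightarrow> 'f lseq) \<Rightarrow> 'h \<Rightarrow> 'h" where
  "rho_op \<rho> \<alpha> \<beta> A = (\<lambda>v\<in>fixed_space \<rho> \<beta>. orth_proj (fixed_space \<rho> \<alpha>) (\<rho> A v))"

definition rho_hat ::
  "(('f::field lseq \<Rightarrow> 'f lseq) \<Rightarrow> 'h::complex_hilbert \<Rightarrow> 'h) \<Rightarrow> int \<times> int \<Rightarrow> int \<times> int \<Rightarrow>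
   ('f lseq \<Rightarrow> 'f lseq) set \<Rightarrow> 'h \<Rightarrow> 'h" where
  "rho_hat \<rho> \<alpha> \<beta> \<aa> = rho_op \<rho> \<alpha> \<beta> (SOME A. A \<in> \<aa>)"

end

theory Submission
  imports
    Defs
    "HOL-Probability.Infinite_Product_Measure"
    "HOL-Combinatorics.Permutations"
begin

text \<open>The operator of the product \<open>A\<^sup>\<circ> B\<^sup>\<lozenge>\<close> equals \<open>A \<Theta> B \<Pi>\<close>, where \<open>A\<close> and \<open>B\<close> are the given finitary
operators, \<open>\<Theta>\<close> is the operator of a permutation that exchanges the interval \<open>(s, \<beta>\<^sub>-]\<close> with the
interval of the same length just below it and \<open>(\<beta>\<^sub>+, t]\<close> with the one just above it, and \<open>\<Pi>\<close> is
the operator of a permutation and lies in the group \<open>Qbar \<gamma>\<close> (lemma \<open>mat_op_star_matrix\<close>). Hence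
\<open>\<aa> \<star> \<bb>\<close> is the double coset of \<open>A \<Theta> B\<close>, and (a) says that \<open>P\<^sub>\<alpha> \<rho>(A) P\<^sub>\<beta> \<rho>(B) w = P\<^sub>\<alpha> \<rho>(A) \<rho>(\<Theta>)
\<rho>(B) w\<close> for \<open>w\<close> in \<open>H\<^sub>\<gamma>\<close>. Being the identity outside the square \<open>(s, t]\<close>, the operators \<open>A\<close> and
\<open>B\<close> normalize \<open>Qbar (s, t)\<close>, so \<open>\<rho>(B) w\<close> and, for \<open>u\<close> in \<open>H\<^sub>\<alpha>\<close>, \<open>\<rho>(A\<^sup>-\<^sup>1) u\<close> are fixed by
\<open>Qbar (s, t)\<close>. Pairing with \<open>u\<close> reduces (a) to the identity \<open>\<langle>\<rho>(\<Theta>) x, y\<rangle> = \<langle>P\<^sub>\<beta> x, y\<rangle>\<close> for \<open>x\<close>,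
\<open>y\<close> fixed by \<open>Qbar (s, t)\<close> (lemma \<open>two_swap_computes_projection\<close>).

To prove the identity, let \<open>\<Theta>\<^sub>n\<close> exchange the same two intervals with their translates by
distance \<open>n\<close>, for \<open>n\<close> not below their lengths. All \<open>\<Theta>\<^sub>n\<close> lie in \<open>Qbar \<beta>\<close>, because they fix
\<open>(\<beta>\<^sub>-, \<beta>\<^sub>+]\<close> and move no index across it. Given \<open>q\<close> in \<open>Qbar \<beta>\<close>, one has \<open>\<Theta>\<^sub>n q \<in> Qbar (s, t) \<Theta>
Qbar (s, t)\<close> for all large \<open>n\<close> (lemma \<open>two_swap_Qbar_double_coset\<close>): modulo \<open>Qbar (s, t)\<close> on the
right \<open>q\<close> is finitary, conjugation by \<open>\<Theta>\<^sub>n\<close> makes a finitary element of \<open>Qbar \<beta>\<close> trivial on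
\<open>W t / W s\<close>, and \<open>\<Theta>\<^sub>n\<close> itself is conjugate to \<open>\<Theta>\<close> by a permutation that fixes the window. So
\<open>\<langle>\<rho>(\<Theta>\<^sub>n) z, y\<rangle> = \<langle>\<rho>(\<Theta>) x, y\<rangle>\<close> for large \<open>n\<close> if \<open>z = \<rho>(q) x\<close>, and therefore also if \<open>z\<close> is in the
convex hull of these vectors. But \<open>P\<^sub>\<beta> x\<close> is a limit of such \<open>z\<close>: it is the vector of least norm
in the closed convex hull of the orbit of \<open>x\<close> (lemma \<open>ex_projection\<close>). Since \<open>\<rho>(\<Theta>\<^sub>n)\<close> fixes
\<open>P\<^sub>\<beta> x\<close>, the identity follows.

That \<open>g\<close> in \<open>GLbar\<close> is finitary modulo \<open>Qbar\<close> (lemma \<open>finitary_approximation\<close>) is needed also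
for the product \<open>\<aa> \<star> \<bb>\<close> to exist. It is linear algebra in a finite quotient \<open>W t / W s\<close>, once it
is known that \<open>g W m / W s\<close> and \<open>W m / W s\<close> have equally many elements; the shift shows that
this may fail for bicontinuous linear bijections. Invariance of a Haar measure gives it, so a
Haar measure has to be constructed (lemma \<open>haar_measure_haar\<close>). In the other direction, a linear
bijection that fixes some \<open>W s\<close> pointwise acts on each of the countably many cosets of \<open>W s\<close> as
a translation, and thus preserves every Haar measure (lemma \<open>GLbarI_fixes_W\<close>); this puts the
finitary operators and the permutation operators into \<open>GLbar\<close>.

Statements (b) and (c), and the independence of the choice of \<open>A\<close> in its double coset, are
formal consequences of unitarity and of the properties of orthogonal projections.\<close>

section \<open>The topology and the Borel sets of \<open>\<bbbV>\<close>\<close>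

lemma coord_Abs_lseq:
  assumes "\<And>j. j > m \<Longrightarrow> f j = 0"
  shows "coord (Abs_lseq f) = f"
  by (rule Abs_lseq_inverse) (use assms in blast)

lemma W_iff: "v \<in> W m \<longleftrightarrow> (\<forall>j>m. coord v j = 0)"
  by (simp add: W_def)

lemma W_mono: "m \<le> n \<Longrightarrow> W m \<subseteq> W n"
  by (auto simp: W_iff)

lemma ex_W: "\<exists>m. v \<in> W m"
  using coord_eventually_zero[of v] by (simp add: W_iff)

lemma zero_in_W [simp]: "(0 :: 'a::ab_group_add lseq) \<in> W m"
  by (simp add: W_iff)

lemma W_add: "v \<in> W m \<Longrightarrow> w \<in> W m \<Longrightarrow> (v + w :: 'a::ab_group_add lseq) \<in> W m"
  by (simp add: W_iff)

lemma W_diff_commute: "v - w \<in> W m \<Longrightarrow> (w - v :: 'a::ab_group_add lseq) \<in> W m"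
  by (simp add: W_iff)

lemma W_vscale: "v \<in> W m \<Longrightarrow> vscale c v \<in> W m"
  by (simp add: W_iff)

text \<open>The cosets of the subgroups \<open>W n\<close> form a base of the topology. Within \<open>W m\<close> such a coset fixes
the coordinates in \<open>(n, m]\<close>, which is a finite set, so it is a cylinder; and every cylinder
contains such a coset because all but finitely many coordinates of a cylinder are free.\<close>

lemma open_lseq_iff:
  fixes U :: "'a::ab_group_add lseq set"
  shows "open U \<longleftrightarrow> (\<forall>v\<in>U. \<exists>n. \<forall>w. w - v \<in> W n \<longrightarrow> w \<in> U)"
proof
  assume U: "open U"
  show "\<forall>v\<in>U. \<exists>n. \<forall>w. w - v \<in> W n \<longrightarrow> w \<in> U"
  proof
    fix v assume v: "v \<in> U"
    obtain m where m: "v \<in> W m" using ex_W by blast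
    have "openin (subtopology prod_topology (coord ` (W m :: 'a lseq set))) (coord ` (U \<inter> W m))"
      using U unfolding open_lseq_def by blast
    then obtain T where T: "openin (prod_topology :: (int \<Rightarrow> 'a) topology) T"
        "coord ` (U \<inter> W m) = T \<inter> coord ` W m"
      unfolding openin_subtopology by blast
    have "coord v \<in> T" using T(2) v m by blast
    then obtain C where C: "finite {i. C i \<noteq> (UNIV :: 'a set)}" "coord v \<in> Pi\<^sub>E UNIV C" "Pi\<^sub>E UNIV C \<subseteq> T"
      using T(1) unfolding openin_product_topology_alt by fastforce
    define n where "n = Min (insert m {i. C i \<noteq> UNIV}) - 1"
    have "Min (insert m {i. C i \<noteq> UNIV}) \<le> i" if "i = m \<or> C i \<noteq> UNIV" for i
      using C(1) that by (intro Min_le) auto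
    then have le: "n + 1 \<le> i" if "i = m \<or> C i \<noteq> UNIV" for i
      using that unfolding n_def by simp
    have nm: "n < m" using le[of m] by simp
    have nC: "n < i" if "C i \<noteq> UNIV" for i using le[of i] that by simp
    have "w \<in> U" if w: "w - v \<in> W n" for w
    proof -
      have eq: "coord w j = coord v j" if "j > n" for j using w that by (simp add: W_iff)
      have "w \<in> W m" using m eq nm by (simp add: W_iff)
      moreover have "coord w i \<in> C i" for i
        using C(2) eq[of i] nC[of i] by (cases "C i = UNIV") (auto simp: PiE_iff)
      then have "coord w \<in> T" using C(3) by (auto simp: PiE_iff)
      ultimately have "coord w \<in> coord ` (U \<inter> W m)" using T(2) by blast
      then show "w \<in> U" by (auto simp: coord_inject)
    qed
    then show "\<exists>n. \<forall>w. w - v \<in> W n \<longrightarrow> w \<in> U" by blast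
  qed
next
  assume U: "\<forall>v\<in>U. \<exists>n. \<forall>w. w - v \<in> W n \<longrightarrow> w \<in> U"
  then obtain n where n: "\<And>v w. v \<in> U \<Longrightarrow> w - v \<in> W (n v) \<Longrightarrow> w \<in> U" by metis
  show "open U"
    unfolding open_lseq_def
  proof
    fix m
    define C where "C v = Pi\<^sub>E UNIV (\<lambda>j. if n v < j \<and> j \<le> m then {coord v j} else UNIV)" for v
    have "openin prod_topology (C v)" for v :: "'a lseq"
    proof -
      have "{i. \<not> (n v < i \<longrightarrow> i \<le> m \<longrightarrow> {coord v i} = UNIV)} \<subseteq> {n v<..m}" by auto
      then have "finite {i. \<not> (n v < i \<longrightarrow> i \<le> m \<longrightarrow> {coord v i} = (UNIV :: 'a set))}"
        using finite_subset by blast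
      then show ?thesis
        unfolding C_def openin_PiE_gen by (simp add: if_distrib[of "\<lambda>x. x = UNIV"] cong: if_cong)
    qed
    then have "openin prod_topology (\<Union>v\<in>U \<inter> W m. C v)" by blast
    moreover have "coord ` (U \<inter> W m) = (\<Union>v\<in>U \<inter> W m. C v) \<inter> coord ` W m"
    proof (intro equalityI subsetI)
      fix x assume "x \<in> coord ` (U \<inter> W m)"
      then show "x \<in> (\<Union>v\<in>U \<inter> W m. C v) \<inter> coord ` W m" by (auto simp: C_def)
    next
      fix x assume "x \<in> (\<Union>v\<in>U \<inter> W m. C v) \<inter> coord ` W m"
      then obtain v w where v: "v \<in> U" "v \<in> W m" and w: "w \<in> W m" "x = coord w" "coord w \<in> C v" by blast
      have "coord w j = coord v j" if "n v < j" for j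
      proof (cases "j \<le> m")
        case True
        have "coord w j \<in> (if n v < j \<and> j \<le> m then {coord v j} else UNIV)"
          using w(3) unfolding C_def PiE_iff by blast
        then show ?thesis using that True by simp
      next
        case False
        then show ?thesis using v(2) w(1) by (simp add: W_iff)
      qed
      then have "w \<in> U" by (intro n[OF v(1)]) (simp add: W_iff)
      then show "x \<in> coord ` (U \<inter> W m)" using w by blast
    qed
    ultimately show "openin (subtopology prod_topology (coord ` (W m :: 'a lseq set))) (coord ` (U \<inter> W m))"
      unfolding openin_subtopology by blast
  qed
qed

definition wcoset :: "'a::ab_group_add lseq \<Rightarrow> int \<Rightarrow> 'a lseq set" where
  "wcoset v n = {w. w - v \<in> W n}"

lemma open_wcoset: "open (wcoset v n)"
  unfolding open_lseq_iff wcoset_def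
  by (auto simp: W_iff algebra_simps intro!: exI[of _ n])

lemma W_eq_wcoset: "W n = wcoset 0 n"
  by (simp add: wcoset_def)

lemma wcoset_refl: "v \<in> wcoset v n"
  by (simp add: wcoset_def)

lemma wcoset_eq: "w \<in> wcoset v n \<Longrightarrow> wcoset w n = wcoset v n"
  by (auto simp: wcoset_def W_iff)

lemma wcoset_mono: "m \<le> n \<Longrightarrow> wcoset v m \<subseteq> wcoset v n"
  using W_mono by (auto simp: wcoset_def)

lemma wcoset_borel: "wcoset v n \<in> sets borel"
  by (rule borel_open[OF open_wcoset])

text \<open>The \<open>W m\<close> form an increasing open cover of the whole space.\<close>

lemma compact_subset_W:
  assumes "compact (K :: 'a::ab_group_add lseq set)"
  shows "\<exists>m. K \<subseteq> W m"
proof -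
  have 1: "\<And>m. m \<in> UNIV \<Longrightarrow> open (W m :: 'a lseq set)" by (simp add: W_eq_wcoset open_wcoset)
  have 2: "K \<subseteq> (\<Union>m. W m)" using ex_W by blast
  obtain F where F: "finite F" "K \<subseteq> (\<Union>m\<in>F. W m)"
    using compactE_image[OF assms 1 2] by metis
  have "K \<subseteq> W (Max F)" using F W_mono[OF Max_ge[OF F(1)]] by blast
  then show ?thesis by blast
qed

text \<open>Representatives of the cosets of \<open>W s\<close>.\<close>

definition transversal :: "int \<Rightarrow> 'a::ab_group_add lseq set" where
  "transversal s = {v. \<forall>j\<le>s. coord v j = 0}"

definition trunc :: "int \<Rightarrow> 'a::ab_group_add lseq \<Rightarrow> 'a lseq" where
  "trunc s v = Abs_lseq (\<lambda>j. if s < j then coord v j else 0)"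

lemma coord_trunc [simp]: "coord (trunc s v) j = (if s < j then coord v j else 0)"
  unfolding trunc_def by (subst Abs_lseq_inverse) (use coord_eventually_zero[of v] in auto)

lemma trunc_in_transversal: "trunc s v \<in> transversal s"
  by (simp add: transversal_def)

lemma trunc_wcoset: "v \<in> wcoset (trunc s v) s"
  by (simp add: wcoset_def W_iff)

text \<open>The span of the basis vectors with index in \<open>(s, t]\<close>: representatives of \<open>W t / W s\<close>.\<close>

definition band :: "int \<Rightarrow> int \<Rightarrow> 'a::ab_group_add lseq set" where
  "band s t = transversal s \<inter> W t"

lemma band_iff: "v \<in> band s t \<longleftrightarrow> (\<forall>j. \<not> (s < j \<and> j \<le> t) \<longrightarrow> coord v j = 0)"
  by (auto simp: band_def transversal_def W_iff)

lemma bij_betw_band: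
  "bij_betw (\<lambda>v. restrict (coord v) {s<..t}) (band s t)
     ({s<..t} \<rightarrow>\<^sub>E (UNIV :: 'a::ab_group_add set))"
proof (rule bij_betwI[where g = "\<lambda>x. Abs_lseq (\<lambda>j. if s < j \<and> j \<le> t then x j else 0)"])
  have *: "coord (Abs_lseq (\<lambda>j. if s < j \<and> j \<le> t then x j else 0)) =
      (\<lambda>j. if s < j \<and> j \<le> t then x j else 0)" for x :: "int \<Rightarrow> 'a"
    by (rule coord_Abs_lseq[of t]) simp
  show "(\<lambda>x. Abs_lseq (\<lambda>j. if s < j \<and> j \<le> t then x j else 0))
      \<in> ({s<..t} \<rightarrow>\<^sub>E (UNIV :: 'a set)) \<rightarrow> band s t"
    by (simp add: band_iff *)
  show "Abs_lseq (\<lambda>j. if s < j \<and> j \<le> t then restrict (coord v) {s<..t} j else 0) = v"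
    if "v \<in> band s t" for v :: "'a lseq"
  proof (rule lseq_eqI)
    fix j
    show "coord (Abs_lseq (\<lambda>j. if s < j \<and> j \<le> t then restrict (coord v) {s<..t} j else 0)) j = coord v j"
      using that by (auto simp: * band_iff)
  qed
  show "restrict (coord (Abs_lseq (\<lambda>j. if s < j \<and> j \<le> t then x j else 0))) {s<..t} = x"
    if "x \<in> {s<..t} \<rightarrow>\<^sub>E (UNIV :: 'a set)" for x
  proof
    fix j
    show "restrict (coord (Abs_lseq (\<lambda>j. if s < j \<and> j \<le> t then x j else 0))) {s<..t} j = x j"
      using that by (auto simp: * PiE_iff extensional_def)
  qed
qed auto

lemma finite_band: "finite (band s t :: 'a::{ab_group_add, finite} lseq set)"
  using bij_betw_finite[OF bij_betw_band[of s t, where 'a='a]] by (simp add: finite_PiE)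

lemma card_band: "card (band s t :: 'a::{ab_group_add, finite} lseq set) = CARD('a) ^ nat (t - s)"
  using bij_betw_same_card[OF bij_betw_band[of s t, where 'a='a]] by (simp add: card_PiE)

lemma countable_transversal: "countable (transversal s :: 'a::{ab_group_add, finite} lseq set)"
proof -
  have "transversal s = (\<Union>t. band s t :: 'a lseq set)" using ex_W by (auto simp: band_def)
  then show ?thesis by (simp add: countable_finite[OF finite_band])
qed

lemma open_eq_Union_wcosets:
  fixes U :: "'a::{ab_group_add, finite} lseq set"
  assumes "open U"
  shows "\<exists>\<C>. countable \<C> \<and> \<C> \<subseteq> {wcoset v n |v n. n \<le> 0} \<and> U = \<Union>\<C>"
proof -
  define \<C> where "\<C> = {C \<in> (\<Union>n. (\<lambda>v. wcoset v n) ` transversal n). C \<subseteq> U \<and> (\<exists>v n. n \<le> 0 \<and> C = wcoset v n)}"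
  have countable: "countable \<C>"
  proof (rule countable_subset)
    show "\<C> \<subseteq> (\<Union>n. (\<lambda>v. wcoset v n) ` transversal n)" unfolding \<C>_def by blast
  qed (simp add: countable_transversal)
  have "v \<in> \<Union>\<C>" if v: "v \<in> U" for v
  proof -
    obtain n where "\<And>w. w - v \<in> W n \<Longrightarrow> w \<in> U" using assms v unfolding open_lseq_iff by blast
    then have "wcoset v n \<subseteq> U" by (auto simp: wcoset_def)
    then have *: "wcoset v (min n 0) \<subseteq> U" using wcoset_mono[of "min n 0" n v] by simp
    define k where "k = min n 0"
    have "wcoset v k = wcoset (trunc k v) k"
      by (rule wcoset_eq[OF trunc_wcoset])
    then have "wcoset v k \<in> (\<lambda>v. wcoset v k) ` transversal k"
      by (rule image_eqI) (rule trunc_in_transversal)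
    then have "wcoset v k \<in> (\<Union>n. (\<lambda>v. wcoset v n) ` transversal n)" by (rule UN_I[OF UNIV_I])
    moreover have "\<exists>w m. m \<le> 0 \<and> wcoset v k = wcoset w m"
      by (intro exI[of _ v] exI[of _ k]) (simp add: k_def)
    ultimately have "wcoset v k \<in> \<C>"
      using *[folded k_def] unfolding \<C>_def mem_Collect_eq by (intro conjI)
    then show ?thesis by (rule UnionI) (rule wcoset_refl)
  qed
  then have "U = \<Union>\<C>" by (auto simp: \<C>_def)
  moreover have "\<C> \<subseteq> {wcoset v n |v n. n \<le> 0}" by (auto simp: \<C>_def)
  ultimately show ?thesis using countable by blast
qed

text \<open>The cosets of the \<open>W n\<close> with \<open>n \<le> 0\<close> still form a base, and there are countably many of them.
Unlike larger cosets, each of them meets a single coset of \<open>W 0\<close>, so its measure below is one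
product.\<close>

lemma sets_borel_wcosets:
  "sets (borel :: 'a::{ab_group_add, finite} lseq measure) =
     sigma_sets UNIV (insert {} {wcoset v n |v n. n \<le> 0})" (is "_ = sigma_sets UNIV ?E")
proof
  have "sets (borel :: 'a lseq measure) = sigma_sets UNIV {U. open U}"
    by (simp add: borel_def)
  also have "\<dots> \<subseteq> sigma_sets UNIV ?E"
  proof (rule sigma_sets_mono)
    show "{U. open U} \<subseteq> sigma_sets UNIV ?E"
    proof
      fix U :: "'a lseq set" assume "U \<in> {U. open U}"
      then obtain \<C> where C: "countable \<C>" "\<C> \<subseteq> {wcoset v n |v n. n \<le> 0}" "U = \<Union>\<C>"
        using open_eq_Union_wcosets by blast
      show "U \<in> sigma_sets UNIV ?E"
        unfolding C(3) using C(1,2)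
        by (intro sigma_sets_UNION) (auto intro: sigma_sets.Basic)
    qed
  qed
  finally show "sets borel \<subseteq> sigma_sets UNIV ?E" .
  show "sigma_sets UNIV ?E \<subseteq> sets (borel :: 'a lseq measure)"
    using sets.sigma_sets_subset[of ?E "borel :: 'a lseq measure"] wcoset_borel by auto
qed

section \<open>A Haar measure on \<open>\<bbbV>\<close>\<close>

definition tail :: "(nat \<Rightarrow> 'a) \<Rightarrow> 'a::ab_group_add lseq" where
  "tail x = Abs_lseq (\<lambda>j. if j \<le> 0 then x (nat (- j)) else 0)"

lemma coord_tail [simp]: "coord (tail x) j = (if j \<le> 0 then x (nat (- j)) else 0)"
  unfolding tail_def by (subst coord_Abs_lseq[of 0]) auto

definition digits :: "(nat \<Rightarrow> 'a::finite) measure" where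
  "digits = PiM UNIV (\<lambda>_. uniform_count_measure UNIV)"

text \<open>Counting measure on the coordinates with index \<open>j > 0\<close>, times the uniform probability on each
coordinate with index \<open>j \<le> 0\<close>.\<close>

definition haar :: "'a::{ab_group_add, finite} lseq measure" where
  "haar = distr (count_space (transversal 0) \<Otimes>\<^sub>M digits) borel (\<lambda>(c, x). c + tail x)"

lemma product_prob_space_uniform:
  "product_prob_space (\<lambda>_ :: nat. uniform_count_measure (UNIV :: 'a::finite set))"
  by (intro product_prob_spaceI prob_space_uniform_count_measure) auto

lemma prob_space_digits: "prob_space (digits :: (nat \<Rightarrow> 'a::finite) measure)"
  unfolding digits_def by (intro prob_space_PiM prob_space_uniform_count_measure) auto

lemma space_digits [simp]: "space digits = UNIV"
  by (simp add: digits_def space_PiM space_uniform_count_measure)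

lemma digits_cylinder:
  fixes y :: "nat \<Rightarrow> 'a::finite"
  shows "{x. \<forall>i<k. x i = y i} \<in> sets digits"
    and "emeasure digits {x. \<forall>i<k. x i = y i} = ennreal (1 / CARD('a)) ^ k"
proof -
  interpret product_prob_space "\<lambda>_ :: nat. uniform_count_measure (UNIV :: 'a set)" UNIV
    by (rule product_prob_space_uniform)
  have *: "{x. \<forall>i<k. x i = y i} = {x \<in> space (digits :: (nat \<Rightarrow> 'a) measure). \<forall>i\<in>{..<k}. x i \<in> {y i}}"
    by auto
  show "{x. \<forall>i<k. x i = y i} \<in> sets digits"
    unfolding * unfolding digits_def
    by (intro sets.sets_Collect_finite_All sets_Collect_single) (auto simp: sets_uniform_count_measure)
  show "emeasure digits {x. \<forall>i<k. x i = y i} = ennreal (1 / CARD('a)) ^ k"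
    unfolding * unfolding digits_def
    by (subst emeasure_PiM_Collect) (auto simp: sets_uniform_count_measure emeasure_uniform_count_measure)
qed

text \<open>A coset of \<open>W n\<close> with \<open>n \<le> 0\<close> prescribes all coordinates of positive index and finitely many
others, so that its preimage is a point times a cylinder.\<close>

lemma add_tail_in_wcoset_iff:
  assumes "c \<in> transversal 0" "n \<le> 0"
  shows "c + tail x \<in> wcoset v n \<longleftrightarrow>
    c = trunc 0 v \<and> (\<forall>i<nat (- n). x i = coord v (- int i))"
proof
  assume L: "c + tail x \<in> wcoset v n"
  then have eq: "coord c j + coord (tail x) j = coord v j" if "j > n" for j
    using that by (simp add: wcoset_def W_iff)
  have "c = trunc 0 v"
  proof (rule lseq_eqI)
    fix j show "coord c j = coord (trunc 0 v) j"
      using eq[of j] assms by (auto simp: transversal_def)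
  qed
  moreover have "x i = coord v (- int i)" if "i < nat (- n)" for i
    using eq[of "- int i"] that assms by (auto simp: transversal_def)
  ultimately show "c = trunc 0 v \<and> (\<forall>i<nat (- n). x i = coord v (- int i))" by blast
next
  assume R: "c = trunc 0 v \<and> (\<forall>i<nat (- n). x i = coord v (- int i))"
  have "x (nat (- j)) = coord v j" if "n < j" "j \<le> 0" for j
    using R that by (auto dest: spec[of _ "nat (- j)"])
  then show "c + tail x \<in> wcoset v n"
    using R by (auto simp: wcoset_def W_iff)
qed

lemma measurable_add_tail:
  "(\<lambda>(c, x). c + tail x) \<in> (count_space (transversal 0) \<Otimes>\<^sub>M digits) \<rightarrow>\<^sub>M
     (borel :: 'a::{ab_group_add, finite} lseq measure)"
proof (rule measurable_pair_measure_countable1[OF countable_transversal])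
  fix c :: "'a lseq" assume c: "c \<in> transversal 0"
  show "(\<lambda>x. case (c, x) of (c, x) \<Rightarrow> c + tail x) \<in> digits \<rightarrow>\<^sub>M borel"
  proof (rule measurable_sigma_sets[OF sets_borel_wcosets])
    fix C assume "C \<in> insert {} {wcoset v n |(v :: 'a lseq) n. n \<le> 0}"
    then consider "C = {}" | v n where "n \<le> 0" "C = wcoset v n" by blast
    then show "(\<lambda>x. case (c, x) of (c, x) \<Rightarrow> c + tail x) -` C \<inter> space digits \<in> sets digits"
    proof cases
      case 2
      have "(\<lambda>x. c + tail x) -` C =
          (if c = trunc 0 v then {x. \<forall>i<nat (- n). x i = coord v (- int i)} else {})"
        using add_tail_in_wcoset_iff[OF c 2(1)] 2(2) by auto
      then show ?thesis using digits_cylinder(1)[of "nat (- n)" "\<lambda>i. coord v (- int i)"] by simp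
    qed simp
  qed auto
qed

lemma emeasure_haar:
  assumes "E \<in> sets borel"
  shows "emeasure haar E = emeasure (count_space (transversal 0) \<Otimes>\<^sub>M digits)
    {(c, x). c \<in> transversal 0 \<and> c + tail x \<in> E}"
  unfolding haar_def emeasure_distr[OF measurable_add_tail assms]
  by (rule arg_cong[where f = "emeasure _"]) (auto simp: space_pair_measure)

lemma emeasure_haar_wcoset:
  fixes v :: "'a::{ab_group_add, finite} lseq"
  assumes "n \<le> 0"
  shows "emeasure haar (wcoset v n) = ennreal (1 / CARD('a)) ^ nat (- n)"
proof -
  interpret sigma_finite_measure "digits :: (nat \<Rightarrow> 'a) measure"
    using prob_space_digits prob_space_imp_sigma_finite by blast
  have "{(c, x). c \<in> transversal 0 \<and> c + tail x \<in> wcoset v n} =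
      {trunc 0 v} \<times> {x. \<forall>i<nat (- n). x i = coord v (- int i)}"
    using add_tail_in_wcoset_iff[OF _ assms] trunc_in_transversal[of 0 v] by auto
  then show ?thesis
    unfolding emeasure_haar[OF wcoset_borel] using trunc_in_transversal[of 0 v]
    by (simp add: emeasure_pair_measure_Times digits_cylinder)
qed

lemma emeasure_haar_W_finite:
  "emeasure haar (W m :: 'a::{ab_group_add, finite} lseq set) < \<infinity>"
proof -
  interpret prob_space "digits :: (nat \<Rightarrow> 'a) measure" by (rule prob_space_digits)
  have "emeasure haar (W m :: 'a lseq set) \<le>
      emeasure (count_space (transversal 0) \<Otimes>\<^sub>M digits) ((band 0 (max m 0) :: 'a lseq set) \<times> (UNIV :: (nat \<Rightarrow> 'a) set))"
    unfolding emeasure_haar[OF wcoset_borel[of 0 m, folded W_eq_wcoset]]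
  proof (rule emeasure_mono)
    show "{(c, x). c \<in> transversal 0 \<and> c + tail x \<in> W m} \<subseteq> (band 0 (max m 0) :: 'a lseq set) \<times> (UNIV :: (nat \<Rightarrow> 'a) set)"
      by (auto simp: band_def W_iff)
    show "(band 0 (max m 0) :: 'a lseq set) \<times> UNIV \<in> sets (count_space (transversal 0) \<Otimes>\<^sub>M (digits :: (nat \<Rightarrow> 'a) measure))"
      using sets.top[of digits] by (intro pair_measureI) (auto simp: band_def)
  qed
  also have "\<dots> = emeasure (count_space (transversal 0)) (band 0 (max m 0) :: 'a lseq set)"
    using sets.top[of digits] emeasure_space_1
    by (subst emeasure_pair_measure_Times) (auto simp: band_def)
  also have "\<dots> < \<infinity>"
    using finite_band[of 0 "max m 0", where 'a = 'a]
    by (subst emeasure_count_space_finite) (auto simp: band_def of_nat_less_top)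
  finally show ?thesis .
qed

lemma measurable_translate:
  "(+) y \<in> (borel :: 'a::{ab_group_add, finite} lseq measure) \<rightarrow>\<^sub>M borel"
proof (rule measurable_sigma_sets[OF sets_borel_wcosets])
  fix C assume "C \<in> insert {} {wcoset v n |(v :: 'a lseq) n. n \<le> 0}"
  then consider "C = {}" | v n where "C = wcoset v n" by blast
  then show "(+) y -` C \<inter> space borel \<in> sets borel"
  proof cases
    case 2
    then have "(+) y -` C = wcoset (v - y) n" by (auto simp: wcoset_def algebra_simps)
    then show ?thesis using wcoset_borel by simp
  qed simp
qed auto

lemma translate_image_eq: "(+) x ` E = (+) (- x) -` (E :: 'a::ab_group_add set)"
  by (auto intro: image_eqI[of _ _ "- x + _"])

lemma translate_borel:
  "E \<in> sets borel \<Longrightarrow> (+) x ` E \<in> sets (borel :: 'a::{ab_group_add, finite} lseq measure)"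
  using measurable_sets[OF measurable_translate[of "- x"], of E] by (simp add: translate_image_eq)

lemma Int_stable_wcosets: "Int_stable (insert {} {wcoset v n |(v :: 'a::ab_group_add lseq) n. n \<le> 0})"
proof (rule Int_stableI)
  have *: "wcoset v n \<inter> wcoset w m \<in> {{}, wcoset v n}" if "n \<le> m" for v w :: "'a lseq" and n m
  proof (cases "wcoset v n \<inter> wcoset w m = {}")
    case False
    then obtain u where u: "u \<in> wcoset v n" "u \<in> wcoset w m" by blast
    then have "wcoset v n \<subseteq> wcoset w m"
      using wcoset_mono[OF that] wcoset_eq by metis
    then show ?thesis by blast
  qed simp
  fix A B assume "A \<in> insert {} {wcoset v n |(v :: 'a lseq) n. n \<le> 0}"
    "B \<in> insert {} {wcoset v n |(v :: 'a lseq) n. n \<le> 0}"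
  then consider "A \<inter> B = {}" | v n w m where "A = wcoset v n" "n \<le> 0" "B = wcoset w m" "m \<le> 0" by blast
  then show "A \<inter> B \<in> insert {} {wcoset v n |(v :: 'a lseq) n. n \<le> 0}"
  proof cases
    case 2
    then have "A \<inter> B \<in> {{}, A, B}"
      using *[of n m v w] *[of m n w v] by (cases "n \<le> m") (auto simp: Int_commute)
    then show ?thesis using \<open>A \<in> _\<close> \<open>B \<in> _\<close> by auto
  qed simp
qed

text \<open>Translations permute the cosets of each \<open>W n\<close>, and for fixed \<open>n\<close> these cosets all have the same
measure; cosets are nested or disjoint, hence an intersection-stable generator.\<close>

lemma haar_translate: "distr haar borel ((+) y) = (haar :: 'a::{ab_group_add, finite} lseq measure)"
proof (rule measure_eqI_generator_eq_countable[OF Int_stable_wcosets, where \<Omega> = UNIV])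
  have sets_haar: "sets (haar :: 'a lseq measure) = sets borel" by (simp add: haar_def)
  then have meas: "(+) y \<in> (haar :: 'a lseq measure) \<rightarrow>\<^sub>M borel"
    using measurable_translate measurable_cong_sets by blast
  show val: "emeasure (distr haar borel ((+) y)) C = emeasure haar C"
    if "C \<in> insert {} {wcoset v n |(v :: 'a lseq) n. n \<le> 0}" for C
  proof -
    from that consider "C = {}" | v n where "C = wcoset v n" "n \<le> 0" by blast
    then show ?thesis
    proof cases
      case 2
      have "(+) y -` C = wcoset (v - y) n" using 2 by (auto simp: wcoset_def algebra_simps)
      moreover have "space (haar :: 'a lseq measure) = UNIV" by (simp add: haar_def)
      ultimately show ?thesis
        using 2 by (simp add: emeasure_distr[OF meas] wcoset_borel emeasure_haar_wcoset)
    qed simp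
  qed
  show "sets (distr haar borel ((+) y)) = sigma_sets UNIV (insert {} {wcoset v n |(v :: 'a lseq) n. n \<le> 0})"
    "sets (haar :: 'a lseq measure) = sigma_sets UNIV (insert {} {wcoset v n |(v :: 'a lseq) n. n \<le> 0})"
    by (simp_all add: haar_def sets_borel_wcosets)
  show "(\<lambda>v. wcoset v 0) ` transversal 0 \<subseteq> insert {} {wcoset v n |(v :: 'a lseq) n. n \<le> 0}" by blast
  show "(\<Union>v\<in>transversal 0. wcoset v 0) = (UNIV :: 'a lseq set)"
    using trunc_wcoset trunc_in_transversal by blast
  show "countable ((\<lambda>v. wcoset v 0) ` (transversal 0 :: 'a lseq set))"
    using countable_transversal by blast
  fix C assume "C \<in> (\<lambda>v. wcoset v 0) ` (transversal 0 :: 'a lseq set)"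
  then obtain v :: "'a lseq" where C: "C = wcoset v 0" by blast
  then have "emeasure (distr haar borel ((+) y)) C = emeasure haar C" by (intro val) blast
  also have "\<dots> = 1" using emeasure_haar_wcoset[of 0 v] C by simp
  finally show "emeasure (distr haar borel ((+) y)) C \<noteq> \<infinity>" by simp
qed auto

text \<open>Translation invariance is \<open>haar_translate\<close>; compact sets lie in some \<open>W m\<close>, and nonempty open
sets contain a coset of some \<open>W n\<close>.\<close>

lemma haar_measure_haar: "haar_measure (haar :: 'a::{ab_group_add, finite} lseq measure)"
  unfolding haar_measure_def
proof (intro conjI allI ballI impI)
  show sets: "sets (haar :: 'a lseq measure) = sets borel" by (simp add: haar_def)
  then have meas: "(+) y \<in> (haar :: 'a lseq measure) \<rightarrow>\<^sub>M borel" for y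
    using measurable_translate measurable_cong_sets by blast
  show "emeasure haar ((+) x ` E) = emeasure haar E" if "E \<in> sets borel" for x :: "'a lseq" and E
  proof -
    have "space (haar :: 'a lseq measure) = UNIV" by (simp add: haar_def)
    then show ?thesis
      using emeasure_distr[OF meas that, of "- x"] by (simp add: haar_translate translate_image_eq)
  qed
  fix K :: "'a lseq set" assume "compact K"
  then obtain m where "K \<subseteq> W m" using compact_subset_W by blast
  then have "emeasure haar K \<le> emeasure haar (W m :: 'a lseq set)"
    by (intro emeasure_mono) (simp_all add: sets W_eq_wcoset wcoset_borel)
  also have "\<dots> < \<infinity>" by (rule emeasure_haar_W_finite)
  finally show "emeasure haar K < \<infinity>" .
next
  fix U :: "'a lseq set" assume U: "open U \<and> U \<noteq> {}"
  then obtain v where "v \<in> U" by blast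
  then obtain n where "\<And>w. w - v \<in> W n \<Longrightarrow> w \<in> U" using U unfolding open_lseq_iff by blast
  then have "wcoset v n \<subseteq> U" by (auto simp: wcoset_def)
  then have "wcoset v (min n 0) \<subseteq> U" using wcoset_mono[of "min n 0" n v] by simp
  then have "emeasure haar (wcoset v (min n 0)) \<le> emeasure haar U"
    using U by (intro emeasure_mono) (simp_all add: haar_def)
  moreover have "emeasure haar (wcoset v (min n 0)) > 0"
    by (subst emeasure_haar_wcoset) (auto simp: zero_less_iff_neq_zero ennreal_eq_0_iff not_le)
  ultimately show "0 < emeasure haar U" by (rule order.strict_trans2[rotated])
qed

section \<open>The groups \<open>GLbar\<close> and \<open>Qbar\<close>\<close>

abbreviation lin :: "('f::field lseq \<Rightarrow> 'f lseq) \<Rightarrow> bool" where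
  "lin \<equiv> Vector_Spaces.linear vscale vscale"

abbreviation ginv :: "('f::field lseq \<Rightarrow> 'f lseq) \<Rightarrow> 'f lseq \<Rightarrow> 'f lseq" where
  "ginv \<equiv> inv_into UNIV"

lemma lin_iff:
  "lin g \<longleftrightarrow> (\<forall>v w. g (v + w) = g v + g w) \<and> (\<forall>c v. g (vscale c v) = vscale c (g v))"
  by (simp add: Vector_Spaces.linear_iff vector_space_vscale)

lemma lin_add: "lin g \<Longrightarrow> g (v + w) = g v + g w"
  and lin_vscale: "lin g \<Longrightarrow> g (vscale c v) = vscale c (g v)"
  by (simp_all add: lin_iff)

lemma lin_zero: "lin g \<Longrightarrow> g 0 = 0"
  using lin_add[of g 0 0] by simp

lemma lin_diff: "lin g \<Longrightarrow> g (v - w) = g v - g w"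
  using lin_add[of g "v - w" w] by (simp add: algebra_simps)

lemma lin_sum: "lin g \<Longrightarrow> g (\<Sum>i\<in>I. f i) = (\<Sum>i\<in>I. g (f i))"
  by (induction I rule: infinite_finite_induct) (simp_all add: lin_zero lin_add)

lemma lin_comp: "lin g \<Longrightarrow> lin h \<Longrightarrow> lin (g \<circ> h)"
  by (simp add: lin_iff)

lemma lin_inv:
  assumes "lin g" "bij g"
  shows "lin (ginv g)"
  unfolding lin_iff
proof (intro conjI allI)
  show "ginv g (v + w) = ginv g v + ginv g w" for v w
    using assms by (metis bij_inv_eq_iff lin_add)
  show "ginv g (vscale c v) = vscale c (ginv g v)" for c v
    using assms by (metis bij_inv_eq_iff lin_vscale)
qed

text \<open>An additive map is continuous as soon as it is continuous at \<open>0\<close>, where the \<open>W n\<close> form a base of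
neighborhoods.\<close>

lemma continuous_lin_iff:
  assumes "lin g"
  shows "continuous_on UNIV g \<longleftrightarrow> (\<forall>n. \<exists>m. g ` W m \<subseteq> W n)"
proof
  assume cont: "continuous_on UNIV g"
  show "\<forall>n. \<exists>m. g ` W m \<subseteq> W n"
  proof
    fix n
    have "open (g -` W n)"
      using cont open_wcoset[of 0 n, folded W_eq_wcoset] by (auto simp: continuous_on_open_vimage)
    moreover have "0 \<in> g -` W n" by (simp add: lin_zero[OF assms])
    ultimately obtain m where "\<And>w. w \<in> W m \<Longrightarrow> w \<in> g -` W n"
      unfolding open_lseq_iff by (metis diff_zero)
    then show "\<exists>m. g ` W m \<subseteq> W n" by blast
  qed
next
  assume *: "\<forall>n. \<exists>m. g ` W m \<subseteq> W n"
  have "open (g -` U)" if U: "open U" for U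
    unfolding open_lseq_iff
  proof
    fix v assume "v \<in> g -` U"
    then obtain n where n: "\<And>w. w - g v \<in> W n \<Longrightarrow> w \<in> U"
      using U unfolding open_lseq_iff by blast
    obtain m where "g ` W m \<subseteq> W n" using * by blast
    then have "w \<in> g -` U" if "w - v \<in> W m" for w
      using n[of "g w"] that lin_diff[OF assms, of w v] by auto
    then show "\<exists>m. \<forall>w. w - v \<in> W m \<longrightarrow> w \<in> g -` U" by blast
  qed
  then show "continuous_on UNIV g" by (simp add: continuous_on_open_vimage)
qed

lemma GLbarD:
  assumes "g \<in> GLbar"
  shows "lin g" "bij g" "continuous_on UNIV g" "continuous_on UNIV (ginv g)"
    "\<And>M E. haar_measure M \<Longrightarrow> E \<in> sets borel \<Longrightarrow> emeasure M (g ` E) = emeasure M E"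
  using assms by (auto simp: GLbar_def)

lemma GLbar_image_borel:
  assumes "g \<in> GLbar" "E \<in> sets borel"
  shows "g ` E \<in> sets borel"
proof -
  have "ginv g \<in> borel \<rightarrow>\<^sub>M borel"
    by (rule borel_measurable_continuous_onI[OF GLbarD(4)[OF assms(1)]])
  from measurable_sets[OF this assms(2)] show ?thesis
    by (simp add: bij_vimage_eq_inv_image bij_imp_bij_inv GLbarD(2)[OF assms(1)] inv_inv_eq)
qed

lemma GLbar_id: "id \<in> GLbar"
  by (simp add: GLbar_def lin_iff)

lemma GLbar_comp:
  assumes g: "g \<in> GLbar" and h: "h \<in> GLbar"
  shows "g \<circ> h \<in> GLbar"
  unfolding GLbar_def mem_Collect_eq
proof (intro conjI allI impI ballI)
  show "lin (g \<circ> h)" "bij (g \<circ> h)"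
    using GLbarD[OF g] GLbarD[OF h] by (auto intro: lin_comp bij_comp)
  show "continuous_on UNIV (g \<circ> h)"
    using GLbarD(3)[OF g] GLbarD(3)[OF h] continuous_on_subset by (blast intro: continuous_on_compose)
  have "continuous_on UNIV (ginv h \<circ> ginv g)"
    using GLbarD(4)[OF g] GLbarD(4)[OF h] continuous_on_subset by (blast intro: continuous_on_compose)
  then show "continuous_on UNIV (ginv (g \<circ> h))"
    by (simp add: o_inv_distrib GLbarD(2)[OF g] GLbarD(2)[OF h])
  fix M :: "'a lseq measure" and E :: "'a lseq set"
  assume "haar_measure M" "E \<in> sets borel"
  moreover have "(g \<circ> h) ` E = g ` h ` E" by (simp add: image_comp)
  ultimately show "emeasure M ((g \<circ> h) ` E) = emeasure M E"
    using GLbarD(5)[OF g] GLbarD(5)[OF h] GLbar_image_borel[OF h] by metis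
qed

lemma GLbar_inv:
  assumes g: "g \<in> GLbar"
  shows "ginv g \<in> GLbar"
  unfolding GLbar_def mem_Collect_eq
proof (intro conjI allI impI ballI)
  show "lin (ginv g)" "bij (ginv g)" "continuous_on UNIV (ginv g)"
    using GLbarD[OF g] by (auto intro: lin_inv bij_imp_bij_inv)
  show "continuous_on UNIV (ginv (ginv g))"
    using GLbarD[OF g] by (simp add: inv_inv_eq)
  fix M :: "'a lseq measure" and E :: "'a lseq set"
  assume M: "haar_measure M" and E: "E \<in> sets borel"
  have "ginv g ` E = g -` E" using GLbarD(2)[OF g] by (simp add: bij_vimage_eq_inv_image)
  then have "ginv g ` E \<in> sets borel"
    using measurable_sets[OF borel_measurable_continuous_onI[OF GLbarD(3)[OF g]] E] by simp
  moreover have "g ` ginv g ` E = E"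
    by (rule image_f_inv_f[OF bij_is_surj[OF GLbarD(2)[OF g]]])
  ultimately show "emeasure M (ginv g ` E) = emeasure M E" using GLbarD(5)[OF g M] by metis
qed

lemma disjoint_wcosets: "disjoint_family_on (\<lambda>c. wcoset c s) (transversal s)"
  unfolding disjoint_family_on_def
proof (intro ballI impI)
  fix c d :: "'a lseq" assume cd: "c \<in> transversal s" "d \<in> transversal s" "c \<noteq> d"
  have "c = d" if "v \<in> wcoset c s" "v \<in> wcoset d s" for v
  proof (rule lseq_eqI)
    fix j show "coord c j = coord d j"
      using that cd by (cases "j \<le> s") (auto simp: wcoset_def W_iff transversal_def)
  qed
  then show "wcoset c s \<inter> wcoset d s = {}" using cd by blast
qed

text \<open>For \<open>w\<close> in \<open>W s\<close> one has \<open>g (c + w) = g c + w\<close>, so on the coset \<open>c + W s\<close> the map \<open>g\<close> is the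
translation by \<open>g c - c\<close>. Cutting a Borel set along the countably many cosets shows that its
measure is preserved.\<close>

lemma GLbarI_fixes_W:
  fixes g :: "'f::{field, finite} lseq \<Rightarrow> 'f lseq"
  assumes lin: "lin g" and bij: "bij g" and fixed: "\<And>v. v \<in> W s \<Longrightarrow> g v = v"
  shows "g \<in> GLbar"
  unfolding GLbar_def mem_Collect_eq
proof (intro conjI allI impI ballI lin bij)
  have cont: "continuous_on UNIV h" if "lin h" "\<And>v. v \<in> W s \<Longrightarrow> h v = v" for h :: "'f lseq \<Rightarrow> 'f lseq"
    unfolding continuous_lin_iff[OF that(1)]
  proof
    fix n
    show "\<exists>m. h ` W m \<subseteq> W n"
      using that(2) W_mono[of "min s n" s] W_mono[of "min s n" n]
      by (intro exI[of _ "min s n"]) force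
  qed
  show "continuous_on UNIV g" by (rule cont[OF lin fixed])
  show "continuous_on UNIV (ginv g)"
    by (rule cont[OF lin_inv[OF lin bij]]) (metis fixed bij bij_inv_eq_iff)
  fix M :: "'f lseq measure" and E :: "'f lseq set"
  assume M: "haar_measure M" and E: "E \<in> sets borel"
  then have sets: "sets M = sets borel" by (simp add: haar_measure_def)
  define X where "X c = E \<inter> wcoset c s" for c
  have X: "X c \<in> sets borel" for c unfolding X_def using E wcoset_borel by blast
  have EX: "E = (\<Union>c\<in>transversal s. X c)"
    unfolding X_def using trunc_wcoset trunc_in_transversal by blast
  have disj: "disjoint_family_on X (transversal s)"
    using disjoint_wcosets[of s] unfolding X_def disjoint_family_on_def by blast
  have gX: "g ` X c = (+) (g c - c) ` X c" for c
  proof (rule image_cong[OF refl])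
    fix v assume "v \<in> X c"
    then have "g (v - c) = v - c" using fixed by (simp add: X_def wcoset_def)
    then show "g v = g c - c + v" by (simp add: lin_diff[OF lin] algebra_simps)
  qed
  have gX_borel: "g ` X c \<in> sets M" for c
    unfolding gX sets by (rule translate_borel[OF X])
  have "disjoint_family_on (\<lambda>c. g ` X c) (transversal s)"
    using disj bij by (simp add: disjoint_family_on_def image_Int[symmetric] bij_is_inj)
  then have "emeasure M (g ` E) = (\<integral>\<^sup>+ c. emeasure M (g ` X c) \<partial>count_space (transversal s))"
    unfolding EX image_UN using gX_borel by (intro emeasure_UN_countable countable_transversal)
  also have "\<dots> = (\<integral>\<^sup>+ c. emeasure M (X c) \<partial>count_space (transversal s))"
    using M X by (simp add: gX haar_measure_def)
  also have "\<dots> = emeasure M E"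
    unfolding EX using X sets disj by (intro emeasure_UN_countable[symmetric] countable_transversal) auto
  finally show "emeasure M (g ` E) = emeasure M E" .
qed

lemma GLbar_image_W_lower:
  assumes "g \<in> GLbar"
  shows "\<exists>s. W s \<subseteq> g ` W m"
proof -
  obtain s where "ginv g ` W s \<subseteq> W m"
    using GLbarD(1,3)[OF GLbar_inv[OF assms]] continuous_lin_iff by blast
  then have "g ` ginv g ` W s \<subseteq> g ` W m" by (rule image_mono)
  then show ?thesis by (auto simp: image_f_inv_f bij_is_surj GLbarD(2)[OF assms])
qed

text \<open>Some \<open>W n\<close> is mapped into \<open>W 0\<close> by continuity, and \<open>W m\<close> is a union of finitely many cosets of
\<open>W n\<close>.\<close>

lemma GLbar_image_W_upper:
  fixes g :: "'f::{field, finite} lseq \<Rightarrow> 'f lseq"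
  assumes g: "g \<in> GLbar"
  shows "\<exists>t. g ` W m \<subseteq> W t"
proof -
  obtain n where n: "g ` W n \<subseteq> W 0"
    using GLbarD(1,3)[OF g] continuous_lin_iff by blast
  have "\<exists>T. \<forall>v. g v \<in> W (T v)" by (intro choice allI ex_W)
  then obtain T where T: "\<And>v. g v \<in> W (T v)" by blast
  define t where "t = Max (insert 0 (T ` band n m))"
  have t: "0 \<le> t" "T v \<le> t" if "v \<in> band n m" for v
    unfolding t_def using that finite_band[of n m, where 'a = 'f] by (auto intro: Max_ge)
  have "g v \<in> W t" if "v \<in> W m" for v
  proof -
    have tr: "trunc n v \<in> band n m" using that by (auto simp: band_iff W_iff)
    have "v - trunc n v \<in> W n" by (simp add: W_iff)
    then have "g (v - trunc n v) \<in> W t" using n W_mono[OF t(1)[OF tr]] by blast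
    moreover have "g (trunc n v) \<in> W t" using T W_mono[OF t(2)[OF tr]] by blast
    ultimately show ?thesis using W_add by (fastforce simp: lin_diff[OF GLbarD(1)[OF g]])
  qed
  then show ?thesis by blast
qed

text \<open>The subgroup \<open>U\<close> is a finite disjoint union of cosets of \<open>W s\<close>, with representatives in
\<open>band s t\<close>.\<close>

lemma emeasure_haar_subgroup:
  fixes U :: "'f::{ab_group_add, finite} lseq set"
  assumes add: "\<And>v w. v \<in> U \<Longrightarrow> w \<in> U \<Longrightarrow> v + w \<in> U"
    and s: "W s \<subseteq> U" and t: "U \<subseteq> W t"
  shows "emeasure haar U = of_nat (card (U \<inter> band s t)) * emeasure haar (W s :: 'f lseq set)"
proof -
  have inv: "emeasure haar ((+) u ` W s) = emeasure haar (W s :: 'f lseq set)" for u :: "'f lseq"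
    using haar_measure_haar wcoset_borel[of 0 s] unfolding haar_measure_def W_eq_wcoset by blast
  have coset: "wcoset u s = (+) u ` W s" for u :: "'f lseq"
    unfolding translate_image_eq by (auto simp: wcoset_def algebra_simps)
  have "U = (\<Union>u\<in>U \<inter> band s t. wcoset u s)"
  proof (intro equalityI subsetI)
    fix v assume v: "v \<in> U"
    have "trunc s v - v \<in> W s" by (simp add: W_iff)
    then have "v + (trunc s v - v) \<in> U" using v s by (intro add) auto
    then have "trunc s v \<in> U \<inter> band s t"
      using t trunc_in_transversal[of s v] by (auto simp: band_def)
    then show "v \<in> (\<Union>u\<in>U \<inter> band s t. wcoset u s)" using trunc_wcoset by blast
  next
    fix v assume "v \<in> (\<Union>u\<in>U \<inter> band s t. wcoset u s)"
    then obtain u where "u \<in> U" "v - u \<in> U" using s by (auto simp: wcoset_def)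
    then show "v \<in> U" using add[of u "v - u"] by simp
  qed
  also have "emeasure haar \<dots> = (\<Sum>u\<in>U \<inter> band s t. emeasure haar (wcoset u s))"
    using disjoint_wcosets[of s] wcoset_borel finite_band[of s t, where 'a = 'f]
    by (intro sum_emeasure[symmetric]) (auto simp: disjoint_family_on_def band_def haar_def)
  also have "\<dots> = of_nat (card (U \<inter> band s t)) * emeasure haar (W s :: 'f lseq set)"
    by (simp add: coset inv)
  finally show ?thesis .
qed

text \<open>This is where the invariance of the Haar measure under \<open>g\<close> enters: \<open>g W m\<close> and \<open>W m\<close> have the
same measure, hence the same index over \<open>W s\<close>.\<close>

lemma card_GLbar_image_W:
  fixes g :: "'f::{field, finite} lseq \<Rightarrow> 'f lseq"
  assumes g: "g \<in> GLbar" and s: "W s \<subseteq> g ` W m" and t: "g ` W m \<subseteq> W t" and sm: "s \<le> m"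
  shows "card (g ` W m \<inter> band s t) = CARD('f) ^ nat (m - s)"
proof -
  have W: "emeasure haar (W m :: 'f lseq set) =
      of_nat (card (W m \<inter> band s m :: 'f lseq set)) * emeasure haar (W s :: 'f lseq set)"
    by (rule emeasure_haar_subgroup[OF _ W_mono[OF sm] order_refl]) (rule W_add)
  have gW: "emeasure haar (g ` W m) =
      of_nat (card (g ` W m \<inter> band s t)) * emeasure haar (W s :: 'f lseq set)"
  proof (rule emeasure_haar_subgroup[OF _ s t])
    fix v w assume "v \<in> g ` W m" "w \<in> g ` W m"
    then obtain v' w' where "v' \<in> W m" "w' \<in> W m" "v = g v'" "w = g w'" by blast
    then show "v + w \<in> g ` W m"
      using W_add[of v' m w'] lin_add[OF GLbarD(1)[OF g], of v' w'] by (simp add: rev_image_eqI)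
  qed
  have "emeasure haar (g ` W m) = emeasure haar (W m :: 'f lseq set)"
    using GLbarD(5)[OF g haar_measure_haar] wcoset_borel[of 0 m] by (simp add: W_eq_wcoset)
  then have eq: "of_nat (card (g ` W m \<inter> band s t)) * emeasure haar (W s :: 'f lseq set) =
      of_nat (card (W m \<inter> band s m :: 'f lseq set)) * emeasure haar (W s :: 'f lseq set)"
    by (simp only: W gW)
  have "open (W s :: 'f lseq set) \<and> (W s :: 'f lseq set) \<noteq> {}"
    using open_wcoset[of "0 :: 'f lseq" s] wcoset_refl[of "0 :: 'f lseq" s] unfolding W_eq_wcoset by auto
  moreover have "\<forall>U :: 'f lseq set. open U \<and> U \<noteq> {} \<longrightarrow> emeasure haar U > 0"
    using haar_measure_haar unfolding haar_measure_def by (elim conjE)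
  ultimately have "emeasure haar (W s :: 'f lseq set) > 0" by (elim allE impE)
  then have "emeasure haar (W s :: 'f lseq set) \<noteq> 0" by simp
  moreover have "emeasure haar (W s :: 'f lseq set) \<noteq> \<infinity>"
    using emeasure_haar_W_finite[of s, where 'a = 'f] by simp
  ultimately have "(of_nat (card (g ` W m \<inter> band s t)) :: ennreal) =
      of_nat (card (W m \<inter> band s m :: 'f lseq set))"
    using arg_cong[OF eq, of "\<lambda>x. x / emeasure haar (W s :: 'f lseq set)"]
    by (simp add: mult_divide_eq_ennreal)
  then have "card (g ` W m \<inter> band s t) = card (W m \<inter> band s m :: 'f lseq set)" by simp
  also have "W m \<inter> band s m = (band s m :: 'f lseq set)" by (auto simp: band_def)
  finally show ?thesis by (simp add: card_band)
qed

text \<open>A form of the definition that is symmetric in \<open>g\<close> and its inverse; the two equations for the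
images of \<open>W t\<close> and \<open>W s\<close> are replaced by inclusions for both maps.\<close>

lemma Qbar_iff:
  fixes g :: "'a::field lseq \<Rightarrow> 'a lseq"
  assumes "s \<le> t"
  shows "g \<in> Qbar (s, t) \<longleftrightarrow>
    g \<in> GLbar \<and> (\<forall>v\<in>W t. g v - v \<in> W s) \<and> (\<forall>v\<in>W t. ginv g v - v \<in> W s)"
proof
  assume Q: "g \<in> Qbar (s, t)"
  then have g: "g \<in> GLbar" "g ` W t = W t" "\<And>v. v \<in> W t \<Longrightarrow> g v - v \<in> W s"
    by (auto simp: Qbar_def)
  have "ginv g v - v \<in> W s" if v: "v \<in> W t" for v
  proof -
    obtain u where u: "u \<in> W t" "v = g u" using v g(2) by blast
    have "ginv g v = u" unfolding u(2) by (rule inv_f_f[OF bij_is_inj[OF GLbarD(2)[OF g(1)]]])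
    then show ?thesis using W_diff_commute[OF g(3)[OF u(1)]] u(2) by simp
  qed
  then show "g \<in> GLbar \<and> (\<forall>v\<in>W t. g v - v \<in> W s) \<and> (\<forall>v\<in>W t. ginv g v - v \<in> W s)"
    using g by simp
next
  assume R: "g \<in> GLbar \<and> (\<forall>v\<in>W t. g v - v \<in> W s) \<and> (\<forall>v\<in>W t. ginv g v - v \<in> W s)"
  have sub: "h v \<in> W m" if "\<forall>v\<in>W t. h v - v \<in> W s" "v \<in> W m" "s \<le> m" "m \<le> t"
    for h and v :: "'a lseq" and m
  proof -
    have "v \<in> W t" using that by (simp add: W_iff)
    then have "h v - v \<in> W s" using that(1) by simp
    then have "h v - v \<in> W m" using that(3) by (simp add: W_iff)
    from W_add[OF this that(2)] show ?thesis by simp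
  qed
  have "g ` W m = W m" if "s \<le> m" "m \<le> t" for m
  proof (intro equalityI subsetI)
    fix v :: "'a lseq" assume "v \<in> W m"
    then have "ginv g v \<in> W m" using sub[of "ginv g" v m] R that by simp
    moreover have "v = g (ginv g v)" using surj_f_inv_f[OF bij_is_surj[OF GLbarD(2)], of g v] R by simp
    ultimately show "v \<in> g ` W m" by (rule rev_image_eqI)
  next
    fix v assume "v \<in> g ` W m"
    then obtain u where "u \<in> W m" "v = g u" by blast
    then show "v \<in> W m" using sub[of g u m] R that by simp
  qed
  then show "g \<in> Qbar (s, t)" using R assms by (simp add: Qbar_def)
qed

lemma Qbar_GLbar: "g \<in> Qbar \<alpha> \<Longrightarrow> g \<in> GLbar"
  by (simp add: Qbar_def)

lemma Qbar_id: "id \<in> Qbar \<alpha>"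
  by (simp add: Qbar_def GLbar_id)

lemma Qbar_comp:
  assumes g: "g \<in> Qbar \<alpha>" and h: "h \<in> Qbar \<alpha>"
  shows "g \<circ> h \<in> Qbar \<alpha>"
proof -
  have "g (h v) - v \<in> W (fst \<alpha>)" if v: "v \<in> W (snd \<alpha>)" for v
  proof -
    have "g (h v) - h v \<in> W (fst \<alpha>)" "h v - v \<in> W (fst \<alpha>)"
      using g h v by (auto simp: Qbar_def)
    from W_add[OF this] show ?thesis by simp
  qed
  moreover have "(g \<circ> h) ` X = g ` h ` X" for X by (simp add: image_comp)
  ultimately show ?thesis
    using g h unfolding Qbar_def by (simp add: GLbar_comp)
qed

lemma Qbar_inv:
  assumes "g \<in> Qbar \<alpha>" "\<alpha> \<in> idx"
  shows "ginv g \<in> Qbar \<alpha>"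
proof -
  have st: "fst \<alpha> \<le> snd \<alpha>" using assms(2) by (simp add: idx_def)
  have "g \<in> Qbar (fst \<alpha>, snd \<alpha>)" using assms(1) by simp
  then have "ginv g \<in> Qbar (fst \<alpha>, snd \<alpha>)"
    unfolding Qbar_iff[OF st] by (simp add: GLbar_inv GLbarD(2) inv_inv_eq)
  then show ?thesis by simp
qed

text \<open>An operator that is trivial on \<open>W t / W s\<close> stabilizes every \<open>W m\<close> with \<open>s \<le> m \<le> t\<close>.\<close>

lemma Qbar_antimono:
  fixes g :: "'a::field lseq \<Rightarrow> 'a lseq"
  assumes g: "g \<in> Qbar (s, t)" and "s \<le> fst \<alpha>" "fst \<alpha> \<le> snd \<alpha>" "snd \<alpha> \<le> t"
  shows "g \<in> Qbar \<alpha>"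
proof -
  have "s \<le> t" using assms by simp
  note Q = g[unfolded Qbar_iff[OF \<open>s \<le> t\<close>]]
  have sub: "v \<in> W s \<Longrightarrow> v \<in> W (fst \<alpha>)" "v \<in> W (snd \<alpha>) \<Longrightarrow> v \<in> W t" for v :: "'a lseq"
    using assms by (auto simp: W_iff)
  have "g \<in> Qbar (fst \<alpha>, snd \<alpha>)"
    unfolding Qbar_iff[OF assms(3)] using Q sub by simp
  then show ?thesis by simp
qed

section \<open>Finitary matrices and their operators\<close>

interpretation vs: vector_space "vscale :: 'f::field \<Rightarrow> 'f lseq \<Rightarrow> 'f lseq"
  by (rule vector_space_vscale)

lemma coord_sum: "coord (\<Sum>i\<in>I. f i :: 'a::ab_group_add lseq) j = (\<Sum>i\<in>I. coord (f i) j)"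
  by (induction I rule: infinite_finite_induct) simp_all

lemma id_outsideD:
  "id_outside s t A \<Longrightarrow> \<not> (s < i \<and> i \<le> t) \<or> \<not> (s < j \<and> j \<le> t) \<Longrightarrow> A i j = id_mat i j"
  unfolding id_outside_def by blast

lemma id_outside_mono: "id_outside s t A \<Longrightarrow> s' \<le> s \<Longrightarrow> t \<le> t' \<Longrightarrow> id_outside s' t' A"
  unfolding id_outside_def by force

lemma finitary_id_outside:
  assumes "finitary A"
  shows "\<exists>s t. id_outside s t A"
proof -
  define X where "X = {(i, j). A i j \<noteq> id_mat i j}"
  define Y where "Y = insert 0 (fst ` X \<union> snd ` X)"
  have Y: "finite Y" using assms unfolding Y_def X_def finitary_def by simp
  have "A i j = id_mat i j" if "\<not> (Min Y - 1 < i \<and> i \<le> Max Y \<and> Min Y - 1 < j \<and> j \<le> Max Y)" for i j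
  proof (rule ccontr)
    assume "A i j \<noteq> id_mat i j"
    then have "(i, j) \<in> X" by (simp add: X_def)
    then have "i \<in> Y" "j \<in> Y" by (force simp: Y_def)+
    then have "Min Y \<le> i" "i \<le> Max Y" "Min Y \<le> j" "j \<le> Max Y" using Y by simp_all
    then show False using that by simp
  qed
  then show ?thesis unfolding id_outside_def by blast
qed

lemma id_outside_finitary:
  assumes "id_outside s t A"
  shows "finitary A"
  unfolding finitary_def
proof (rule finite_subset)
  show "{(i, j). A i j \<noteq> id_mat i j} \<subseteq> {s<..t} \<times> {s<..t}"
  proof clarify
    fix i j assume "A i j \<noteq> id_mat i j"
    then show "i \<in> {s<..t} \<and> j \<in> {s<..t}" using id_outsideD[OF assms, of i j] by auto
  qed
qed simp

lemma id_outside_id_mat: "id_outside s t id_mat"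
  by (simp add: id_outside_def)

text \<open>The support of a row depends on the row; this replaces it by the fixed interval \<open>(s, t]\<close>.\<close>

lemma sum_row:
  assumes "id_outside s t A"
  shows "(\<Sum>j | A i j \<noteq> 0. A i j * f j) =
    (if s < i \<and> i \<le> t then \<Sum>j\<in>{s<..t}. A i j * f j else f i)"
proof (cases "s < i \<and> i \<le> t")
  case True
  have "j \<in> {s<..t}" if j: "A i j \<noteq> 0" for j
  proof (rule ccontr)
    assume "j \<notin> {s<..t}"
    then have "A i j = id_mat i j" "i \<noteq> j" using True id_outsideD[OF assms, of i j] by auto
    then show False using j by (simp add: id_mat_def)
  qed
  then have "{j. A i j \<noteq> 0} \<subseteq> {s<..t}" by auto
  then have "(\<Sum>j | A i j \<noteq> 0. A i j * f j) = (\<Sum>j\<in>{s<..t}. A i j * f j)"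
    by (intro sum.mono_neutral_left) auto
  then show ?thesis using True by simp
next
  case False
  then have A: "A i j = id_mat i j" for j using id_outsideD[OF assms, of i j] by simp
  have "{j. A i j \<noteq> 0} = {i}" unfolding A by (simp add: id_mat_def)
  then show ?thesis unfolding if_not_P[OF False] by (simp add: A id_mat_def)
qed

lemma coord_mat_op:
  assumes "id_outside s t A"
  shows "coord (mat_op A v) i =
    (if s < i \<and> i \<le> t then \<Sum>j\<in>{s<..t}. A i j * coord v j else coord v i)"
proof -
  obtain m where m: "\<forall>j>m. coord v j = 0" using coord_eventually_zero by blast
  show ?thesis
    unfolding mat_op_def sum_row[OF assms]
    by (subst coord_Abs_lseq[of "max m t"]) (use m in auto)
qed

lemma mat_mult_eq:
  assumes "id_outside s t A"
  shows "mat_mult A B i k = (if s < i \<and> i \<le> t then \<Sum>j\<in>{s<..t}. A i j * B j k else B i k)"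
  unfolding mat_mult_def by (rule sum_row[OF assms])

lemma id_outside_mat_mult:
  assumes A: "id_outside s t A" and B: "id_outside s t B"
  shows "id_outside s t (mat_mult A B)"
  unfolding id_outside_def
proof (intro allI impI)
  fix i k assume *: "\<not> (s < i \<and> i \<le> t \<and> s < k \<and> k \<le> t)"
  show "mat_mult A B i k = id_mat i k"
  proof (cases "s < i \<and> i \<le> t")
    case True
    then have k: "\<not> (s < k \<and> k \<le> t)" using * by blast
    have "B j k = 0" if "j \<in> {s<..t}" for j
      using id_outsideD[OF B, of j k] k that by (auto simp: id_mat_def)
    moreover have "id_mat i k = (0 :: 'a)" using True k by (auto simp: id_mat_def)
    ultimately show ?thesis using True by (simp add: mat_mult_eq[OF A])
  next
    case False
    then show ?thesis using id_outsideD[OF B, of i k] by (auto simp: mat_mult_eq[OF A])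
  qed
qed

lemma mat_op_mat_mult:
  assumes A: "id_outside s t A" and B: "id_outside s t B"
  shows "mat_op (mat_mult A B) = mat_op A \<circ> mat_op B"
proof
  fix v show "mat_op (mat_mult A B) v = (mat_op A \<circ> mat_op B) v"
  proof (rule lseq_eqI)
    fix i
    show "coord (mat_op (mat_mult A B) v) i = coord ((mat_op A \<circ> mat_op B) v) i"
    proof (cases "s < i \<and> i \<le> t")
      case True
      have "coord (mat_op (mat_mult A B) v) i =
          (\<Sum>k\<in>{s<..t}. \<Sum>j\<in>{s<..t}. A i j * B j k * coord v k)"
        using True by (simp add: coord_mat_op[OF id_outside_mat_mult[OF A B]] mat_mult_eq[OF A] sum_distrib_right)
      also have "\<dots> = (\<Sum>j\<in>{s<..t}. A i j * (\<Sum>k\<in>{s<..t}. B j k * coord v k))"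
        by (subst sum.swap) (simp add: sum_distrib_left mult.assoc)
      also have "\<dots> = coord ((mat_op A \<circ> mat_op B) v) i"
        using True by (simp add: coord_mat_op[OF A] coord_mat_op[OF B])
      finally show ?thesis .
    next
      case False
      then show ?thesis
        by (auto simp: coord_mat_op[OF id_outside_mat_mult[OF A B]] coord_mat_op[OF A] coord_mat_op[OF B])
    qed
  qed
qed

lemma mat_op_id_mat: "mat_op id_mat = id"
proof
  fix v :: "'a lseq"
  show "mat_op id_mat v = id v"
    by (rule lseq_eqI) (auto simp: coord_mat_op[OF id_outside_id_mat[of 0 0]])
qed

lemma lin_mat_op:
  assumes "id_outside s t A"
  shows "lin (mat_op A)"
  unfolding lin_iff
  by (auto intro!: lseq_eqI simp: coord_mat_op[OF assms] sum.distrib algebra_simps sum_distrib_left)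

lemma mat_op_fixes_W:
  assumes "id_outside s t A" "v \<in> W s"
  shows "mat_op A v = v"
proof (rule lseq_eqI)
  fix i show "coord (mat_op A v) i = coord v i"
    using assms(2) by (auto simp: coord_mat_op[OF assms(1)] W_iff)
qed

lemma mat_op_diff_in_band:
  assumes "id_outside s t A"
  shows "mat_op A v - v \<in> band s t"
  by (auto simp: band_iff coord_mat_op[OF assms])

lemma GL2inf_inverse:
  assumes "A \<in> GL2inf"
  obtains B where "B \<in> GL2inf" "ginv (mat_op A) = mat_op B" "bij (mat_op A)"
    "mat_op A \<circ> mat_op B = id" "mat_op B \<circ> mat_op A = id"
proof -
  obtain B where B: "finitary A" "finitary B" "mat_mult A B = id_mat" "mat_mult B A = id_mat"
    using assms by (auto simp: GL2inf_def)
  obtain s t where "id_outside s t A" using finitary_id_outside[OF B(1)] by blast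
  moreover obtain s' t' where "id_outside s' t' B" using finitary_id_outside[OF B(2)] by blast
  ultimately have AB: "id_outside (min s s') (max t t') A" "id_outside (min s s') (max t t') B"
    by (auto intro: id_outside_mono)
  have 1: "mat_op A \<circ> mat_op B = id" and 2: "mat_op B \<circ> mat_op A = id"
    using mat_op_mat_mult[OF AB] mat_op_mat_mult[OF AB(2,1)] B by (simp_all add: mat_op_id_mat)
  show ?thesis
  proof (rule that)
    show "B \<in> GL2inf" unfolding GL2inf_def using B by auto
    show "bij (mat_op A)" by (rule o_bij[OF 2 1])
    show "ginv (mat_op A) = mat_op B" by (rule inv_unique_comp[OF 1 2])
  qed (fact 1 2)+
qed

lemma mat_op_GLbar:
  fixes A :: "int \<Rightarrow> int \<Rightarrow> 'f::{field, finite}"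
  assumes "A \<in> GL2inf"
  shows "mat_op A \<in> GLbar"
proof -
  obtain s t where "id_outside s t A"
    using assms finitary_id_outside unfolding GL2inf_def by blast
  moreover obtain B where "bij (mat_op A)" using GL2inf_inverse[OF assms] .
  ultimately show ?thesis by (intro GLbarI_fixes_W lin_mat_op mat_op_fixes_W)
qed

definition unit_vec :: "int \<Rightarrow> 'f::field lseq" where
  "unit_vec j = Abs_lseq (\<lambda>i. id_mat i j)"

lemma coord_unit_vec [simp]: "coord (unit_vec j) i = id_mat i j"
  unfolding unit_vec_def by (subst coord_Abs_lseq[of j]) (auto simp: id_mat_def)

text \<open>Linear combinations of a family indexed by the interval \<open>(s, k]\<close>. Families, rather than sets, of
vectors are used because they become the columns of a matrix.\<close>

definition comb :: "int \<Rightarrow> int \<Rightarrow> (int \<Rightarrow> 'f::field lseq) \<Rightarrow> (int \<Rightarrow> 'f) \<Rightarrow> 'f lseq" where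
  "comb s k b c = (\<Sum>j\<in>{s<..k}. vscale (c j) (b j))"

definition indep :: "int \<Rightarrow> int \<Rightarrow> (int \<Rightarrow> 'f::field lseq) \<Rightarrow> bool" where
  "indep s k b \<longleftrightarrow> (\<forall>c. comb s k b c = 0 \<longrightarrow> (\<forall>j\<in>{s<..k}. c j = 0))"

lemma comb_cong: "(\<And>j. s < j \<Longrightarrow> j \<le> k \<Longrightarrow> c j = d j) \<Longrightarrow> (\<And>j. s < j \<Longrightarrow> j \<le> k \<Longrightarrow> b j = b' j) \<Longrightarrow>
    comb s k b c = comb s k b' d"
  unfolding comb_def by (rule sum.cong) auto

lemma comb_split:
  assumes "s \<le> k" "k \<le> m"
  shows "comb s m b c = comb s k b c + comb k m b c"
proof -
  have "{s<..m} = {s<..k} \<union> {k<..m}" using assms by auto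
  then show ?thesis unfolding comb_def by (simp add: sum.union_disjoint)
qed

lemma comb_diff: "comb s k b (\<lambda>j. c j - d j) = comb s k b c - comb s k b d"
  unfolding comb_def by (simp add: vs.scale_left_diff_distrib sum_subtractf)

lemma comb_vscale: "comb s k b (\<lambda>j. a * c j) = vscale a (comb s k b c)"
  unfolding comb_def by (simp add: vs.scale_sum_right)

lemma comb_in_subspace:
  assumes "vs.subspace S" "\<And>j. s < j \<Longrightarrow> j \<le> k \<Longrightarrow> b j \<in> S"
  shows "comb s k b c \<in> S"
  unfolding comb_def using assms by (intro vs.subspace_sum vs.subspace_scale) auto

lemma lin_comb: "lin g \<Longrightarrow> g (comb s k b c) = comb s k (\<lambda>j. g (b j)) c"
  unfolding comb_def by (simp add: lin_sum lin_vscale)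

lemma coord_comb_unit_vec: "coord (comb s k unit_vec c) i = (if s < i \<and> i \<le> k then c i else 0)"
  by (simp add: comb_def coord_sum id_mat_def if_distrib sum.delta cong: if_cong)

lemma indep_inj:
  assumes "indep s k b"
  shows "inj_on (comb s k b) ({s<..k} \<rightarrow>\<^sub>E UNIV)"
proof (rule inj_onI)
  fix c d assume cd: "c \<in> {s<..k} \<rightarrow>\<^sub>E UNIV" "d \<in> {s<..k} \<rightarrow>\<^sub>E UNIV" "comb s k b c = comb s k b d"
  then have "comb s k b (\<lambda>j. c j - d j) = 0" by (simp add: comb_diff)
  then have "c j = d j" if "j \<in> {s<..k}" for j
    using assms[unfolded indep_def, rule_format, of "\<lambda>j. c j - d j" j] that by simp
  then show "c = d" using cd by (auto intro: PiE_ext)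
qed

lemma range_comb: "range (comb s k b) = comb s k b ` ({s<..k} \<rightarrow>\<^sub>E UNIV)"
proof (intro equalityI subsetI)
  fix x assume "x \<in> range (comb s k b)"
  then obtain c where "x = comb s k b c" by blast
  then have "x = comb s k b (restrict c {s<..k})" by (auto intro: comb_cong)
  moreover have "restrict c {s<..k} \<in> {s<..k} \<rightarrow>\<^sub>E UNIV" by simp
  ultimately show "x \<in> comb s k b ` ({s<..k} \<rightarrow>\<^sub>E UNIV)" by (rule image_eqI)
qed auto

lemma card_coefficients:
  "card ({s<..k} \<rightarrow>\<^sub>E (UNIV :: 'f::finite set)) = CARD('f) ^ nat (k - s)"
  by (simp add: card_PiE)

text \<open>The combinations of the family are fewer in number than the elements of \<open>S\<close>, so some element of
\<open>S\<close> is not among them.\<close>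

lemma indep_extend1:
  fixes b :: "int \<Rightarrow> 'f::{field, finite} lseq"
  assumes b: "indep s k b" and sk: "s \<le> k" and S: "CARD('f) ^ nat (k - s) < card S"
  obtains x where "x \<in> S" "indep s (k + 1) (b(k + 1 := x))"
proof -
  have "card (range (comb s k b)) \<le> CARD('f) ^ nat (k - s)"
    unfolding range_comb card_coefficients[symmetric] by (rule card_image_le) (simp add: finite_PiE)
  moreover have "finite (range (comb s k b))" unfolding range_comb by (simp add: finite_PiE)
  ultimately have "\<not> S \<subseteq> range (comb s k b)"
    using S card_mono[of "range (comb s k b)" S] by linarith
  then obtain x where x: "x \<in> S" "\<And>c. x \<noteq> comb s k b c" by blast
  have "indep s (k + 1) (b(k + 1 := x))"
    unfolding indep_def
  proof (intro allI impI)
    fix c assume c: "comb s (k + 1) (b(k + 1 := x)) c = 0"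
    have "{k<..k + 1} = {k + 1}" by auto
    moreover have "comb s k (b(k + 1 := x)) c = comb s k b c" by (rule comb_cong) auto
    ultimately have eq: "comb s k b c + vscale (c (k + 1)) x = 0"
      using c comb_split[OF sk, of "k + 1" "b(k + 1 := x)" c] by (simp add: comb_def[of k])
    have ck: "c (k + 1) = 0"
    proof (rule ccontr)
      assume nz: "c (k + 1) \<noteq> 0"
      have "vscale (c (k + 1)) x = - comb s k b c" using eq by (simp add: eq_neg_iff_add_eq_0 add.commute)
      then have "vscale (inverse (c (k + 1))) (vscale (c (k + 1)) x) =
          vscale (- inverse (c (k + 1))) (comb s k b c)" by simp
      then have "x = vscale (- inverse (c (k + 1))) (comb s k b c)" using nz by simp
      then show False using x(2)[of "\<lambda>j. - inverse (c (k + 1)) * c j"] by (simp add: comb_vscale[symmetric])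
    qed
    then have "\<forall>j\<in>{s<..k}. c j = 0" using b eq unfolding indep_def by simp
    moreover have "j \<in> {s<..k} \<or> j = k + 1" if "j \<in> {s<..k + 1}" for j using that by auto
    ultimately show "\<forall>j\<in>{s<..k + 1}. c j = 0" using ck by blast
  qed
  then show ?thesis using x(1) that by blast
qed

text \<open>Extension to a basis, with dimensions expressed through numbers of elements: a space of
dimension \<open>m - s\<close> over a field with \<open>q\<close> elements has \<open>q ^ (m - s)\<close> elements.\<close>

lemma indep_extend:
  fixes b :: "int \<Rightarrow> 'f::{field, finite} lseq"
  assumes b: "indep s k b" and sk: "s \<le> k" and km: "k \<le> m" and S: "card S = CARD('f) ^ nat (m - s)"
  obtains b' where "indep s m b'" "\<And>j. j \<le> k \<Longrightarrow> b' j = b j" "\<And>j. k < j \<Longrightarrow> j \<le> m \<Longrightarrow> b' j \<in> S"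
proof -
  have q: "1 < CARD('f)"
    using card_mono[of UNIV "{0, 1 :: 'f}"] by simp
  have "n \<le> m \<longrightarrow> (\<exists>b'. indep s n b' \<and> (\<forall>j\<le>k. b' j = b j) \<and> (\<forall>j. k < j \<and> j \<le> n \<longrightarrow> b' j \<in> S))"
    if "k \<le> n" for n
    using that
  proof (induction n rule: int_ge_induct)
    case base
    show ?case using b by (intro impI exI[of _ b]) auto
  next
    case (step n)
    show ?case
    proof
      assume nm: "n + 1 \<le> m"
      then obtain b' where b': "indep s n b'" "\<forall>j\<le>k. b' j = b j" "\<forall>j. k < j \<and> j \<le> n \<longrightarrow> b' j \<in> S"
        using step.IH by auto
      have "CARD('f) ^ nat (n - s) < card S"
        unfolding S using q nm step.hyps sk by (intro power_strict_increasing) auto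
      then obtain x where x: "x \<in> S" "indep s (n + 1) (b'(n + 1 := x))"
        using indep_extend1[OF b'(1)] sk step.hyps by force
      show "\<exists>b'. indep s (n + 1) b' \<and> (\<forall>j\<le>k. b' j = b j) \<and> (\<forall>j. k < j \<and> j \<le> n + 1 \<longrightarrow> b' j \<in> S)"
        using b' x step.hyps by (intro exI[of _ "b'(n + 1 := x)"]) auto
    qed
  qed
  then show ?thesis using km that by blast
qed

lemma indep_spans:
  fixes b :: "int \<Rightarrow> 'f::{field, finite} lseq"
  assumes b: "indep s m b" and S: "vs.subspace S" "finite S" "card S = CARD('f) ^ nat (m - s)"
    and bS: "\<And>j. s < j \<Longrightarrow> j \<le> m \<Longrightarrow> b j \<in> S"
  shows "range (comb s m b) = S"
proof (rule card_subset_eq[OF S(2)])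
  show "range (comb s m b) \<subseteq> S"
  proof clarify
    fix c show "comb s m b c \<in> S" by (rule comb_in_subspace[OF S(1) bS])
  qed
  show "card (range (comb s m b)) = card S"
    unfolding range_comb S(3) by (simp add: card_image[OF indep_inj[OF b]] card_coefficients)
qed

lemma subspace_W: "vs.subspace (W m)"
  by (rule vs.subspaceI) (auto intro: W_add W_vscale)

lemma subspace_band: "vs.subspace (band s t)"
  by (rule vs.subspaceI) (auto simp: band_iff)

lemma subspace_lin_image:
  assumes "lin g" "vs.subspace S"
  shows "vs.subspace (g ` S)"
proof (rule vs.subspaceI)
  show "0 \<in> g ` S" using lin_zero[OF assms(1)] vs.subspace_0[OF assms(2)] by (metis imageI)
next
  fix x y assume "x \<in> g ` S" "y \<in> g ` S"
  then obtain u v where "u \<in> S" "v \<in> S" "x = g u" "y = g v" by blast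
  then show "x + y \<in> g ` S"
    using lin_add[OF assms(1), of u v] vs.subspace_add[OF assms(2), of u v] by (simp add: rev_image_eqI)
next
  fix c x assume "x \<in> g ` S"
  then obtain u where "u \<in> S" "x = g u" by blast
  then show "vscale c x \<in> g ` S"
    using lin_vscale[OF assms(1), of c u] vs.subspace_scale[OF assms(2), of u c] by (simp add: rev_image_eqI)
qed

lemma lin_trunc: "lin (trunc s)"
  unfolding lin_iff by (auto intro!: lseq_eqI)

lemma diff_trunc_in_W: "v - trunc s v \<in> W s"
  by (simp add: W_iff)

definition columns_mat :: "int \<Rightarrow> int \<Rightarrow> (int \<Rightarrow> 'f::field lseq) \<Rightarrow> int \<Rightarrow> int \<Rightarrow> 'f" where
  "columns_mat s t b i j = (if s < j \<and> j \<le> t then coord (b j) i else id_mat i j)"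

lemma id_outside_columns_mat:
  assumes "\<And>j. s < j \<Longrightarrow> j \<le> t \<Longrightarrow> b j \<in> band s t"
  shows "id_outside s t (columns_mat s t b)"
  unfolding id_outside_def
proof (intro allI impI)
  fix i j assume *: "\<not> (s < i \<and> i \<le> t \<and> s < j \<and> j \<le> t)"
  show "columns_mat s t b i j = id_mat i j"
  proof (cases "s < j \<and> j \<le> t")
    case True
    then have "coord (b j) i = 0" "i \<noteq> j" using assms[of j] * by (auto simp: band_iff)
    then show ?thesis using True by (simp add: columns_mat_def id_mat_def)
  next
    case False
    then show ?thesis unfolding columns_mat_def by (simp only: if_False)
  qed
qed

lemma mat_op_columns_mat:
  assumes "\<And>j. s < j \<Longrightarrow> j \<le> t \<Longrightarrow> b j \<in> band s t" and "v \<in> W t"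
  shows "mat_op (columns_mat s t b) v = (v - trunc s v) + comb s t b (coord v)"
proof (rule lseq_eqI)
  fix i
  have "coord (b j) i = 0" if "\<not> (s < i \<and> i \<le> t)" "j \<in> {s<..t}" for j
    using assms(1)[of j] that by (simp add: band_iff)
  then have "(\<Sum>j\<in>{s<..t}. coord v j * coord (b j) i) = 0" if "\<not> (s < i \<and> i \<le> t)"
    using that by (simp add: sum.neutral)
  moreover have "(\<Sum>j\<in>{s<..t}. columns_mat s t b i j * coord v j) =
      (\<Sum>j\<in>{s<..t}. coord v j * coord (b j) i)"
    by (rule sum.cong) (auto simp: columns_mat_def)
  moreover have "t < i \<Longrightarrow> coord v i = 0" using assms(2) by (simp add: W_iff)
  ultimately show "coord (mat_op (columns_mat s t b) v) i = coord ((v - trunc s v) + comb s t b (coord v)) i"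
    by (auto simp: coord_mat_op[OF id_outside_columns_mat[OF assms(1)]] comb_def coord_sum)
qed

text \<open>The unit vectors are combinations of the columns, and the coefficients form a right inverse. It
is a left inverse as well, since by linear independence the combinations of columns given by the
product in the other order determine their coefficients.\<close>

lemma columns_mat_GL2inf:
  fixes b :: "int \<Rightarrow> 'f::{field, finite} lseq"
  assumes b: "\<And>j. s < j \<Longrightarrow> j \<le> t \<Longrightarrow> b j \<in> band s t" and indep: "indep s t b"
  shows "columns_mat s t b \<in> GL2inf"
proof -
  let ?A = "columns_mat s t b"
  have A: "id_outside s t ?A" by (rule id_outside_columns_mat[OF b])
  have range: "range (comb s t b) = band s t"
    by (rule indep_spans[OF indep subspace_band finite_band card_band b])
  have "\<exists>c. comb s t b c = unit_vec k" if "s < k" "k \<le> t" for k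
  proof -
    have "unit_vec k \<in> range (comb s t b)"
      unfolding range using that by (auto simp: band_iff id_mat_def)
    then show ?thesis by auto
  qed
  then obtain c where c: "\<And>k. s < k \<Longrightarrow> k \<le> t \<Longrightarrow> comb s t b (c k) = unit_vec k" by metis
  define C where "C j k = (if s < j \<and> j \<le> t \<and> s < k \<and> k \<le> t then c k j else id_mat j k)" for j k
  have C: "id_outside s t C" by (simp add: id_outside_def C_def)
  have AC: "mat_mult ?A C = id_mat"
  proof (intro ext)
    fix i k
    show "mat_mult ?A C i k = id_mat i k"
    proof (cases "s < i \<and> i \<le> t \<and> s < k \<and> k \<le> t")
      case True
      have "mat_mult ?A C i k = (\<Sum>j\<in>{s<..t}. c k j * coord (b j) i)"
        unfolding mat_mult_eq[OF A] using True by (auto simp: C_def columns_mat_def intro!: sum.cong)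
      also have "\<dots> = coord (comb s t b (c k)) i" by (simp add: comb_def coord_sum)
      finally show ?thesis using c True by simp
    next
      case False
      then show ?thesis by (rule id_outside_mat_mult[OF A C, unfolded id_outside_def, rule_format])
    qed
  qed
  have CA: "mat_mult C ?A = id_mat"
  proof (intro ext)
    fix j k
    show "mat_mult C ?A j k = id_mat j k"
    proof (cases "s < j \<and> j \<le> t \<and> s < k \<and> k \<le> t")
      case True
      have "comb s t b (\<lambda>j. mat_mult C ?A j k) = comb s t b (\<lambda>j. \<Sum>l\<in>{s<..t}. c l j * coord (b k) l)"
        using True by (intro comb_cong refl) (auto simp: mat_mult_eq[OF C] C_def columns_mat_def intro!: sum.cong)
      also have "\<dots> = (\<Sum>j\<in>{s<..t}. \<Sum>l\<in>{s<..t}. vscale (c l j * coord (b k) l) (b j))"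
        by (simp add: comb_def vs.scale_sum_left)
      also have "\<dots> = (\<Sum>l\<in>{s<..t}. vscale (coord (b k) l) (comb s t b (c l)))"
        by (subst sum.swap) (simp add: comb_def vs.scale_sum_right mult.commute)
      also have "\<dots> = (\<Sum>l\<in>{s<..t}. vscale (coord (b k) l) (unit_vec l))"
        using c by (intro sum.cong) auto
      also have "\<dots> = comb s t unit_vec (coord (b k))" by (simp add: comb_def)
      also have "\<dots> = b k"
        using b[of k] True by (intro lseq_eqI) (auto simp: coord_comb_unit_vec band_iff)
      also have "\<dots> = comb s t b (\<lambda>j. id_mat j k)"
        using True by (simp add: comb_def id_mat_def if_distrib[of "\<lambda>x. vscale x _"] sum.delta cong: if_cong)
      finally have "comb s t b (\<lambda>j. mat_mult C ?A j k - id_mat j k) = 0" by (simp add: comb_diff)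
      then have "mat_mult C ?A j k - id_mat j k = 0" using indep True unfolding indep_def by auto
      then show ?thesis by simp
    next
      case False
      then show ?thesis by (rule id_outside_mat_mult[OF C A, unfolded id_outside_def, rule_format])
    qed
  qed
  show ?thesis
    unfolding GL2inf_def using AC CA id_outside_finitary[OF A] id_outside_finitary[OF C] by blast
qed

text \<open>Put \<open>U = g W a\<close> and choose \<open>s\<close>, \<open>t\<close> with \<open>W s \<subseteq> U\<close> and \<open>g W b \<subseteq> W t\<close>. The columns of the matrix
are, in this order, a basis of \<open>U / W s\<close> for the indices in \<open>(s, a]\<close>, the images under \<open>g\<close> of
the unit vectors, taken modulo \<open>W s\<close>, for \<open>(a, b]\<close>, and a completion to a basis of \<open>W t / W s\<close>.
The count of indices is right because \<open>U / W s\<close> has dimension \<open>a - s\<close>. The resulting operator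
\<open>h\<close> maps \<open>W a\<close> onto \<open>U\<close> and agrees with \<open>g\<close> on \<open>W b\<close> modulo \<open>U\<close>, which says that \<open>h\<^sup>-\<^sup>1 g\<close> is in
\<open>Qbar (a, b)\<close>.\<close>

lemma finitary_approximation:
  fixes g :: "'f::{field, finite} lseq \<Rightarrow> 'f lseq"
  assumes g: "g \<in> GLbar" and ab: "a \<le> b"
  obtains A where "A \<in> GL2inf" "ginv (mat_op A) \<circ> g \<in> Qbar (a, b)"
proof -
  note lin = GLbarD(1)[OF g] and bij = GLbarD(2)[OF g]
  obtain s0 where s0: "W s0 \<subseteq> g ` W a" using GLbar_image_W_lower[OF g] by blast
  obtain t0 where t0: "g ` W b \<subseteq> W t0" using GLbar_image_W_upper[OF g] by blast
  define s t where "s = min s0 a" and "t = max t0 b"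
  have sa: "s \<le> a" and bt: "b \<le> t" by (simp_all add: s_def t_def)
  have sU: "W s \<subseteq> g ` W a" using s0 W_mono[of s s0] by (auto simp: s_def)
  have Ut: "g ` W b \<subseteq> W t" using t0 W_mono[of t0 t] by (auto simp: t_def)
  have Ut': "g ` W a \<subseteq> W t" using Ut image_mono[OF W_mono[OF ab], of g] by simp
  define U where "U = g ` W a"
  have U: "vs.subspace U" unfolding U_def by (rule subspace_lin_image[OF lin subspace_W])
  have WsU: "v \<in> U" if "v \<in> W s" for v using sU that unfolding U_def by (rule subsetD)
  have UU: "vs.subspace (U \<inter> band s t)" by (rule vs.subspace_inter[OF U subspace_band])
  have cardU: "card (U \<inter> band s t) = CARD('f) ^ nat (a - s)"
    unfolding U_def by (rule card_GLbar_image_W[OF g sU Ut' sa])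
  \<comment> \<open>A basis of \<open>U\<close> modulo \<open>W s\<close>.\<close>
  obtain b1 where b1: "indep s a b1" "\<And>j. s < j \<Longrightarrow> j \<le> a \<Longrightarrow> b1 j \<in> U \<inter> band s t"
  proof (rule indep_extend[OF _ order_refl sa cardU])
    show "indep s s (\<lambda>_. 0 :: 'f lseq)" by (simp add: indep_def)
  qed blast
  \<comment> \<open>Its continuation by the images of unit vectors, still independent since \<open>g\<close> is injective modulo \<open>U\<close>.\<close>
  define b2 where "b2 j = (if a < j then trunc s (g (unit_vec j)) else b1 j)" for j
  have comb1: "comb s a b2 c = comb s a b1 c" for c
    by (rule comb_cong) (auto simp: b2_def)
  have comb1U: "comb s a b1 c \<in> U \<inter> band s t" for c
    by (rule comb_in_subspace[OF UU b1(2)])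
  have comb2: "comb a b b2 c = trunc s (g (comb a b unit_vec c))" for c
    unfolding lin_comb[OF lin] lin_comb[OF lin_trunc] by (rule comb_cong) (auto simp: b2_def)
  have comb_sb: "comb s b b2 c = comb s a b1 c + trunc s (g (comb a b unit_vec c))" for c
    unfolding comb_split[OF sa ab] comb1 comb2 ..
  have indep2: "indep s b b2"
    unfolding indep_def
  proof (intro allI impI)
    fix c assume c: "comb s b b2 c = 0"
    define w where "w = comb a b unit_vec c"
    have "trunc s (g w) = - comb s a b1 c"
      using c unfolding comb_sb w_def by (simp add: eq_neg_iff_add_eq_0 add.commute)
    then have "trunc s (g w) \<in> U" using comb1U[of c] vs.subspace_neg[OF U] by simp
    from vs.subspace_add[OF U this WsU[OF diff_trunc_in_W[of "g w" s]]] have "g w \<in> U" by simp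
    then have "w \<in> W a" unfolding U_def by (simp add: inj_image_mem_iff[OF bij_is_inj[OF bij]])
    then have 1: "c j = 0" if "a < j" "j \<le> b" for j
      using that by (auto simp: w_def W_iff coord_comb_unit_vec)
    then have "comb a b unit_vec c = comb a b unit_vec (\<lambda>_. 0)" by (intro comb_cong) auto
    then have "comb a b unit_vec c = 0" by (simp add: comb_def)
    then have "comb s a b1 c = 0"
      using c unfolding comb_sb by (simp add: lin_zero[OF lin] lin_zero[OF lin_trunc])
    then have 2: "c j = 0" if "s < j" "j \<le> a" for j using b1(1) that unfolding indep_def by simp
    show "\<forall>j\<in>{s<..b}. c j = 0" using 1 2 by (metis greaterThanAtMost_iff linorder_not_less)
  qed
  have sb: "s \<le> b" using sa ab by simp
  obtain b3 where b3: "indep s t b3" "\<And>j. j \<le> b \<Longrightarrow> b3 j = b2 j" "\<And>j. b < j \<Longrightarrow> j \<le> t \<Longrightarrow> b3 j \<in> band s t"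
    by (rule indep_extend[OF indep2 sb bt card_band]) blast
  have b3f: "b3 j \<in> band s t" if "s < j" "j \<le> t" for j
  proof (cases "b < j")
    case False
    show ?thesis
    proof (cases "a < j")
      case True
      have "unit_vec j \<in> W b" using False by (simp add: W_iff id_mat_def)
      then have "g (unit_vec j) \<in> W t" using Ut by blast
      then show ?thesis using False True b3(2)[of j] by (simp add: b2_def band_iff W_iff)
    next
      case False
      then show ?thesis using b1(2)[of j] b3(2)[of j] that ab by (simp add: b2_def)
    qed
  qed (use b3(3) that in blast)
  define A where "A = columns_mat s t b3"
  have A: "A \<in> GL2inf" unfolding A_def by (rule columns_mat_GL2inf[OF b3f b3(1)])
  define h where "h = mat_op A"
  have hG: "h \<in> GLbar" unfolding h_def by (rule mat_op_GLbar[OF A])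
  note hlin = GLbarD(1)[OF hG] and hbij = GLbarD(2)[OF hG]
  have comb3: "comb s t b3 c = comb s b b2 c" if "\<And>j. b < j \<Longrightarrow> c j = 0" for c
  proof -
    have "comb b t b3 c = comb b t b3 (\<lambda>_. 0)" using that by (intro comb_cong) auto
    then have "comb b t b3 c = 0" by (simp add: comb_def)
    moreover have "comb s b b3 c = comb s b b2 c" using b3(2) by (intro comb_cong) auto
    ultimately show ?thesis by (simp add: comb_split[OF sb bt])
  qed
  have h: "h v = (v - trunc s v) + comb s a b1 (coord v) + trunc s (g (comb a b unit_vec (coord v)))"
    if v: "v \<in> W b" for v
  proof -
    have "v \<in> W t" using v W_mono[OF bt] by blast
    then have "h v = (v - trunc s v) + comb s t b3 (coord v)"
      unfolding h_def A_def by (intro mat_op_columns_mat b3f)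
    then show ?thesis using comb3[of "coord v"] v by (simp add: W_iff comb_sb add.assoc)
  qed
  have ha: "h v = (v - trunc s v) + comb s a b1 (coord v)" if v: "v \<in> W a" for v
  proof -
    have "comb a b unit_vec (coord v) = comb a b unit_vec (\<lambda>_. 0)"
      using v by (intro comb_cong) (auto simp: W_iff)
    then have "comb a b unit_vec (coord v) = 0" by (simp add: comb_def)
    moreover have "v \<in> W b" using v W_mono[OF ab] by blast
    ultimately show ?thesis using h by (simp add: lin_zero[OF lin] lin_zero[OF lin_trunc])
  qed
  have hW: "h ` W a = U"
  proof (intro equalityI subsetI)
    fix u assume "u \<in> h ` W a"
    then obtain v where v: "v \<in> W a" "u = h v" by blast
    then show "u \<in> U"
      using ha[OF v(1)] vs.subspace_add[OF U WsU[OF diff_trunc_in_W], of "comb s a b1 (coord v)" v] comb1U[of "coord v"]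
      by simp
  next
    fix u assume u: "u \<in> U"
    have "u - (u - trunc s u) \<in> U" by (rule vs.subspace_diff[OF U u WsU[OF diff_trunc_in_W]])
    then have "trunc s u \<in> U \<inter> band s t"
      using u Ut' by (auto simp: U_def band_iff W_iff)
    also have "U \<inter> band s t = range (comb s a b1)"
      using finite_band by (intro indep_spans[OF b1(1) UU _ cardU b1(2), symmetric]) auto
    finally obtain c where c: "trunc s u = comb s a b1 c" by blast
    define v where "v = (u - trunc s u) + comb s a unit_vec c"
    have va: "v \<in> W a" using sa by (simp add: v_def W_iff coord_comb_unit_vec)
    have "trunc s v = comb s a unit_vec c"
      by (rule lseq_eqI) (simp add: v_def coord_comb_unit_vec)
    then have "v - trunc s v = u - trunc s u" by (simp add: v_def)
    moreover have "comb s a b1 (coord v) = comb s a b1 c"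
      by (rule comb_cong) (simp_all add: v_def coord_comb_unit_vec)
    ultimately have "h v = u" using ha[OF va] c by simp
    then show "u \<in> h ` W a" using va by blast
  qed
  \<comment> \<open>Split \<open>v\<close> into \<open>w\<close>, on which \<open>h\<close> and \<open>g\<close> agree modulo \<open>W s\<close>, and a rest in \<open>W a\<close>.\<close>
  have hg: "h v - g v \<in> U" if v: "v \<in> W b" for v
  proof -
    define w where "w = comb a b unit_vec (coord v)"
    have "v - w \<in> W a" using v by (auto simp: w_def W_iff coord_comb_unit_vec)
    then have gU: "g (v - w) \<in> U" unfolding U_def by (rule imageI)
    have "h v - g v = ((v - trunc s v) + comb s a b1 (coord v)) - (g w - trunc s (g w)) - g (v - w)"
      unfolding h[OF v] w_def[symmetric] lin_diff[OF lin] by simp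
    moreover have "(v - trunc s v) + comb s a b1 (coord v) \<in> U"
      using comb1U[of "coord v"] by (intro vs.subspace_add[OF U WsU[OF diff_trunc_in_W]]) simp
    ultimately show ?thesis
      using vs.subspace_diff[OF U vs.subspace_diff[OF U _ WsU[OF diff_trunc_in_W]] gU] by metis
  qed
  have inv_W: "ginv k u \<in> W a" if k: "k = g \<or> k = h" and u: "u \<in> U" for k u
  proof -
    have "U = k ` W a" and "bij k" using k hW hbij bij U_def by auto
    then obtain v where "v \<in> W a" "u = k v" using u by auto
    then show ?thesis using \<open>bij k\<close> by (simp add: inv_f_f[OF bij_is_inj])
  qed
  have "ginv h \<circ> g \<in> Qbar (a, b)"
    unfolding Qbar_iff[OF ab]
  proof (intro conjI ballI)
    show "ginv h \<circ> g \<in> GLbar" by (intro GLbar_comp GLbar_inv hG g)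
    fix v :: "'f lseq" assume v: "v \<in> W b"
    have "ginv h (g v - h v) \<in> W a"
      using inv_W[of h "g v - h v"] vs.subspace_neg[OF U hg[OF v]] by simp
    then show "(ginv h \<circ> g) v - v \<in> W a"
      by (simp add: lin_diff[OF lin_inv[OF hlin hbij]] inv_f_f[OF bij_is_inj[OF hbij]])
    have "ginv g (h v - g v) \<in> W a"
      using inv_W[of g "h v - g v"] hg[OF v] by simp
    then show "ginv (ginv h \<circ> g) v - v \<in> W a"
      by (simp add: lin_diff[OF lin_inv[OF lin bij]] inv_f_f[OF bij_is_inj[OF bij]]
          o_inv_distrib bij_imp_bij_inv bij hbij inv_inv_eq)
  qed
  then show ?thesis using that[OF A] by (simp add: h_def)
qed

section \<open>Permutation operators\<close>

definition perm_op :: "(int \<Rightarrow> int) \<Rightarrow> 'f::field lseq \<Rightarrow> 'f lseq" where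
  "perm_op \<theta> v = Abs_lseq (\<lambda>i. coord v (\<theta> i))"

lemma permutation_bounded_support:
  assumes "permutation (\<theta> :: int \<Rightarrow> int)"
  shows "\<exists>s t. \<forall>i. i \<le> s \<or> t < i \<longrightarrow> \<theta> i = i"
proof -
  define X where "X = insert 0 {i. \<theta> i \<noteq> i}"
  have X: "finite X" using assms by (simp add: X_def permutation)
  have "\<theta> i = i" if "i \<le> Min X - 1 \<or> Max X < i" for i
  proof (rule ccontr)
    assume "\<theta> i \<noteq> i"
    then have "i \<in> X" by (simp add: X_def)
    then have "Min X \<le> i" "i \<le> Max X" using X by simp_all
    then show False using that by linarith
  qed
  then show ?thesis by blast
qed

lemma coord_perm_op:
  assumes "permutation \<theta>"
  shows "coord (perm_op \<theta> v) i = coord v (\<theta> i)"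
proof -
  obtain s t where "\<forall>i. i \<le> s \<or> t < i \<longrightarrow> \<theta> i = i"
    using permutation_bounded_support[OF assms] by blast
  moreover obtain m where "\<forall>j>m. coord v j = 0" using coord_eventually_zero by blast
  ultimately show ?thesis
    unfolding perm_op_def by (subst coord_Abs_lseq[of "max m t"]) simp_all
qed

lemma perm_op_comp:
  assumes "permutation \<theta>" "permutation \<eta>"
  shows "perm_op \<theta> \<circ> perm_op \<eta> = perm_op (\<eta> \<circ> \<theta>)"
proof
  fix v show "(perm_op \<theta> \<circ> perm_op \<eta>) v = perm_op (\<eta> \<circ> \<theta>) v"
    using assms permutation_compose[OF assms(2,1)] by (intro lseq_eqI) (simp add: coord_perm_op)
qed

lemma perm_op_id: "perm_op id = id"
proof
  fix v :: "'a lseq" show "perm_op id v = id v"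
    by (rule lseq_eqI) (simp add: coord_perm_op[OF permutation_id])
qed

lemma perm_op_inverse:
  assumes "permutation \<theta>"
  shows "perm_op \<theta> \<circ> perm_op (inv_into UNIV \<theta>) = id" "perm_op (inv_into UNIV \<theta>) \<circ> perm_op \<theta> = id"
proof -
  have "bij \<theta>" using assms by (simp add: permutation)
  then have "inv_into UNIV \<theta> \<circ> \<theta> = id" and "\<theta> \<circ> inv_into UNIV \<theta> = id"
    using inv_o_cancel[OF bij_is_inj, of \<theta>] surj_iff[THEN iffD1, OF bij_is_surj, of \<theta>] by simp_all
  then show "perm_op \<theta> \<circ> perm_op (inv_into UNIV \<theta>) = id" "perm_op (inv_into UNIV \<theta>) \<circ> perm_op \<theta> = id"
    using assms permutation_inverse[OF assms] by (simp_all add: perm_op_comp perm_op_id)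
qed

lemma ginv_perm_op: "permutation \<theta> \<Longrightarrow> ginv (perm_op \<theta>) = perm_op (inv_into UNIV \<theta>)"
  by (rule inv_unique_comp) (rule perm_op_inverse, assumption)+

text \<open>A permutation of finite support is the identity below some \<open>s\<close>, so its operator fixes \<open>W s\<close>.\<close>

lemma perm_op_GLbar:
  assumes "permutation \<theta>"
  shows "perm_op \<theta> \<in> (GLbar :: ('f::{field, finite} lseq \<Rightarrow> 'f lseq) set)"
proof -
  obtain s t where st: "\<And>i. i \<le> s \<or> t < i \<Longrightarrow> \<theta> i = i"
    using permutation_bounded_support[OF assms] by blast
  have inj: "inj \<theta>" using assms by (simp add: permutation bij_is_inj)
  show ?thesis
  proof (rule GLbarI_fixes_W)
    show "lin (perm_op \<theta>)"
      unfolding lin_iff by (auto intro!: lseq_eqI simp: coord_perm_op[OF assms])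
    show "bij (perm_op \<theta>)" by (rule o_bij[OF perm_op_inverse(2,1)[OF assms]])
    fix v :: "'f lseq" assume v: "v \<in> W s"
    show "perm_op \<theta> v = v"
    proof (rule lseq_eqI)
      fix i
      show "coord (perm_op \<theta> v) i = coord v i"
      proof (cases "i \<le> s")
        case False
        have "\<not> \<theta> i \<le> s"
        proof
          assume "\<theta> i \<le> s"
          then have "\<theta> (\<theta> i) = \<theta> i" using st by blast
          then have "\<theta> i = i" by (rule injD[OF inj])
          then show False using \<open>\<theta> i \<le> s\<close> False by simp
        qed
        then show ?thesis using False v by (simp add: coord_perm_op[OF assms] W_iff)
      qed (simp add: coord_perm_op[OF assms] st)
    qed
  qed
qed

lemma perm_op_Qbar:
  assumes \<theta>: "permutation \<theta>" and st: "s \<le> t"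
    and t: "\<And>i. \<theta> i \<le> t \<longleftrightarrow> i \<le> t" and mid: "\<And>i. s < i \<Longrightarrow> i \<le> t \<Longrightarrow> \<theta> i = i"
  shows "perm_op \<theta> \<in> (Qbar (s, t) :: ('f::{field, finite} lseq \<Rightarrow> 'f lseq) set)"
  unfolding Qbar_iff[OF st] ginv_perm_op[OF \<theta>]
proof (intro conjI ballI perm_op_GLbar[OF \<theta>])
  have *: "perm_op \<eta> v - v \<in> W s" if \<eta>: "permutation \<eta>" and t: "\<And>i. \<eta> i \<le> t \<longleftrightarrow> i \<le> t"
      and mid: "\<And>i. s < i \<Longrightarrow> i \<le> t \<Longrightarrow> \<eta> i = i" and v: "v \<in> W t" for \<eta> and v :: "'f lseq"
    unfolding W_iff
  proof (intro allI impI)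
    fix i assume "s < i"
    then show "coord (perm_op \<eta> v - v) i = 0"
      using v t[of i] mid[of i] by (cases "i \<le> t") (auto simp: coord_perm_op[OF \<eta>] W_iff)
  qed
  fix v :: "'f lseq" assume v: "v \<in> W t"
  show "perm_op \<theta> v - v \<in> W s" by (rule *[OF \<theta> t mid v])
  have bij: "bij \<theta>" using \<theta> by (simp add: permutation)
  show "perm_op (inv_into UNIV \<theta>) v - v \<in> W s"
  proof (rule *[OF permutation_inverse[OF \<theta>] _ _ v])
    show "inv_into UNIV \<theta> i \<le> t \<longleftrightarrow> i \<le> t" for i
      using t[of "inv_into UNIV \<theta> i"] by (simp add: surj_f_inv_f[OF bij_is_surj[OF bij]])
    show "inv_into UNIV \<theta> i = i" if "s < i" "i \<le> t" for i
      using mid[OF that] inv_f_f[OF bij_is_inj[OF bij], of i] by simp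
  qed
qed

lemma mat_op_permuted:
  assumes \<theta>: "permutation \<theta>" and \<pi>: "permutation \<pi>" and B: "id_outside s t B"
  shows "mat_op (\<lambda>i j. B (\<theta> i) (\<pi> j)) = perm_op \<theta> \<circ> mat_op B \<circ> perm_op (inv_into UNIV \<pi>)"
proof
  fix v :: "'a lseq"
  define w where "w = perm_op (inv_into UNIV \<pi>) v"
  have bij: "bij \<pi>" using \<pi> by (simp add: permutation)
  have "(\<Sum>j | B k (\<pi> j) \<noteq> 0. B k (\<pi> j) * coord v j) = coord (mat_op B w) k" for k
  proof -
    have "bij_betw \<pi> {j. B k (\<pi> j) \<noteq> 0} {j. B k j \<noteq> 0}"
      using bij by (intro bij_betwI[of _ _ _ "inv_into UNIV \<pi>"])
        (auto simp: surj_f_inv_f[OF bij_is_surj] inv_f_f[OF bij_is_inj])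
    then have "(\<Sum>j | B k j \<noteq> 0. B k j * coord w j) =
        (\<Sum>j | B k (\<pi> j) \<noteq> 0. B k (\<pi> j) * coord w (\<pi> j))"
      by (rule sum.reindex_bij_betw[symmetric])
    moreover have "coord w (\<pi> j) = coord v j" for j
      using bij by (simp add: w_def coord_perm_op[OF permutation_inverse[OF \<pi>]] inv_f_f[OF bij_is_inj])
    ultimately show ?thesis by (simp add: coord_mat_op[OF B] sum_row[OF B])
  qed
  then show "mat_op (\<lambda>i j. B (\<theta> i) (\<pi> j)) v = (perm_op \<theta> \<circ> mat_op B \<circ> perm_op (inv_into UNIV \<pi>)) v"
    by (simp add: mat_op_def[of "\<lambda>i j. B (\<theta> i) (\<pi> j)"] perm_op_def[of \<theta>] w_def)
qed

text \<open>Exchanges \<open>(s, b]\<close> with its translate by \<open>- D\<close>, and \<open>(c, t]\<close> with its translate by \<open>E\<close>. The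
distances must be at least the lengths of the intervals for this to be a permutation.\<close>

definition two_swap :: "int \<Rightarrow> int \<Rightarrow> int \<Rightarrow> int \<Rightarrow> int \<Rightarrow> int \<Rightarrow> int \<Rightarrow> int" where
  "two_swap s b c t D E j =
     (if s < j \<and> j \<le> b then j - D else if s - D < j \<and> j \<le> b - D then j + D
      else if c < j \<and> j \<le> t then j + E else if c + E < j \<and> j \<le> t + E then j - E else j)"

locale swap_bounds =
  fixes s b c t :: int
  assumes sb: "s \<le> b" and bc: "b \<le> c" and ct: "c \<le> t"
begin

lemma two_swap_involution:
  assumes "b - s \<le> D" "t - c \<le> E"
  shows "two_swap s b c t D E (two_swap s b c t D E j) = j"
  using assms sb bc ct by (simp add: two_swap_def)

lemma permutation_two_swap:
  assumes "b - s \<le> D" "t - c \<le> E"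
  shows "permutation (two_swap s b c t D E)"
proof -
  have "two_swap s b c t D E \<circ> two_swap s b c t D E = id"
    using two_swap_involution[OF assms] by (simp add: fun_eq_iff)
  then have "bij (two_swap s b c t D E)" by (intro o_bij)
  moreover have "{j. two_swap s b c t D E j \<noteq> j} \<subseteq> {s - D..t + E}"
    using assms sb bc ct by (auto simp: two_swap_def)
  then have "finite {j. two_swap s b c t D E j \<noteq> j}" by (rule finite_subset) simp
  ultimately show ?thesis by (simp add: permutation)
qed

lemma inv_two_swap:
  assumes "b - s \<le> D" "t - c \<le> E"
  shows "inv_into UNIV (two_swap s b c t D E) = two_swap s b c t D E"
  using two_swap_involution[OF assms] by (intro inv_unique_comp) (simp_all add: fun_eq_iff)

lemma two_swap_sides:
  assumes "b - s \<le> D" "t - c \<le> E"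
  shows "two_swap s b c t D E j \<le> b \<longleftrightarrow> j \<le> b" "two_swap s b c t D E j \<le> c \<longleftrightarrow> j \<le> c"
    "b < j \<Longrightarrow> j \<le> c \<Longrightarrow> two_swap s b c t D E j = j"
  using assms sb bc ct by (simp_all add: two_swap_def)

lemma perm_op_two_swap_Qbar:
  assumes "b - s \<le> D" "t - c \<le> E"
  shows "perm_op (two_swap s b c t D E) \<in> (Qbar (b, c) :: ('f::{field, finite} lseq \<Rightarrow> 'f lseq) set)"
  using two_swap_sides[OF assms] bc by (intro perm_op_Qbar permutation_two_swap[OF assms]) auto

text \<open>The permutation \<open>p\<close> carries the near translates of the two intervals to the far ones; it is
itself an exchange, and it fixes \<open>(s, t]\<close>. The lower bounds on \<open>D\<close> and \<open>E\<close> make the near and the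
far translates disjoint.\<close>

lemma two_swap_conjugate:
  fixes D E
  defines "p \<equiv> two_swap (2 * s - b) s t (2 * t - c) (D - (b - s)) (E - (t - c))"
  assumes "2 * (b - s) \<le> D" "2 * (t - c) \<le> E"
  shows "p (two_swap s b c t (b - s) (t - c) (p j)) = two_swap s b c t D E j"
proof -
  define \<theta> where "\<theta> = two_swap s b c t (b - s) (t - c)"
  have p: "p i = (if 2 * s - b < i \<and> i \<le> s then i - D + (b - s)
      else if s - D < i \<and> i \<le> b - D then i + D - (b - s)
      else if t < i \<and> i \<le> 2 * t - c then i + E - (t - c)
      else if c + E < i \<and> i \<le> t + E then i - E + (t - c) else i)" for i
    unfolding p_def two_swap_def by (simp add: algebra_simps)
  have \<theta>: "\<theta> i = (if s < i \<and> i \<le> b then i - b + s else if 2 * s - b < i \<and> i \<le> s then i + b - s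
      else if c < i \<and> i \<le> t then i + t - c else if t < i \<and> i \<le> 2 * t - c then i - t + c else i)" for i
    unfolding \<theta>_def two_swap_def by (simp add: algebra_simps)
  consider "s < j" "j \<le> b" | "s - D < j" "j \<le> b - D" | "c < j" "j \<le> t" | "c + E < j" "j \<le> t + E"
    | "2 * s - b < j" "j \<le> s" | "t < j" "j \<le> 2 * t - c"
    | "b < j" "j \<le> c" | "j \<le> s - D" | "b - D < j" "j \<le> 2 * s - b"
    | "2 * t - c < j" "j \<le> c + E" | "t + E < j"
    by linarith
  then have "p (\<theta> (p j)) = two_swap s b c t D E j"
    by cases (use assms(2,3) sb bc ct in \<open>simp_all add: p \<theta> two_swap_def\<close>)
  then show ?thesis by (simp add: \<theta>_def)
qed

text \<open>Let \<open>\<theta>\<close> be the exchange over distance \<open>n\<close>. For large \<open>n\<close> it moves \<open>(s, b]\<close> and \<open>(c, t]\<close> out of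
the range where \<open>A\<close> differs from the identity, while it preserves the sets of indices \<open>j \<le> b\<close>
and \<open>j > c\<close> and fixes \<open>(b, c]\<close>. Hence the entry of the conjugate matrix in row \<open>i > s\<close> and
column \<open>j \<le> t\<close> is that of the identity: if \<open>i\<close> or \<open>j\<close> lies in \<open>(s, b] \<union> (c, t]\<close>, one of the two
indices has been moved to where \<open>A\<close> is trivial, and otherwise the entry is trivial because \<open>A\<close>
acts trivially on \<open>W c / W b\<close>. These entries decide membership in \<open>Qbar (s, t)\<close>.\<close>

lemma conjugate_Qbar:
  fixes A :: "int \<Rightarrow> int \<Rightarrow> 'f::{field, finite}"
  assumes A: "A \<in> GL2inf" and Q: "mat_op A \<in> Qbar (b, c)"
  shows "\<exists>n0. \<forall>n\<ge>n0. perm_op (two_swap s b c t n n) \<circ> mat_op A \<circ> perm_op (two_swap s b c t n n) \<in> Qbar (s, t)"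
proof -
  obtain C where C: "C \<in> GL2inf" "ginv (mat_op A) = mat_op C" and bij: "bij (mat_op A)"
    using GL2inf_inverse[OF A] by metis
  have "(b, c) \<in> idx" using bc by (simp add: idx_def)
  then have QC: "mat_op C \<in> Qbar (b, c)" using Qbar_inv[OF Q] C(2) by simp
  obtain s1 t1 where A1: "id_outside s1 t1 A" using A finitary_id_outside unfolding GL2inf_def by blast
  obtain s2 t2 where C2: "id_outside s2 t2 C" using C(1) finitary_id_outside unfolding GL2inf_def by blast
  define s' t' where "s' = min s1 s2" and "t' = max t1 t2"
  have A': "id_outside s' t' A" and C': "id_outside s' t' C"
    using A1 C2 by (auto intro: id_outside_mono simp: s'_def t'_def)
  \<comment> \<open>The last two bounds move the two intervals past \<open>s'\<close> and \<open>t'\<close>, where both matrices are trivial.\<close>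
  define n0 where "n0 = Max {b - s, t - c, b - s', t' - c}"
  have *: "coord (perm_op (two_swap s b c t n n) (mat_op B (perm_op (two_swap s b c t n n) v))) i = coord v i"
    if B: "id_outside s' t' B" and QB: "mat_op B \<in> Qbar (b, c)" and n: "n0 \<le> n"
      and v: "v \<in> W t" and i: "s < i" for B :: "int \<Rightarrow> int \<Rightarrow> 'f" and n v i
  proof -
    have n': "b - s \<le> n" "t - c \<le> n" "b - s' \<le> n" "t' - c \<le> n" using n by (auto simp: n0_def)
    define \<theta> where "\<theta> = two_swap s b c t n n"
    have \<theta>: "permutation \<theta>" "\<And>j. \<theta> (\<theta> j) = j"
      unfolding \<theta>_def using permutation_two_swap two_swap_involution n' by simp_all
    note sides = two_swap_sides[OF n'(1,2), folded \<theta>_def]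
    have low: "\<theta> j \<le> s'" if "s < j" "j \<le> b" for j
      using that n' by (simp add: \<theta>_def two_swap_def)
    have high: "t' < \<theta> j" if "c < j" "j \<le> t" for j
      using that n' sb bc by (simp add: \<theta>_def two_swap_def)
    have entry: "B k j = id_mat k j" if "b < k" "j \<le> c" for k j
    proof -
      have "unit_vec j \<in> (W c :: 'f lseq set)" using that by (simp add: W_iff id_mat_def)
      then have "mat_op B (unit_vec j) - unit_vec j \<in> W b" using QB by (simp add: Qbar_def)
      then have "coord (mat_op B (unit_vec j)) k = id_mat k j" using that by (simp add: W_iff)
      moreover have "coord (mat_op B (unit_vec j)) k = B k j"
      proof -
        have "(\<Sum>l\<in>{s'<..t'}. B k l * id_mat l j) = B k j" if "s' < k" "k \<le> t'"
        proof (cases "s' < j \<and> j \<le> t'")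
          case True
          then show ?thesis by (simp add: id_mat_def if_distrib cong: if_cong)
        next
          case False
          then have "B k j = id_mat k j" by (intro id_outsideD[OF B]) simp
          moreover have "k \<noteq> j" using False that by blast
          moreover have "l \<noteq> j" if "l \<in> {s'<..t'}" for l using False that by auto
          ultimately show ?thesis by (simp add: id_mat_def)
        qed
        moreover have "id_mat k j = B k j" if "\<not> (s' < k \<and> k \<le> t')"
          using id_outsideD[OF B, of k j] that by simp
        ultimately show ?thesis by (simp add: coord_mat_op[OF B])
      qed
      ultimately show ?thesis by simp
    qed
    have row: "B (\<theta> i) (\<theta> j) = id_mat (\<theta> i) (\<theta> j)" if j: "j \<le> t" for j
    proof -
      consider "i \<le> b" | "c < i" "i \<le> t" | "c < j" | "b < i" "j \<le> c" by linarith
      then show ?thesis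
      proof cases
        case 1
        then show ?thesis using low[of i] i by (intro id_outsideD[OF B]) simp
      next
        case 2
        then show ?thesis using high[of i] by (intro id_outsideD[OF B]) simp
      next
        case 3
        then show ?thesis using high[of j] j by (intro id_outsideD[OF B]) simp
      next
        case 4
        then show ?thesis using sides(1)[of i] sides(2)[of j] by (intro entry) simp_all
      qed
    qed
    have "coord (mat_op B (perm_op \<theta> v)) (\<theta> i) =
        (\<Sum>j | B (\<theta> i) j \<noteq> 0. B (\<theta> i) j * coord v (\<theta> j))"
      unfolding coord_mat_op[OF B] sum_row[OF B] by (simp add: coord_perm_op[OF \<theta>(1)])
    also have "\<dots> = (\<Sum>j | B (\<theta> i) j \<noteq> 0. if j = \<theta> i then coord v i else 0)"
    proof (rule sum.cong[OF refl])
      fix j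
      show "B (\<theta> i) j * coord v (\<theta> j) = (if j = \<theta> i then coord v i else 0)"
      proof (cases "\<theta> j \<le> t")
        case True
        then have "B (\<theta> i) j = id_mat (\<theta> i) j" using row[of "\<theta> j"] \<theta>(2) by simp
        then show ?thesis using \<theta>(2) by (simp add: id_mat_def)
      next
        case False
        then show ?thesis using v \<theta>(2) by (auto simp: W_iff)
      qed
    qed
    also have "\<dots> = coord v i"
    proof (cases "i \<le> t")
      case True
      have "{j. B (\<theta> i) j \<noteq> 0} \<subseteq> insert (\<theta> i) {s'<..t'}"
      proof clarify
        fix j assume "B (\<theta> i) j \<noteq> 0" "j \<notin> {s'<..t'}"
        then show "j = \<theta> i" using id_outsideD[OF B, of "\<theta> i" j] by (auto simp: id_mat_def split: if_splits)
      qed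
      then have "finite {j. B (\<theta> i) j \<noteq> 0}" by (rule finite_subset) simp
      moreover have "B (\<theta> i) (\<theta> i) \<noteq> 0" using row[OF True] by (simp add: id_mat_def)
      ultimately show ?thesis by (simp add: sum.delta)
    next
      case False
      then have "coord v i = 0" using v by (simp add: W_iff)
      then show ?thesis by (simp add: sum.neutral)
    qed
    finally show ?thesis
      unfolding \<theta>_def[symmetric] by (simp add: coord_perm_op[OF \<theta>(1)])
  qed
  have "perm_op (two_swap s b c t n n) \<circ> mat_op A \<circ> perm_op (two_swap s b c t n n) \<in> Qbar (s, t)"
    if n: "n0 \<le> n" for n
  proof -
    have n': "b - s \<le> n" "t - c \<le> n" using n by (auto simp: n0_def)
    define P where "P = (perm_op (two_swap s b c t n n) :: 'f lseq \<Rightarrow> 'f lseq)"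
    have P: "P \<in> GLbar" unfolding P_def by (rule perm_op_GLbar[OF permutation_two_swap[OF n']])
    have Pinv: "ginv P = P"
      unfolding P_def ginv_perm_op[OF permutation_two_swap[OF n']] inv_two_swap[OF n'] ..
    have "s \<le> t" using sb bc ct by simp
    have "ginv (P \<circ> mat_op A \<circ> P) = P \<circ> mat_op C \<circ> P"
      using GLbarD(2)[OF P] bij by (simp add: o_inv_distrib bij_comp Pinv C(2) comp_assoc)
    moreover have "P \<circ> mat_op A \<circ> P \<in> GLbar" by (intro GLbar_comp P mat_op_GLbar A)
    ultimately show ?thesis
      unfolding P_def[symmetric] Qbar_iff[OF \<open>s \<le> t\<close>]
      using *[OF A' Q n, folded P_def] *[OF C' QC n, folded P_def] by (simp add: W_iff)
  qed
  then show ?thesis by blast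
qed

text \<open>Write \<open>q = A r\<close> with \<open>A\<close> finitary and \<open>r\<close> in \<open>Qbar (s, t)\<close>, which is contained in \<open>Qbar (b, c)\<close>,
so that \<open>A\<close> is in \<open>Qbar (b, c)\<close> too. With \<open>T\<close> the exchange over distance \<open>n\<close> and \<open>T\<^sub>0\<close> the one
over minimal distances, \<open>T q = (T A T) T r\<close> and \<open>T = p T\<^sub>0 p\<close>, where \<open>T A T\<close> and \<open>p\<close> are in
\<open>Qbar (s, t)\<close>.\<close>

lemma two_swap_Qbar_double_coset:
  fixes q :: "'f::{field, finite} lseq \<Rightarrow> 'f lseq"
  assumes q: "q \<in> Qbar (b, c)"
  shows "\<exists>n0. \<forall>n\<ge>n0. \<exists>p\<in>Qbar (s, t). \<exists>r\<in>Qbar (s, t).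
    perm_op (two_swap s b c t n n) \<circ> q = p \<circ> perm_op (two_swap s b c t (b - s) (t - c)) \<circ> r"
proof -
  have st: "s \<le> t" using sb bc ct by simp
  obtain A where A: "A \<in> GL2inf" and r: "ginv (mat_op A) \<circ> q \<in> Qbar (s, t)"
    using finitary_approximation[OF Qbar_GLbar[OF q] st] by blast
  define r where "r = ginv (mat_op A) \<circ> q"
  have r: "r \<in> Qbar (s, t)" using r by (simp add: r_def)
  have bijA: "bij (mat_op A)" by (rule GLbarD(2)[OF mat_op_GLbar[OF A]])
  have Ar: "mat_op A \<circ> r = q"
    unfolding r_def by (auto simp: surj_f_inv_f[OF bij_is_surj[OF bijA]])
  have r': "r \<in> Qbar (b, c)" using Qbar_antimono[OF r, of "(b, c)"] sb bc ct by simp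
  have bijr: "bij r" by (rule GLbarD(2)[OF Qbar_GLbar[OF r]])
  have "mat_op A = q \<circ> ginv r"
    unfolding Ar[symmetric] by (auto simp: surj_f_inv_f[OF bij_is_surj[OF bijr]])
  moreover have "q \<circ> ginv r \<in> Qbar (b, c)"
    using q r' bc by (intro Qbar_comp Qbar_inv) (auto simp: idx_def)
  ultimately obtain n0 where n0: "\<And>n. n0 \<le> n \<Longrightarrow>
      perm_op (two_swap s b c t n n) \<circ> mat_op A \<circ> perm_op (two_swap s b c t n n) \<in> Qbar (s, t)"
    using conjugate_Qbar[OF A] by auto
  \<comment> \<open>The factor \<open>2\<close> is the hypothesis of \<open>two_swap_conjugate\<close>.\<close>
  define n1 where "n1 = Max {n0, 2 * (b - s), 2 * (t - c)}"
  have "\<exists>p\<in>Qbar (s, t). \<exists>r\<in>Qbar (s, t).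
      perm_op (two_swap s b c t n n) \<circ> q = p \<circ> perm_op (two_swap s b c t (b - s) (t - c)) \<circ> r"
    if n: "n1 \<le> n" for n
  proof -
    have n': "n0 \<le> n" "2 * (b - s) \<le> n" "2 * (t - c) \<le> n" using n by (auto simp: n1_def)
    have n'': "b - s \<le> n" "t - c \<le> n" using n' sb ct by simp_all
    define T where "T = (perm_op (two_swap s b c t n n) :: 'f lseq \<Rightarrow> 'f lseq)"
    define T0 where "T0 = (perm_op (two_swap s b c t (b - s) (t - c)) :: 'f lseq \<Rightarrow> 'f lseq)"
    define u where "u = two_swap (2 * s - b) s t (2 * t - c) (n - (b - s)) (n - (t - c))"
    interpret u: swap_bounds "2 * s - b" s t "2 * t - c" by standard (use sb bc ct in simp_all)
    have un: "s - (2 * s - b) \<le> n - (b - s)" "2 * t - c - t \<le> n - (t - c)" using n' by simp_all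
    have uQ: "perm_op u \<in> (Qbar (s, t) :: ('f lseq \<Rightarrow> 'f lseq) set)"
      unfolding u_def by (rule u.perm_op_two_swap_Qbar[OF un])
    have perm_u: "permutation u" unfolding u_def by (rule u.permutation_two_swap[OF un])
    have perm0: "permutation (two_swap s b c t (b - s) (t - c))" by (rule permutation_two_swap) simp_all
    have "u \<circ> (two_swap s b c t (b - s) (t - c) \<circ> u) = two_swap s b c t n n"
      unfolding u_def using two_swap_conjugate[OF n'(2,3)] by (simp add: fun_eq_iff)
    then have T: "T = perm_op u \<circ> T0 \<circ> perm_op u"
      unfolding T_def T0_def by (simp add: perm_op_comp perm_u perm0 permutation_compose)
    have TT: "T \<circ> T = id"
      using perm_op_inverse(1)[OF permutation_two_swap[OF n''], where 'a = 'f]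
      unfolding T_def inv_two_swap[OF n''] .
    have "T \<circ> q = (T \<circ> mat_op A \<circ> T) \<circ> T \<circ> r"
      using TT unfolding Ar[symmetric] by (simp add: comp_assoc fun_eq_iff)
    also have "\<dots> = ((T \<circ> mat_op A \<circ> T) \<circ> perm_op u) \<circ> T0 \<circ> (perm_op u \<circ> r)"
      by (subst (3) T) (simp add: comp_assoc)
    finally have "T \<circ> q = ((T \<circ> mat_op A \<circ> T) \<circ> perm_op u) \<circ> T0 \<circ> (perm_op u \<circ> r)" .
    moreover have "(T \<circ> mat_op A \<circ> T) \<circ> perm_op u \<in> Qbar (s, t)"
      using n0[OF n'(1)] uQ unfolding T_def by (rule Qbar_comp)
    moreover have "perm_op u \<circ> r \<in> Qbar (s, t)" by (rule Qbar_comp[OF uQ r])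
    ultimately show ?thesis unfolding T_def T0_def by (intro bexI)
  qed
  then show ?thesis by blast
qed

end

section \<open>Projections onto fixed vectors\<close>

lemma cinner_add_right: "cinner x (y + z) = cinner x y + cinner x (z :: 'h::complex_hilbert)"
  by (metis cinner_add_left cinner_commute complex_cnj_add)

lemma cinner_scaleR_left: "cinner (r *\<^sub>R x) y = of_real r * cinner x (y :: 'h::complex_hilbert)"
  by (metis cinner_scaleC_left scaleC_of_real)

lemma cinner_scaleR_right: "cinner x (r *\<^sub>R y) = of_real r * cinner x (y :: 'h::complex_hilbert)"
  by (metis cinner_commute cinner_scaleR_left complex_cnj_complex_of_real complex_cnj_mult)

lemma cinner_scaleC_right: "cinner x (scaleC c y) = cnj c * cinner x (y :: 'h::complex_hilbert)"
  by (metis cinner_commute cinner_scaleC_left complex_cnj_mult)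

lemma cinner_minus_left: "cinner (- x) y = - cinner x (y :: 'h::complex_hilbert)"
  using cinner_scaleR_left[of "-1" x y] by simp

lemma cinner_minus_right: "cinner x (- y) = - cinner x (y :: 'h::complex_hilbert)"
  using cinner_scaleR_right[of x "-1" y] by simp

lemma cinner_diff_left: "cinner (x - y) z = cinner x z - cinner y (z :: 'h::complex_hilbert)"
  using cinner_add_left[of x "- y" z] by (simp add: cinner_minus_left)

lemma cinner_diff_right: "cinner x (y - z) = cinner x y - cinner x (z :: 'h::complex_hilbert)"
  using cinner_add_right[of x y "- z"] by (simp add: cinner_minus_right)

lemma cinner_zero_left [simp]: "cinner 0 (y :: 'h::complex_hilbert) = 0"
  using cinner_scaleR_left[of 0 0 y] by simp

lemma cinner_zero_right [simp]: "cinner (y :: 'h::complex_hilbert) 0 = 0"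
  using cinner_scaleR_right[of y 0 0] by simp

lemma cinner_self_eq_zero: "cinner x x = 0 \<longleftrightarrow> x = (0 :: 'h::complex_hilbert)"
  by (simp add: cinner_norm)

lemma cinner_ext:
  assumes "\<And>z. z \<in> S \<Longrightarrow> cinner x z = cinner y z" "x - y \<in> S"
  shows "x = (y :: 'h::complex_hilbert)"
proof -
  have "cinner (x - y) (x - y) = 0" using assms by (simp add: cinner_diff_left)
  then show ?thesis by (simp add: cinner_self_eq_zero)
qed

lemma norm_add_square:
  "(norm (x + y))\<^sup>2 = (norm x)\<^sup>2 + (norm y)\<^sup>2 + 2 * Re (cinner x (y :: 'h::complex_hilbert))"
proof -
  have "complex_of_real ((norm (x + y))\<^sup>2) = cinner (x + y) (x + y)" by (simp only: cinner_norm)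
  also have "\<dots> = cinner x x + cinner y y + (cinner x y + cinner y x)"
    by (simp add: cinner_add_left cinner_add_right)
  also have "\<dots> = cinner x x + cinner y y + (cinner x y + cnj (cinner x y))"
    by (simp only: cinner_commute[of y x])
  also have "\<dots> = complex_of_real ((norm x)\<^sup>2 + (norm y)\<^sup>2 + 2 * Re (cinner x y))"
    by (simp add: cinner_norm complex_add_cnj)
  finally show ?thesis by (simp only: of_real_eq_iff)
qed

lemma parallelogram:
  "(norm (x - y))\<^sup>2 = 2 * (norm x)\<^sup>2 + 2 * (norm y)\<^sup>2 - (norm (x + y :: 'h::complex_hilbert))\<^sup>2"
  using norm_add_square[of x y] norm_add_square[of x "- y"] by (simp add: cinner_minus_right)

lemma cinner_Cauchy_Schwarz: "cmod (cinner x y) \<le> norm x * norm (y :: 'h::complex_hilbert)"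
proof (cases "y = 0")
  case False
  define c where "c = cinner x y / of_real ((norm y)\<^sup>2)"
  have c: "cinner x y = c * cinner y y" using False by (simp add: c_def cinner_norm)
  have "cinner (x - scaleC c y) (x - scaleC c y) = cinner x x - c * cinner y x"
    using c by (simp add: cinner_diff_left cinner_diff_right cinner_scaleC_left cinner_scaleC_right algebra_simps)
  also have "c * cinner y x = of_real ((cmod (cinner x y))\<^sup>2 / (norm y)\<^sup>2)"
    unfolding c_def cinner_commute[of y x] of_real_divide complex_norm_square by simp
  finally have "complex_of_real ((norm (x - scaleC c y))\<^sup>2) =
      of_real ((norm x)\<^sup>2 - (cmod (cinner x y))\<^sup>2 / (norm y)\<^sup>2)"
    by (simp add: cinner_norm)
  then have "(norm (x - scaleC c y))\<^sup>2 = (norm x)\<^sup>2 - (cmod (cinner x y))\<^sup>2 / (norm y)\<^sup>2"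
    by (simp only: of_real_eq_iff)
  then have "(cmod (cinner x y))\<^sup>2 / (norm y)\<^sup>2 \<le> (norm x)\<^sup>2"
    by (metis diff_ge_0_iff_ge zero_le_power2)
  then have "(cmod (cinner x y))\<^sup>2 \<le> (norm x * norm y)\<^sup>2"
    using False by (simp add: divide_le_eq power_mult_distrib)
  then show ?thesis by (rule power2_le_imp_le) simp
qed simp

text \<open>A minimizing sequence is a Cauchy sequence by the parallelogram law, because midpoints of its
terms stay in the convex set. Uniqueness is stated in the form in which it is used: an element
of no larger norm is the minimizer.\<close>

lemma ex_min_norm:
  fixes C :: "'h::complex_hilbert set"
  assumes "closed C" "convex C" "C \<noteq> {}"
  obtains z where "z \<in> C" "\<And>w. w \<in> C \<Longrightarrow> norm w \<le> norm z \<Longrightarrow> w = z"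
proof -
  define d where "d = (INF w\<in>C. norm w)"
  have bdd: "bdd_below (norm ` C)" by (rule bdd_belowI[of _ 0]) auto
  have d: "d \<le> norm w" if "w \<in> C" for w unfolding d_def by (rule cINF_lower[OF bdd that])
  have d0: "0 \<le> d" unfolding d_def using assms(3) by (intro cINF_greatest) auto
  have close: "(norm (v - w))\<^sup>2 \<le> 2 * (norm v)\<^sup>2 + 2 * (norm w)\<^sup>2 - 4 * d\<^sup>2" if "v \<in> C" "w \<in> C" for v w
  proof -
    have "(1/2) *\<^sub>R v + (1/2) *\<^sub>R w \<in> C" using assms(2) that by (intro convexD) auto
    then have "d \<le> norm ((1/2) *\<^sub>R (v + w))" using d by (simp add: scaleR_add_right)
    then have "2 * d \<le> norm (v + w)" by simp
    then have "(2 * d)\<^sup>2 \<le> (norm (v + w))\<^sup>2" using d0 by (intro power_mono) auto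
    then show ?thesis by (simp add: parallelogram power_mult_distrib)
  qed
  have "\<exists>w\<in>C. norm w < d + 1 / real (Suc n)" for n
    using cINF_less_iff[OF assms(3) bdd, of "d + 1 / real (Suc n)"] by (simp add: d_def)
  then obtain w where w: "\<And>n. w n \<in> C" "\<And>n. norm (w n) < d + 1 / real (Suc n)" by metis
  have norm_lim: "(\<lambda>n. norm (w n)) \<longlonglongrightarrow> d"
  proof (rule tendsto_sandwich[of "\<lambda>_. d" _ _ "\<lambda>n. d + 1 / real (Suc n)"])
    show "(\<lambda>n. d + 1 / real (Suc n)) \<longlonglongrightarrow> d"
      using LIMSEQ_inverse_real_of_nat_add[of d] by (simp add: inverse_eq_divide)
  qed (intro always_eventually allI d w(1) less_imp_le[OF w(2)] tendsto_const)+
  have "Cauchy w"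
  proof (rule CauchyI)
    fix e :: real assume e: "0 < e"
    have "(\<lambda>n. (norm (w n))\<^sup>2) \<longlonglongrightarrow> d\<^sup>2" by (intro tendsto_power norm_lim)
    moreover have "d\<^sup>2 < d\<^sup>2 + e\<^sup>2 / 4" using e by simp
    ultimately have "\<forall>\<^sub>F n in sequentially. (norm (w n))\<^sup>2 < d\<^sup>2 + e\<^sup>2 / 4"
      by (rule order_tendstoD(2))
    then obtain N where N: "\<And>n. N \<le> n \<Longrightarrow> (norm (w n))\<^sup>2 < d\<^sup>2 + e\<^sup>2 / 4"
      by (auto simp: eventually_sequentially)
    have *: "norm (w m - w n) < e" if "N \<le> m" "N \<le> n" for m n
    proof -
      have "(norm (w m - w n))\<^sup>2 < e\<^sup>2"
        using close[OF w(1)[of m] w(1)[of n]] N[OF that(1)] N[OF that(2)] by linarith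
      then show ?thesis by (rule power2_less_imp_less) (use e in simp)
    qed
    show "\<exists>M. \<forall>m\<ge>M. \<forall>n\<ge>M. norm (w m - w n) < e" by (intro exI[of _ N] allI impI *)
  qed
  then have "convergent w" by (simp only: Cauchy_convergent_iff)
  then obtain z where z: "w \<longlonglongrightarrow> z" unfolding convergent_def by (elim exE)
  have zC: "z \<in> C" by (rule closed_sequentially[OF assms(1) w(1) z])
  have "(\<lambda>n. norm (w n)) \<longlonglongrightarrow> norm z" by (rule tendsto_norm[OF z])
  then have zd: "norm z = d" by (rule LIMSEQ_unique[OF _ norm_lim])
  show ?thesis
  proof (rule that[OF zC])
    fix v assume v: "v \<in> C" "norm v \<le> norm z"
    then have "norm v = d" using d[OF v(1)] zd by simp
    then have "(norm (v - z))\<^sup>2 \<le> 0" using close[OF v(1) zC] zd by simp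
    then show "v = z" by simp
  qed
qed

lemma orth_proj_eqI:
  assumes sub: "\<And>u v. u \<in> S \<Longrightarrow> v \<in> S \<Longrightarrow> u - v \<in> S"
    and y: "y \<in> S" "\<And>z. z \<in> S \<Longrightarrow> cinner y z = cinner x z"
  shows "orth_proj S x = (y :: 'h::complex_hilbert)"
  unfolding orth_proj_def
proof (rule the_equality)
  show "y \<in> S \<and> (\<forall>z\<in>S. cinner (x - y) z = 0)" using y by (simp add: cinner_diff_left)
  fix u assume u: "u \<in> S \<and> (\<forall>z\<in>S. cinner (x - u) z = 0)"
  show "u = y"
    by (rule cinner_ext[of S]) (use u y sub in \<open>auto simp: cinner_diff_left\<close>)
qed

text \<open>A class of operators that contains those of the matrices differing from the identity only in the
square of the indices in \<open>(s, t]\<close>, is closed under inversion, and suffices for normalizing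
\<open>Qbar (s, t)\<close>.\<close>

definition window :: "int \<Rightarrow> int \<Rightarrow> ('f::field lseq \<Rightarrow> 'f lseq) \<Rightarrow> bool" where
  "window s t h \<longleftrightarrow> h \<in> GLbar \<and> (\<forall>v\<in>W s. h v = v) \<and> (\<forall>v. h v - v \<in> W t)"

lemma window_inv:
  assumes "window s t h"
  shows "window s t (ginv h)"
proof -
  have h: "h \<in> GLbar" "\<And>v. v \<in> W s \<Longrightarrow> h v = v" "\<And>v. h v - v \<in> W t"
    using assms by (auto simp: window_def)
  note hh = surj_f_inv_f[OF bij_is_surj[OF GLbarD(2)[OF h(1)]]]
  have "ginv h v = v" if "v \<in> W s" for v
    using inv_f_f[OF bij_is_inj[OF GLbarD(2)[OF h(1)]], of v] h(2)[OF that] by simp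
  moreover have "ginv h v - v \<in> W t" for v
    using W_diff_commute[OF h(3)[of "ginv h v"]] by (simp add: hh)
  ultimately show ?thesis using GLbar_inv[OF h(1)] by (simp add: window_def)
qed

text \<open>For \<open>v\<close> in \<open>W t\<close> the vector \<open>q (h v) - h v\<close> lies in \<open>W s\<close>, where \<open>h\<close> is the identity; so
applying \<open>h\<^sup>-\<^sup>1\<close> to it changes nothing.\<close>

lemma window_normalizes_Qbar:
  assumes h: "window s t h" and q: "q \<in> Qbar (s, t)" and st: "s \<le> t"
  shows "ginv h \<circ> q \<circ> h \<in> Qbar (s, t)"
proof -
  have hG: "h \<in> GLbar" using h by (simp add: window_def)
  note bij = GLbarD(2)[OF hG]
  note hi = inv_f_f[OF bij_is_inj[OF bij]]
  have *: "(ginv h \<circ> k \<circ> h) v - v \<in> W s" if k: "\<forall>v\<in>W t. k v - v \<in> W s" and v: "v \<in> W t" for k v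
  proof -
    have "h v - v \<in> W t" using h by (simp add: window_def)
    from W_add[OF this v] have "h v \<in> W t" by simp
    then have e: "k (h v) - h v \<in> W s" using k by blast
    then have "ginv h (k (h v) - h v) = k (h v) - h v"
      using window_inv[OF h] by (simp add: window_def)
    then have "(ginv h \<circ> k \<circ> h) v - v = k (h v) - h v"
      by (simp add: lin_diff[OF lin_inv[OF GLbarD(1)[OF hG] bij]] hi)
    then show ?thesis using e by simp
  qed
  note Q = q[unfolded Qbar_iff[OF st]]
  have "bij q" using Q by (intro GLbarD(2)) simp
  then have "ginv (ginv h \<circ> q \<circ> h) = ginv h \<circ> ginv q \<circ> h"
    by (simp add: o_inv_distrib bij_comp bij_imp_bij_inv bij inv_inv_eq comp_assoc[of _ q h])
  moreover have "ginv h \<circ> q \<circ> h \<in> GLbar" using Q hG by (intro GLbar_comp GLbar_inv) auto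
  ultimately show ?thesis unfolding Qbar_iff[OF st] using * Q by simp
qed

locale unitary_representation =
  fixes \<rho> :: "('f::{field, finite} lseq \<Rightarrow> 'f lseq) \<Rightarrow> 'h::complex_hilbert \<Rightarrow> 'h"
  assumes unitary_rep: "unitary_rep \<rho>"
begin

lemma rho_add: "g \<in> GLbar \<Longrightarrow> \<rho> g (x + y) = \<rho> g x + \<rho> g y"
  and rho_scaleC: "g \<in> GLbar \<Longrightarrow> \<rho> g (scaleC c x) = scaleC c (\<rho> g x)"
  and cinner_rho: "g \<in> GLbar \<Longrightarrow> cinner (\<rho> g x) (\<rho> g y) = cinner x y"
  using unitary_rep unfolding unitary_rep_def unitary_op_def by simp_all

lemma rho_comp: "g \<in> GLbar \<Longrightarrow> h \<in> GLbar \<Longrightarrow> \<rho> (g \<circ> h) x = \<rho> g (\<rho> h x)"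
  using unitary_rep unfolding unitary_rep_def by simp

lemma rho_scaleR: "g \<in> GLbar \<Longrightarrow> \<rho> g (r *\<^sub>R x) = r *\<^sub>R \<rho> g x"
  using rho_scaleC[of g "of_real r" x] by (simp add: scaleC_of_real)

lemma rho_diff: "g \<in> GLbar \<Longrightarrow> \<rho> g (x - y) = \<rho> g x - \<rho> g y"
  using rho_add[of g "x - y" y] by (simp add: algebra_simps)

lemma norm_rho:
  assumes "g \<in> GLbar"
  shows "norm (\<rho> g x) = norm x"
proof -
  have "complex_of_real ((norm (\<rho> g x))\<^sup>2) = complex_of_real ((norm x)\<^sup>2)"
    using cinner_rho[OF assms, of x x] by (simp only: cinner_norm)
  then have "(norm (\<rho> g x))\<^sup>2 = (norm x)\<^sup>2" by (simp only: of_real_eq_iff)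
  then show ?thesis by simp
qed

lemma bounded_linear_rho: "g \<in> GLbar \<Longrightarrow> bounded_linear (\<rho> g)"
  by (rule bounded_linear_intro[of _ 1]) (simp_all add: rho_add rho_scaleR norm_rho)

lemma rho_id: "\<rho> id x = x"
proof -
  have "\<rho> id (\<rho> id x - x) = 0"
    using rho_comp[OF GLbar_id GLbar_id, of x] by (simp add: rho_diff[OF GLbar_id])
  then have "norm (\<rho> id x - x) = 0" using norm_rho[OF GLbar_id] by (metis norm_zero)
  then show ?thesis by simp
qed

lemma rho_ginv_cancel:
  assumes "g \<in> GLbar"
  shows "\<rho> g (\<rho> (ginv g) x) = x"
proof -
  have "g \<circ> ginv g = id"
    by (rule surj_iff[THEN iffD1, OF bij_is_surj[OF GLbarD(2)[OF assms]]])
  then show ?thesis using rho_comp[OF assms GLbar_inv[OF assms], of x] by (simp add: rho_id)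
qed

lemma cinner_rho_left: "g \<in> GLbar \<Longrightarrow> cinner (\<rho> g x) y = cinner x (\<rho> (ginv g) y)"
  using cinner_rho[of g x "\<rho> (ginv g) y"] by (simp add: rho_ginv_cancel)

lemma fixed_spaceD: "v \<in> fixed_space \<rho> \<alpha> \<Longrightarrow> g \<in> Qbar \<alpha> \<Longrightarrow> \<rho> g v = v"
  by (simp add: fixed_space_def)

lemma fixed_space_diff: "u \<in> fixed_space \<rho> \<alpha> \<Longrightarrow> v \<in> fixed_space \<rho> \<alpha> \<Longrightarrow> u - v \<in> fixed_space \<rho> \<alpha>"
  by (simp add: fixed_space_def rho_diff Qbar_GLbar)

lemma cinner_rho_fixed:
  assumes "\<alpha> \<in> idx" "q \<in> Qbar \<alpha>" "z \<in> fixed_space \<rho> \<alpha>"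
  shows "cinner (\<rho> q x) z = cinner x z"
  using cinner_rho_left[OF Qbar_GLbar[OF assms(2)], of x z] Qbar_inv[OF assms(2,1)]
    fixed_spaceD[OF assms(3)] by simp

definition orbit_hull :: "int \<times> int \<Rightarrow> 'h \<Rightarrow> 'h set" where
  "orbit_hull \<alpha> x = convex hull ((\<lambda>g. \<rho> g x) ` Qbar \<alpha>)"

text \<open>The orthogonal projection onto the fixed vectors of \<open>Qbar \<alpha>\<close> is the vector of least norm in the
closed convex hull of the orbit: the hull is invariant under the group, so by uniqueness its
shortest vector is fixed; and pairing with a fixed vector is constant on the orbit, hence on the
closed hull.\<close>

lemma ex_projection:
  assumes \<alpha>: "\<alpha> \<in> idx"
  obtains y where "y \<in> fixed_space \<rho> \<alpha>" "y \<in> closure (orbit_hull \<alpha> x)"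
    "\<And>z. z \<in> fixed_space \<rho> \<alpha> \<Longrightarrow> cinner y z = cinner x z"
proof -
  let ?O = "(\<lambda>g. \<rho> g x) ` Qbar \<alpha>"
  let ?C = "closure (orbit_hull \<alpha> x)"
  have "x \<in> ?O" using Qbar_id[of \<alpha>] rho_id[of x] by (metis imageI)
  then have "?C \<noteq> {}" unfolding orbit_hull_def using hull_subset[of ?O convex] closure_subset by blast
  then obtain y where y: "y \<in> ?C" "\<And>w. w \<in> ?C \<Longrightarrow> norm w \<le> norm y \<Longrightarrow> w = y"
    using ex_min_norm[of ?C] by (auto simp: orbit_hull_def convex_closure)
  have "\<rho> q y = y" if q: "q \<in> Qbar \<alpha>" for q
  proof (rule y(2))
    have qG: "q \<in> GLbar" by (rule Qbar_GLbar[OF q])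
    have "\<rho> q ` ?O \<subseteq> ?O"
    proof clarify
      fix g :: "'f lseq \<Rightarrow> 'f lseq" assume g: "g \<in> Qbar \<alpha>"
      have "\<rho> q (\<rho> g x) = \<rho> (q \<circ> g) x" using rho_comp[OF qG Qbar_GLbar[OF g]] by simp
      then show "\<rho> q (\<rho> g x) \<in> ?O" using Qbar_comp[OF q g] by (rule image_eqI)
    qed
    then have hull: "\<rho> q ` orbit_hull \<alpha> x \<subseteq> orbit_hull \<alpha> x"
      unfolding orbit_hull_def
        convex_hull_linear_image[OF bounded_linear.linear[OF bounded_linear_rho[OF qG]]]
      by (rule hull_mono)
    have "\<rho> q y \<in> closure (\<rho> q ` orbit_hull \<alpha> x)"
      using closure_bounded_linear_image_subset[OF bounded_linear_rho[OF qG]] imageI[OF y(1)]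
      by (rule subsetD)
    then show "\<rho> q y \<in> ?C" by (rule subsetD[OF closure_mono[OF hull]])
    show "norm (\<rho> q y) \<le> norm y" by (simp add: norm_rho[OF qG])
  qed
  then have "y \<in> fixed_space \<rho> \<alpha>" by (simp add: fixed_space_def)
  moreover have "cinner y z = cinner x z" if z: "z \<in> fixed_space \<rho> \<alpha>" for z
  proof -
    have bl: "bounded_linear (\<lambda>w. cinner w z)"
      by (rule bounded_linear_intro[of _ "norm z"])
        (simp_all add: cinner_add_left cinner_scaleR_left scaleR_conv_of_real cinner_Cauchy_Schwarz)
    have "orbit_hull \<alpha> x \<subseteq> {w. cinner w z = cinner x z}"
      unfolding orbit_hull_def
    proof (rule hull_minimal)
      show "?O \<subseteq> {w. cinner w z = cinner x z}" using cinner_rho_fixed[OF \<alpha> _ z] by auto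
      show "convex {w. cinner w z = cinner x z}"
        by (rule convexI) (simp add: cinner_add_left cinner_scaleR_left distrib_right[symmetric] of_real_add[symmetric] del: of_real_add)
    qed
    moreover have "closed {w. cinner w z = cinner x z}"
      using bl by (intro closed_Collect_eq continuous_intros) (simp_all add: linear_continuous_on)
    ultimately have "?C \<subseteq> {w. cinner w z = cinner x z}" by (rule closure_minimal)
    then show ?thesis using y(1) by blast
  qed
  ultimately show ?thesis using that y(1) by blast
qed

abbreviation proj :: "int \<times> int \<Rightarrow> 'h \<Rightarrow> 'h" where
  "proj \<alpha> \<equiv> orth_proj (fixed_space \<rho> \<alpha>)"

lemma proj_eqI:
  assumes "y \<in> fixed_space \<rho> \<alpha>" "\<And>z. z \<in> fixed_space \<rho> \<alpha> \<Longrightarrow> cinner y z = cinner x z"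
  shows "proj \<alpha> x = y"
  by (rule orth_proj_eqI[OF fixed_space_diff assms])

lemma proj:
  assumes "\<alpha> \<in> idx"
  shows "proj \<alpha> x \<in> fixed_space \<rho> \<alpha>" "proj \<alpha> x \<in> closure (orbit_hull \<alpha> x)"
    "z \<in> fixed_space \<rho> \<alpha> \<Longrightarrow> cinner (proj \<alpha> x) z = cinner x z"
proof -
  obtain y where y: "y \<in> fixed_space \<rho> \<alpha>" "y \<in> closure (orbit_hull \<alpha> x)"
      "\<And>z. z \<in> fixed_space \<rho> \<alpha> \<Longrightarrow> cinner y z = cinner x z"
    using ex_projection[OF assms] by blast
  have "proj \<alpha> x = y" by (rule proj_eqI[OF y(1,3)])
  then show "proj \<alpha> x \<in> fixed_space \<rho> \<alpha>" "proj \<alpha> x \<in> closure (orbit_hull \<alpha> x)"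
    "z \<in> fixed_space \<rho> \<alpha> \<Longrightarrow> cinner (proj \<alpha> x) z = cinner x z"
    using y by simp_all
qed

text \<open>A projection is determined by the inner products with the fixed vectors.\<close>

lemma proj_cong:
  assumes "\<alpha> \<in> idx" "\<And>z. z \<in> fixed_space \<rho> \<alpha> \<Longrightarrow> cinner x z = cinner y z"
  shows "proj \<alpha> x = proj \<alpha> y"
  by (rule proj_eqI[OF proj(1)[OF assms(1)]]) (simp add: proj(3)[OF assms(1)] assms(2))

lemma norm_proj_le:
  assumes "\<alpha> \<in> idx"
  shows "norm (proj \<alpha> x) \<le> norm x"
proof (cases "proj \<alpha> x = 0")
  case False
  have "complex_of_real ((norm (proj \<alpha> x))\<^sup>2) = cinner x (proj \<alpha> x)"
    using proj(3)[OF assms proj(1)[OF assms, of x], of x] by (simp add: cinner_norm)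
  from arg_cong[OF this, of cmod] have "(norm (proj \<alpha> x))\<^sup>2 = cmod (cinner x (proj \<alpha> x))"
    by (simp only: norm_of_real abs_power2)
  also have "\<dots> \<le> norm x * norm (proj \<alpha> x)" by (rule cinner_Cauchy_Schwarz)
  finally show ?thesis using False by (simp add: power2_eq_square)
qed simp

lemma proj_rho:
  assumes "\<alpha> \<in> idx" "q \<in> Qbar \<alpha>"
  shows "proj \<alpha> (\<rho> q x) = proj \<alpha> x"
  by (rule proj_cong[OF assms(1)]) (rule cinner_rho_fixed[OF assms])

text \<open>For each \<open>q\<close> in \<open>Qbar (b, c)\<close> the inner product of \<open>\<rho>(T n) (\<rho>(q) x)\<close> with \<open>y\<close> has, for all large
\<open>n\<close>, the value \<open>k\<close> on the left-hand side; so the same holds on the convex hull of the orbit. How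
large \<open>n\<close> must be depends on the point of the hull, whence the formulation by filters. The
projection of \<open>x\<close> is a limit of points of the hull and is fixed by \<open>T n\<close> for large \<open>n\<close>, and
\<open>\<rho>(T n)\<close> is isometric, so the inner product of the projection with \<open>y\<close> is \<open>k\<close>.\<close>

lemma two_swap_computes_projection:
  assumes "s \<le> b" "b \<le> c" "c \<le> t"
    and x: "x \<in> fixed_space \<rho> (s, t)" and y: "y \<in> fixed_space \<rho> (s, t)"
  shows "cinner (\<rho> (perm_op (two_swap s b c t (b - s) (t - c))) x) y = cinner (proj (b, c) x) y"
proof -
  interpret swap_bounds s b c t using assms by unfold_locales
  define T where "T n = (perm_op (two_swap s b c t n n) :: 'f lseq \<Rightarrow> 'f lseq)" for n
  define T0 where "T0 = (perm_op (two_swap s b c t (b - s) (t - c)) :: 'f lseq \<Rightarrow> 'f lseq)"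
  define k where "k = cinner (\<rho> T0 x) y"
  define Z where "Z = {z. \<forall>\<^sub>F n in at_top. T n \<in> Qbar (b, c) \<and> cinner (\<rho> (T n) z) y = k}"
  have st: "(s, t) \<in> idx" and bc: "(b, c) \<in> idx" using assms by (auto simp: idx_def)
  have T0: "T0 \<in> GLbar"
    unfolding T0_def by (intro Qbar_GLbar[OF perm_op_two_swap_Qbar]) simp_all
  have TQ: "\<forall>\<^sub>F n in at_top. T n \<in> Qbar (b, c)"
    unfolding eventually_at_top_linorder T_def
    by (rule exI[of _ "max (b - s) (t - c)"]) (auto intro: perm_op_two_swap_Qbar)
  have "orbit_hull (b, c) x \<subseteq> Z"
    unfolding orbit_hull_def
  proof (rule hull_minimal)
    show "(\<lambda>g. \<rho> g x) ` Qbar (b, c) \<subseteq> Z"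
    proof clarify
      fix q :: "'f lseq \<Rightarrow> 'f lseq" assume q: "q \<in> Qbar (b, c)"
      have "\<forall>\<^sub>F n in at_top. \<exists>p\<in>Qbar (s, t). \<exists>r\<in>Qbar (s, t). T n \<circ> q = p \<circ> T0 \<circ> r"
        unfolding eventually_at_top_linorder T_def T0_def by (rule two_swap_Qbar_double_coset[OF q])
      with TQ have "\<forall>\<^sub>F n in at_top. T n \<in> Qbar (b, c) \<and> cinner (\<rho> (T n) (\<rho> q x)) y = k"
      proof eventually_elim
        case (elim n)
        then obtain p r where pr: "p \<in> Qbar (s, t)" "r \<in> Qbar (s, t)" "T n \<circ> q = p \<circ> T0 \<circ> r" by blast
        note G = Qbar_GLbar[OF pr(1)] Qbar_GLbar[OF pr(2)] Qbar_GLbar[OF q] Qbar_GLbar[OF elim(1)]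
        have "\<rho> (T n) (\<rho> q x) = \<rho> (p \<circ> T0 \<circ> r) x"
          using rho_comp[OF G(4,3)] pr(3) by simp
        also have "\<dots> = \<rho> p (\<rho> T0 x)"
          using rho_comp[OF GLbar_comp[OF G(1) T0] G(2)] rho_comp[OF G(1) T0]
            fixed_spaceD[OF x pr(2)] by simp
        finally show ?case
          using elim(1) cinner_rho_fixed[OF st pr(1) y] by (simp add: k_def)
      qed
      then show "\<rho> q x \<in> Z" by (simp add: Z_def)
    qed
    show "convex Z"
    proof (rule convexI)
      fix z w :: 'h and u v :: real
      assume z: "z \<in> Z" and w: "w \<in> Z" and uv: "0 \<le> u" "0 \<le> v" "u + v = 1"
      have "\<forall>\<^sub>F n in at_top. T n \<in> Qbar (b, c) \<and> cinner (\<rho> (T n) z) y = k"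
        and "\<forall>\<^sub>F n in at_top. T n \<in> Qbar (b, c) \<and> cinner (\<rho> (T n) w) y = k"
        using z w by (simp_all add: Z_def)
      then have "\<forall>\<^sub>F n in at_top. T n \<in> Qbar (b, c) \<and> cinner (\<rho> (T n) (u *\<^sub>R z + v *\<^sub>R w)) y = k"
      proof eventually_elim
        case (elim n)
        have "cinner (\<rho> (T n) (u *\<^sub>R z + v *\<^sub>R w)) y = of_real u * k + of_real v * k"
          using elim Qbar_GLbar[OF conjunct1[OF elim(1)]]
          by (simp add: rho_add rho_scaleR cinner_add_left cinner_scaleR_left)
        also have "\<dots> = k" using uv(3) by (simp add: distrib_right[symmetric] of_real_add[symmetric] del: of_real_add)
        finally show ?case using elim by simp
      qed
      then show "u *\<^sub>R z + v *\<^sub>R w \<in> Z" by (simp add: Z_def)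
    qed
  qed
  define p where "p = proj (b, c) x"
  have p: "p \<in> fixed_space \<rho> (b, c)" "p \<in> closure Z"
    unfolding p_def using proj(1,2)[OF bc, of x] closure_mono[OF \<open>orbit_hull (b, c) x \<subseteq> Z\<close>] by auto
  have small: "cmod (cinner p y - k) \<le> e" if e: "0 < e" for e
  proof -
    have "0 < e / (norm y + 1)" using e by (simp add: add_nonneg_pos)
    then obtain z where z: "z \<in> Z" "dist z p < e / (norm y + 1)"
      using p(2) unfolding closure_approachable by auto
    have "\<forall>\<^sub>F n in at_top. T n \<in> Qbar (b, c) \<and> cinner (\<rho> (T n) z) y = k"
      using z(1) by (simp add: Z_def)
    from eventually_happens'[OF trivial_limit_at_top_linorder this]
    obtain n where n: "T n \<in> Qbar (b, c)" "cinner (\<rho> (T n) z) y = k" by auto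
    have "cinner p y - k = cinner (\<rho> (T n) (p - z)) y"
      using n fixed_spaceD[OF p(1) n(1)] by (simp add: rho_diff[OF Qbar_GLbar[OF n(1)]] cinner_diff_left)
    then have "cmod (cinner p y - k) \<le> norm (p - z) * norm y"
      using cinner_Cauchy_Schwarz[of "\<rho> (T n) (p - z)" y] by (simp add: norm_rho[OF Qbar_GLbar[OF n(1)]])
    also have "\<dots> \<le> (e / (norm y + 1)) * norm y"
      using z(2) by (intro mult_right_mono) (simp_all add: dist_norm norm_minus_commute)
    also have "\<dots> \<le> e" using e by (simp add: divide_le_eq add_nonneg_pos)
    finally show ?thesis .
  qed
  have "cmod (cinner p y - k) \<le> 0" by (rule field_le_epsilon) (simp add: small)
  then show ?thesis by (simp add: p_def k_def T0_def)
qed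

text \<open>The operator \<open>h\<close> normalizes \<open>Qbar (s, t)\<close>, which is contained in \<open>Qbar \<gamma>\<close>.\<close>

lemma rho_window_fixed:
  assumes h: "window s t h" and w: "w \<in> fixed_space \<rho> \<gamma>"
    and \<gamma>: "s \<le> fst \<gamma>" "fst \<gamma> \<le> snd \<gamma>" "snd \<gamma> \<le> t"
  shows "\<rho> h w \<in> fixed_space \<rho> (s, t)"
  unfolding fixed_space_def mem_Collect_eq
proof
  fix q :: "'f lseq \<Rightarrow> 'f lseq" assume q: "q \<in> Qbar (s, t)"
  have hG: "h \<in> GLbar" using h by (simp add: window_def)
  have st: "s \<le> t" using \<gamma> by simp
  define k where "k = ginv h \<circ> q \<circ> h"
  have kQ: "k \<in> Qbar (s, t)" unfolding k_def by (rule window_normalizes_Qbar[OF h q st])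
  have "h \<circ> k = q \<circ> h"
    by (simp add: k_def fun_eq_iff surj_f_inv_f[OF bij_is_surj[OF GLbarD(2)[OF hG]]])
  then have "\<rho> q (\<rho> h w) = \<rho> h (\<rho> k w)"
    using rho_comp[OF Qbar_GLbar[OF q] hG, of w] rho_comp[OF hG Qbar_GLbar[OF kQ], of w] by simp
  also have "\<rho> k w = w" by (rule fixed_spaceD[OF w Qbar_antimono[OF kQ \<gamma>]])
  finally show "\<rho> q (\<rho> h w) = \<rho> h w" .
qed

lemma multiplicativity:
  assumes A: "window s t A" and B: "window s t B"
    and \<alpha>: "s \<le> fst \<alpha>" "fst \<alpha> \<le> snd \<alpha>" "snd \<alpha> \<le> t"
    and \<beta>: "s \<le> b" "b \<le> c" "c \<le> t"
    and \<gamma>: "s \<le> fst \<gamma>" "fst \<gamma> \<le> snd \<gamma>" "snd \<gamma> \<le> t"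
    and w: "w \<in> fixed_space \<rho> \<gamma>"
  shows "proj \<alpha> (\<rho> A (proj (b, c) (\<rho> B w))) =
    proj \<alpha> (\<rho> (A \<circ> perm_op (two_swap s b c t (b - s) (t - c)) \<circ> B) w)"
proof (rule proj_cong)
  show "\<alpha> \<in> idx" using \<alpha> by (simp add: idx_def)
  let ?T = "perm_op (two_swap s b c t (b - s) (t - c)) :: 'f lseq \<Rightarrow> 'f lseq"
  have AG: "A \<in> GLbar" and BG: "B \<in> GLbar" using A B by (simp_all add: window_def)
  interpret swap_bounds s b c t using \<beta> by unfold_locales
  have TG: "?T \<in> GLbar" by (intro Qbar_GLbar[OF perm_op_two_swap_Qbar]) simp_all
  fix u assume u: "u \<in> fixed_space \<rho> \<alpha>"
  have x: "\<rho> B w \<in> fixed_space \<rho> (s, t)" by (rule rho_window_fixed[OF B w \<gamma>])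
  have y: "\<rho> (ginv A) u \<in> fixed_space \<rho> (s, t)" by (rule rho_window_fixed[OF window_inv[OF A] u \<alpha>])
  have "cinner (\<rho> A (proj (b, c) (\<rho> B w))) u = cinner (proj (b, c) (\<rho> B w)) (\<rho> (ginv A) u)"
    by (rule cinner_rho_left[OF AG])
  also have "\<dots> = cinner (\<rho> ?T (\<rho> B w)) (\<rho> (ginv A) u)"
    by (rule two_swap_computes_projection[OF \<beta> x y, symmetric])
  also have "\<dots> = cinner (\<rho> A (\<rho> ?T (\<rho> B w))) u"
    by (rule cinner_rho_left[OF AG, symmetric])
  also have "\<rho> A (\<rho> ?T (\<rho> B w)) = \<rho> (A \<circ> ?T \<circ> B) w"
    using rho_comp[OF GLbar_comp[OF AG TG] BG] rho_comp[OF AG TG] by simp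
  finally show "cinner (\<rho> A (proj (b, c) (\<rho> B w))) u = cinner (\<rho> (A \<circ> ?T \<circ> B) w) u" .
qed

end

section \<open>The block matrices of the product of double cosets\<close>

lemma dim_append_cols [simp]:
  "dim_row (append_cols X Y) = dim_row X" "dim_col (append_cols X Y) = dim_col X + dim_col Y"
  by (simp_all add: append_cols_def)

lemma index_append_cols [simp]:
  "i < dim_row X \<Longrightarrow> j < dim_col X + dim_col Y \<Longrightarrow>
    append_cols X Y $$ (i, j) = (if j < dim_col X then X $$ (i, j) else Y $$ (i, j - dim_col X))"
  by (simp add: append_cols_def)

lemma dim_append_rows [simp]:
  "dim_row (append_rows X Y) = dim_row X + dim_row Y" "dim_col (append_rows X Y) = dim_col X"
  by (simp_all add: append_rows_def)

lemma index_append_rows [simp]: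
  "i < dim_row X + dim_row Y \<Longrightarrow> j < dim_col X \<Longrightarrow>
    append_rows X Y $$ (i, j) = (if i < dim_row X then X $$ (i, j) else Y $$ (i - dim_row X, j))"
  by (simp add: append_rows_def)

lemma dim_block [simp]:
  "dim_row (block A R C p q) = nat (R ! p - R ! (p - 1))"
  "dim_col (block A R C p q) = nat (C ! q - C ! (q - 1))"
  by (simp_all add: block_def)

lemma index_block [simp]:
  "i < nat (R ! p - R ! (p - 1)) \<Longrightarrow> j < nat (C ! q - C ! (q - 1)) \<Longrightarrow>
    block A R C p q $$ (i, j) = A (R ! (p - 1) + 1 + int i) (C ! (q - 1) + 1 + int j)"
  by (simp add: block_def)

text \<open>Splits the row or column indices of a \<open>5 \<times> 5\<close> block matrix by blocks.\<close>

lemma five_strips: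
  fixes x :: nat
  assumes "x < a1 + a2 + a3 + a4 + a5"
  obtains "x < a1" | k where "k < a2" "x = a1 + k" | k where "k < a3" "x = a1 + a2 + k"
    | k where "k < a4" "x = a1 + a2 + a3 + k" | k where "k < a5" "x = a1 + a2 + a3 + a4 + k"
proof -
  consider "x < a1" | "a1 \<le> x" "x < a1 + a2" | "a1 + a2 \<le> x" "x < a1 + a2 + a3"
    | "a1 + a2 + a3 \<le> x" "x < a1 + a2 + a3 + a4" | "a1 + a2 + a3 + a4 \<le> x"
    by linarith
  then show ?thesis
  proof cases
    case 1 then show ?thesis by (rule that(1))
  next
    case 2 then show ?thesis by (intro that(2)[of "x - a1"]) simp_all
  next
    case 3 then show ?thesis by (intro that(3)[of "x - (a1 + a2)"]) simp_all
  next
    case 4 then show ?thesis by (intro that(4)[of "x - (a1 + a2 + a3)"]) simp_all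
  next
    case 5 then show ?thesis using assms by (intro that(5)[of "x - (a1 + a2 + a3 + a4)"]) simp_all
  qed
qed

lemma complete_mat_index:
  "x < dim_row X \<Longrightarrow> y < dim_col X \<Longrightarrow> complete_mat l X (l + 1 + int x) (l + 1 + int y) = X $$ (x, y)"
  by (simp add: complete_mat_def)

lemma id_outside_complete_mat:
  assumes "X \<in> carrier_mat n n"
  shows "id_outside l (l + int n) (complete_mat l X)"
  using assms unfolding id_outside_def by (auto simp: complete_mat_def)

lemma interval_index:
  assumes "l < i" "i \<le> l + int n"
  obtains x where "x < n" "i = l + 1 + int x"
  using assms by (intro that[of "nat (i - l - 1)"]) auto

lemma complete_mat_eqI:
  assumes X: "X \<in> carrier_mat n n" and M: "id_outside l (l + int n) M"
    and entry: "\<And>x y. x < n \<Longrightarrow> y < n \<Longrightarrow> X $$ (x, y) = M (l + 1 + int x) (l + 1 + int y)"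
  shows "complete_mat l X = M"
proof (intro ext)
  fix i j
  show "complete_mat l X i j = M i j"
  proof (cases "l < i \<and> i \<le> l + int n \<and> l < j \<and> j \<le> l + int n")
    case True
    obtain x where x: "x < n" "i = l + 1 + int x" using True by (auto elim: interval_index)
    obtain y where y: "y < n" "j = l + 1 + int y" using True by (auto elim: interval_index)
    show ?thesis using X x(1) y(1) entry unfolding x(2) y(2) by (simp add: complete_mat_index)
  next
    case False
    then have "complete_mat l X i j = id_mat i j" "M i j = id_mat i j"
      using id_outside_complete_mat[OF X, of l] M unfolding id_outside_def by blast+
    then show ?thesis by simp
  qed
qed

lemma complete_mat_mult:
  assumes X: "X \<in> carrier_mat n n" and Y: "Y \<in> carrier_mat n n"
  shows "complete_mat l (X * Y) = mat_mult (complete_mat l X) (complete_mat l Y)"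
proof (rule complete_mat_eqI)
  show "X * Y \<in> carrier_mat n n" using X Y by simp
  show "id_outside l (l + int n) (mat_mult (complete_mat l X) (complete_mat l Y))"
    by (intro id_outside_mat_mult id_outside_complete_mat X Y)
  fix x y assume xy: "x < n" "y < n"
  have "mat_mult (complete_mat l X) (complete_mat l Y) (l + 1 + int x) (l + 1 + int y) =
      (\<Sum>j\<in>{l<..l + int n}. complete_mat l X (l + 1 + int x) j * complete_mat l Y j (l + 1 + int y))"
    using xy by (simp add: mat_mult_eq[OF id_outside_complete_mat[OF X]])
  also have "\<dots> = (\<Sum>k\<in>{0..<n}. complete_mat l X (l + 1 + int x) (l + 1 + int k) *
      complete_mat l Y (l + 1 + int k) (l + 1 + int y))"
    by (rule sum.reindex_bij_witness[of _ "\<lambda>k. l + 1 + int k" "\<lambda>j. nat (j - l - 1)"]) auto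
  also have "\<dots> = (\<Sum>k\<in>{0..<n}. X $$ (x, k) * Y $$ (k, y))"
    using X Y xy by (intro sum.cong) (auto simp: complete_mat_index)
  also have "\<dots> = (X * Y) $$ (x, y)" using X Y xy by (simp add: scalar_prod_def)
  finally show "(X * Y) $$ (x, y) =
      mat_mult (complete_mat l X) (complete_mat l Y) (l + 1 + int x) (l + 1 + int y)" by simp
qed

text \<open>The column permutation of \<open>B\<^sup>\<lozenge>\<close>: with \<open>a = \<gamma>\<^sub>-\<close>, \<open>b = \<gamma>\<^sub>+\<close>, \<open>D = M\<^sub>-\<close> and \<open>E = M\<^sub>+\<close>, it moves
the columns of \<open>B\<close> with index in \<open>(s, \<gamma>\<^sub>-]\<close> and \<open>(\<gamma>\<^sub>+, t]\<close> to the ends of the enlarged index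
range and the inserted identity columns towards \<open>(\<gamma>\<^sub>-, \<gamma>\<^sub>+]\<close>.\<close>

definition col_perm :: "int \<Rightarrow> int \<Rightarrow> int \<Rightarrow> int \<Rightarrow> int \<Rightarrow> int \<Rightarrow> int \<Rightarrow> int" where
  "col_perm s a b t D E j =
     (if s - D < j \<and> j \<le> a - D then j + D else if a - D < j \<and> j \<le> a then j - (a - s)
      else if b < j \<and> j \<le> b + E then j + (t - b) else if b + E < j \<and> j \<le> t + E then j - E else j)"

definition col_perm_inv :: "int \<Rightarrow> int \<Rightarrow> int \<Rightarrow> int \<Rightarrow> int \<Rightarrow> int \<Rightarrow> int \<Rightarrow> int" where
  "col_perm_inv s a b t D E j =
     (if s < j \<and> j \<le> a then j - D else if s - D < j \<and> j \<le> s then j + (a - s)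
      else if t < j \<and> j \<le> t + E then j - (t - b) else if b < j \<and> j \<le> t then j + E else j)"

lemma permutation_col_perm:
  assumes "s \<le> a" "a \<le> b" "b \<le> t" "0 \<le> D" "0 \<le> E"
  shows "permutation (col_perm s a b t D E)"
proof -
  have "col_perm s a b t D E (col_perm_inv s a b t D E j) = j" for j
  proof -
    consider "s < j" "j \<le> a" | "s - D < j" "j \<le> s" | "t < j" "j \<le> t + E" | "b < j" "j \<le> t"
      | "j \<le> s - D" | "a < j" "j \<le> b" | "t + E < j" by linarith
    then show ?thesis by cases (use assms in \<open>simp_all add: col_perm_def col_perm_inv_def\<close>)
  qed
  moreover have "col_perm_inv s a b t D E (col_perm s a b t D E j) = j" for j
  proof -
    consider "s - D < j" "j \<le> a - D" | "a - D < j" "j \<le> a" | "b < j" "j \<le> b + E" | "b + E < j" "j \<le> t + E"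
      | "j \<le> s - D" | "a < j" "j \<le> b" | "t + E < j" by linarith
    then show ?thesis by cases (use assms in \<open>simp_all add: col_perm_def col_perm_inv_def\<close>)
  qed
  ultimately have "bij (col_perm s a b t D E)"
    by (intro o_bij[of "col_perm_inv s a b t D E"]) (simp_all add: fun_eq_iff)
  moreover have "{j. col_perm s a b t D E j \<noteq> j} \<subseteq> {s - D..t + E}"
    using assms by (auto simp: col_perm_def)
  then have "finite {j. col_perm s a b t D E j \<noteq> j}" by (rule finite_subset) simp
  ultimately show ?thesis by (simp add: permutation)
qed

lemma perm_op_col_perm_Qbar:
  assumes "s \<le> a" "a \<le> b" "b \<le> t" "0 \<le> D" "0 \<le> E"
  shows "perm_op (col_perm s a b t D E) \<in> (Qbar (a, b) :: ('f::{field, finite} lseq \<Rightarrow> 'f lseq) set)"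
proof (rule perm_op_Qbar[OF permutation_col_perm[OF assms] assms(2)])
  show "col_perm s a b t D E i \<le> b \<longleftrightarrow> i \<le> b" for i
    using assms by (simp add: col_perm_def)
  show "col_perm s a b t D E i = i" if "a < i" "i \<le> b" for i
    using that assms by (simp add: col_perm_def)
qed

text \<open>The integers of the definition of the product, as natural numbers: \<open>Nm\<close> stands for \<open>N\<^sub>-\<close>, \<open>n\<close>
for \<open>|\<alpha>|\<close>, \<open>Np\<close> for \<open>N\<^sub>+\<close>, and similarly for \<open>\<beta>\<close> and \<open>\<gamma>\<close>.\<close>

locale block_sizes =
  fixes s t :: int and \<alpha> \<beta> \<gamma> :: "int \<times> int" and Nm n Np Mm m Mp Km k Kp :: nat
  assumes \<alpha>: "fst \<alpha> = s + int Nm" "snd \<alpha> = fst \<alpha> + int n" "t = snd \<alpha> + int Np"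
    and \<beta>: "fst \<beta> = s + int Mm" "snd \<beta> = fst \<beta> + int m" "t = snd \<beta> + int Mp"
    and \<gamma>: "fst \<gamma> = s + int Km" "snd \<gamma> = fst \<gamma> + int k" "t = snd \<gamma> + int Kp"
begin

lemma sizes:
  "nat (fst \<alpha> - s) = Nm" "nat (snd \<alpha> - fst \<alpha>) = n" "nat (t - snd \<alpha>) = Np"
  "nat (fst \<beta> - s) = Mm" "nat (snd \<beta> - fst \<beta>) = m" "nat (t - snd \<beta>) = Mp"
  "nat (fst \<gamma> - s) = Km" "nat (snd \<gamma> - fst \<gamma>) = k" "nat (t - snd \<gamma>) = Kp"
  using \<alpha> \<beta> \<gamma> by simp_all

lemma sizes_eq: "Nm + n + Np = Mm + m + Mp" "Km + k + Kp = Mm + m + Mp"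
  using \<alpha> \<beta> \<gamma> by linarith+

abbreviation total :: nat where "total \<equiv> Mm + Mm + m + Mp + Mp"

lemma A_circ_carrier: "A_circ \<alpha> \<beta> s t A \<in> carrier_mat total total"
  unfolding A_circ_def Let_def block_mat_def block_row_def
  using sizes_eq by (intro carrier_matI) (simp_all add: sizes numeral_eq_Suc)

lemma B_lozenge_carrier: "B_lozenge \<beta> \<gamma> s t B \<in> carrier_mat total total"
  unfolding B_lozenge_def Let_def block_mat_def block_row_def
  using sizes_eq by (intro carrier_matI) (simp_all add: sizes numeral_eq_Suc)

text \<open>The matrix \<open>A\<^sup>\<circ>\<close> is \<open>A\<close> itself, seen in a larger index range. After splitting into the 25
blocks, an entry is either a literal entry of \<open>A\<close> or one outside \<open>(s, t]\<close>, where \<open>A\<close> is the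
identity.\<close>

lemma A_circ_entry:
  assumes A: "id_outside s t A" and x: "x < total" and y: "y < total"
  shows "A_circ \<alpha> \<beta> s t A $$ (x, y) = A (s - int Mm + 1 + int x) (s - int Mm + 1 + int y)"
proof -
  have one: "i \<le> s \<Longrightarrow> i = j \<Longrightarrow> A i j = 1" "t < i \<Longrightarrow> i = j \<Longrightarrow> A i j = 1" for i j
    using id_outsideD[OF A, of i j] by (auto simp: id_mat_def)
  have zero: "i \<le> s \<Longrightarrow> i \<noteq> j \<Longrightarrow> A i j = 0" "t < i \<Longrightarrow> i \<noteq> j \<Longrightarrow> A i j = 0"
    "j \<le> s \<Longrightarrow> i \<noteq> j \<Longrightarrow> A i j = 0" "t < j \<Longrightarrow> i \<noteq> j \<Longrightarrow> A i j = 0" for i j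
    using id_outsideD[OF A, of i j] by (auto simp: id_mat_def)
  have x': "x < Mm + Nm + n + Np + Mp" using x sizes_eq by simp
  show ?thesis
    unfolding A_circ_def Let_def block_mat_def block_row_def
    apply (rule five_strips[OF x']; rule five_strips[OF y])
    apply (simp_all add: sizes numeral_eq_Suc)
    apply (insert \<alpha> \<beta>)
    apply (rule conjI | rule impI | (rule one, linarith, linarith) | (rule zero, linarith, linarith) | (rule arg_cong2[where f = A]; linarith))+
    done
qed

abbreviation row_perm :: "int \<Rightarrow> int" where
  "row_perm \<equiv> two_swap s (fst \<beta>) (snd \<beta>) t (fst \<beta> - s) (t - snd \<beta>)"

abbreviation column_perm :: "int \<Rightarrow> int" where
  "column_perm \<equiv> col_perm s (fst \<gamma>) (snd \<gamma>) t (fst \<beta> - s) (t - snd \<beta>)"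

text \<open>The value of the row permutation in each of the five strips of rows, as the index of the row of
\<open>B\<close> that is placed there.\<close>

lemma row_strips:
  assumes x: "x < total"
  obtains "x < Mm" "row_perm (s - int Mm + 1 + int x) = s + 1 + int x"
    | i where "i < Mm" "x = Mm + i" "row_perm (s - int Mm + 1 + int x) = s - int Mm + 1 + int i"
    | i where "i < m" "x = Mm + Mm + i" "row_perm (s - int Mm + 1 + int x) = fst \<beta> + 1 + int i"
    | i where "i < Mp" "x = Mm + Mm + m + i" "row_perm (s - int Mm + 1 + int x) = t + 1 + int i"
    | i where "i < Mp" "x = Mm + Mm + m + Mp + i" "row_perm (s - int Mm + 1 + int x) = snd \<beta> + 1 + int i"
proof (cases rule: five_strips[OF x])
  case 1
  then show ?thesis using \<beta> by (intro that(1)) (simp_all add: two_swap_def)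
next
  case (2 i)
  then show ?thesis using \<beta> by (intro that(2)[of i]) (simp_all add: two_swap_def)
next
  case (3 i)
  then show ?thesis using \<beta> by (intro that(3)[of i]) (simp_all add: two_swap_def)
next
  case (4 i)
  then show ?thesis using \<beta> by (intro that(4)[of i]) (simp_all add: two_swap_def)
next
  case (5 i)
  then show ?thesis using \<beta> by (intro that(5)[of i]) (simp_all add: two_swap_def)
qed

lemma column_strips:
  assumes y: "y < total"
  obtains "y < Km" "column_perm (s - int Mm + 1 + int y) = s + 1 + int y"
    | j where "j < Mm" "y = Km + j" "column_perm (s - int Mm + 1 + int y) = s - int Mm + 1 + int j"
    | j where "j < k" "y = Km + Mm + j" "column_perm (s - int Mm + 1 + int y) = fst \<gamma> + 1 + int j"
    | j where "j < Mp" "y = Km + Mm + k + j" "column_perm (s - int Mm + 1 + int y) = t + 1 + int j"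
    | j where "j < Kp" "y = Km + Mm + k + Mp + j" "column_perm (s - int Mm + 1 + int y) = snd \<gamma> + 1 + int j"
proof -
  have y': "y < Km + Mm + k + Mp + Kp" using y sizes_eq by simp
  show ?thesis
  proof (cases rule: five_strips[OF y'])
    case 1
    then show ?thesis using \<beta> \<gamma> by (intro that(1)) (simp_all add: col_perm_def)
  next
    case (2 j)
    then show ?thesis using \<beta> \<gamma> by (intro that(2)[of j]) (simp_all add: col_perm_def)
  next
    case (3 j)
    then show ?thesis using \<beta> \<gamma> by (intro that(3)[of j]) (simp_all add: col_perm_def)
  next
    case (4 j)
    then show ?thesis using \<beta> \<gamma> by (intro that(4)[of j]) (simp_all add: col_perm_def)
  next
    case (5 j)
    then show ?thesis using \<beta> \<gamma> by (intro that(5)[of j]) (simp_all add: col_perm_def)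
  qed
qed

text \<open>The matrix \<open>B\<^sup>\<lozenge>\<close> is \<open>B\<close>, seen in a larger index range, with permuted rows and columns.\<close>

lemma B_lozenge_entry:
  assumes B: "id_outside s t B" and x: "x < total" and y: "y < total"
  shows "B_lozenge \<beta> \<gamma> s t B $$ (x, y) =
    B (row_perm (s - int Mm + 1 + int x)) (column_perm (s - int Mm + 1 + int y))"
proof -
  have one: "i \<le> s \<Longrightarrow> i = j \<Longrightarrow> B i j = 1" "t < i \<Longrightarrow> i = j \<Longrightarrow> B i j = 1" for i j
    using id_outsideD[OF B, of i j] by (auto simp: id_mat_def)
  have zero: "i \<le> s \<Longrightarrow> i \<noteq> j \<Longrightarrow> B i j = 0" "t < i \<Longrightarrow> i \<noteq> j \<Longrightarrow> B i j = 0"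
    "j \<le> s \<Longrightarrow> i \<noteq> j \<Longrightarrow> B i j = 0" "t < j \<Longrightarrow> i \<noteq> j \<Longrightarrow> B i j = 0" for i j
    using id_outsideD[OF B, of i j] by (auto simp: id_mat_def)
  define i j where "i = row_perm (s - int Mm + 1 + int x)" and "j = column_perm (s - int Mm + 1 + int y)"
  show ?thesis
    unfolding B_lozenge_def Let_def block_mat_def block_row_def i_def[symmetric] j_def[symmetric]
    apply (rule row_strips[OF x, folded i_def]; rule column_strips[OF y, folded j_def])
    apply (simp_all add: sizes numeral_eq_Suc)
    apply (insert \<beta> \<gamma>)
    apply (rule conjI | rule impI | (rule one, linarith, linarith) | (rule zero, linarith, linarith)
        | (rule arg_cong2[where f = B]; linarith))+
    done
qed

end

section \<open>Multiplicativity\<close>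

context block_sizes
begin

lemma permutation_row_perm: "permutation row_perm"
proof -
  interpret swap_bounds s "fst \<beta>" "snd \<beta>" t using \<beta> by unfold_locales simp_all
  show ?thesis by (rule permutation_two_swap) simp_all
qed

lemma permutation_column_perm: "permutation column_perm"
  using \<beta> \<gamma> by (intro permutation_col_perm) simp_all

text \<open>In operator form, \<open>A\<^sup>\<circ> B\<^sup>\<lozenge> = A \<Theta> B \<Pi>\<close>.\<close>

lemma mat_op_star_matrix:
  assumes A: "id_outside s t A" and B: "id_outside s t B"
  shows "mat_op (complete_mat (s - (fst \<beta> - s)) (A_circ \<alpha> \<beta> s t A * B_lozenge \<beta> \<gamma> s t B)) =
    mat_op A \<circ> perm_op row_perm \<circ> mat_op B \<circ> perm_op (inv_into UNIV column_perm)"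
proof -
  define l where "l = s - int Mm"
  have l: "s - (fst \<beta> - s) = l" using \<beta> by (simp add: l_def)
  have u: "l + int total = t + int Mp" using \<beta> by (simp add: l_def)
  define B' where "B' i j = B (row_perm i) (column_perm j)" for i j
  have A': "id_outside l (l + int total) A" unfolding u by (rule id_outside_mono[OF A]) (simp_all add: l_def)
  have bij_row: "inj row_perm" and bij_col: "inj column_perm"
    using permutation_row_perm permutation_column_perm by (simp_all add: permutation bij_is_inj)
  have fixed: "row_perm i = i" "column_perm i = i" if i: "\<not> (l < i \<and> i \<le> l + int total)" for i
  proof -
    consider "i \<le> l" | "t + int Mp < i" using i unfolding u by linarith
    then show "row_perm i = i" by cases (use \<beta> in \<open>simp_all add: l_def two_swap_def\<close>)
    consider "i \<le> l" | "t + int Mp < i" using i unfolding u by linarith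
    then show "column_perm i = i" by cases (use \<beta> \<gamma> in \<open>simp_all add: l_def col_perm_def\<close>)
  qed
  have out: "B i j = id_mat i j" if "\<not> (l < i \<and> i \<le> l + int total) \<or> \<not> (l < j \<and> j \<le> l + int total)" for i j
    using that unfolding u by (intro id_outsideD[OF B]) (auto simp: l_def)
  have B': "id_outside l (l + int total) B'"
    unfolding id_outside_def
  proof (intro allI impI)
    fix i j assume *: "\<not> (l < i \<and> i \<le> l + int total \<and> l < j \<and> j \<le> l + int total)"
    show "B' i j = id_mat i j"
    proof (cases "l < i \<and> i \<le> l + int total")
      case False
      then have "B' i j = id_mat i (column_perm j)"
        unfolding B'_def fixed(1)[OF False] by (intro out) simp
      also have "\<dots> = id_mat i j"
        using injD[OF bij_col, of j i] fixed(2)[OF False] by (auto simp: id_mat_def)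
      finally show ?thesis .
    next
      case True
      then have j: "\<not> (l < j \<and> j \<le> l + int total)" using * by simp
      then have "B' i j = id_mat (row_perm i) j"
        unfolding B'_def fixed(2)[OF j] by (intro out) simp
      also have "\<dots> = id_mat i j"
        using injD[OF bij_row, of i j] fixed(1)[OF j] by (auto simp: id_mat_def)
      finally show ?thesis .
    qed
  qed
  have "complete_mat l (A_circ \<alpha> \<beta> s t A) = A"
    by (rule complete_mat_eqI[OF A_circ_carrier A']) (simp add: A_circ_entry[OF A] l_def)
  moreover have "complete_mat l (B_lozenge \<beta> \<gamma> s t B) = B'"
    by (rule complete_mat_eqI[OF B_lozenge_carrier B']) (simp add: B_lozenge_entry[OF B] l_def B'_def)
  ultimately have "mat_op (complete_mat l (A_circ \<alpha> \<beta> s t A * B_lozenge \<beta> \<gamma> s t B)) = mat_op A \<circ> mat_op B'"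
    by (simp add: complete_mat_mult[OF A_circ_carrier B_lozenge_carrier] mat_op_mat_mult[OF A' B'])
  also have "mat_op B' = perm_op row_perm \<circ> mat_op B \<circ> perm_op (inv_into UNIV column_perm)"
    unfolding B'_def by (rule mat_op_permuted[OF permutation_row_perm permutation_column_perm B])
  finally show ?thesis unfolding l by (simp only: comp_assoc)
qed

lemma perm_op_inv_column_perm_Qbar:
  "perm_op (inv_into UNIV column_perm) \<in> (Qbar \<gamma> :: ('f::{field, finite} lseq \<Rightarrow> 'f lseq) set)"
proof -
  have "perm_op column_perm \<in> (Qbar (fst \<gamma>, snd \<gamma>) :: ('f lseq \<Rightarrow> 'f lseq) set)"
    using \<beta> \<gamma> by (intro perm_op_col_perm_Qbar) simp_all
  then have "perm_op column_perm \<in> (Qbar \<gamma> :: ('f lseq \<Rightarrow> 'f lseq) set)" by (simp only: prod.collapse)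
  moreover have "\<gamma> \<in> idx" using \<gamma>(2) by (simp add: idx_def)
  ultimately have "ginv (perm_op column_perm) \<in> (Qbar \<gamma> :: ('f lseq \<Rightarrow> 'f lseq) set)"
    by (rule Qbar_inv)
  then show ?thesis by (simp only: ginv_perm_op[OF permutation_column_perm])
qed

end

lemma block_sizes_exist:
  assumes "\<alpha> \<in> idx" "\<beta> \<in> idx" "\<gamma> \<in> idx"
    and "s \<le> fst \<alpha>" "s \<le> fst \<beta>" "s \<le> fst \<gamma>" "snd \<alpha> \<le> t" "snd \<beta> \<le> t" "snd \<gamma> \<le> t"
  shows "block_sizes s t \<alpha> \<beta> \<gamma> (nat (fst \<alpha> - s)) (nat (snd \<alpha> - fst \<alpha>)) (nat (t - snd \<alpha>))
    (nat (fst \<beta> - s)) (nat (snd \<beta> - fst \<beta>)) (nat (t - snd \<beta>))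
    (nat (fst \<gamma> - s)) (nat (snd \<gamma> - fst \<gamma>)) (nat (t - snd \<gamma>))"
  using assms by unfold_locales (simp_all add: idx_def)

lemma mat_op_window:
  fixes A :: "int \<Rightarrow> int \<Rightarrow> 'f::{field, finite}"
  assumes "A \<in> GL2inf" "id_outside s t A"
  shows "window s t (mat_op A)"
  unfolding window_def
  using mat_op_GLbar[OF assms(1)] mat_op_fixes_W[OF assms(2)] mat_op_diff_in_band[OF assms(2)]
  by (simp add: band_def)

lemma mem_dcoset_self: "g \<in> dcoset \<alpha> \<beta> g"
  unfolding dcoset_def mem_Collect_eq
  by (rule exI[of _ id], rule exI[of _ id]) (simp add: Qbar_id)

lemma dcosetsE:
  assumes "\<aa> \<in> dcosets \<alpha> \<beta>"
  obtains g where "g \<in> GLbar" "\<aa> = dcoset \<alpha> \<beta> g"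
  using assms unfolding dcosets_def by auto

lemma dcosetE:
  assumes "A \<in> dcoset \<alpha> \<beta> g"
  obtains p q where "p \<in> Qbar \<alpha>" "q \<in> Qbar \<beta>" "A = p \<circ> g \<circ> q"
  using assms unfolding dcoset_def by auto

lemma dcosets_GLbar:
  assumes "\<aa> \<in> dcosets \<alpha> \<beta>" "A \<in> \<aa>"
  shows "A \<in> GLbar"
proof -
  obtain g where g: "g \<in> GLbar" "\<aa> = dcoset \<alpha> \<beta> g" using dcosetsE[OF assms(1)] .
  obtain p q where "p \<in> Qbar \<alpha>" "q \<in> Qbar \<beta>" "A = p \<circ> g \<circ> q"
    using dcosetE[OF assms(2)[unfolded g(2)]] .
  then show ?thesis using g(1) by (simp add: GLbar_comp Qbar_GLbar)
qed

lemma some_mem_dcosets: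
  assumes "\<aa> \<in> dcosets \<alpha> \<beta>"
  shows "(SOME A. A \<in> \<aa>) \<in> \<aa>"
proof -
  obtain g where "\<aa> = dcoset \<alpha> \<beta> g" using dcosetsE[OF assms] .
  then have "g \<in> \<aa>" by (simp add: mem_dcoset_self)
  then show ?thesis by (rule someI[of "\<lambda>A. A \<in> \<aa>"])
qed

text \<open>If \<open>h\<^sup>-\<^sup>1 g = q\<close> is in \<open>Qbar \<beta>\<close>, then \<open>h = g q\<^sup>-\<^sup>1\<close> is in the double coset of \<open>g\<close>.\<close>

lemma dcosets_finitary:
  fixes \<aa> :: "('f::{field, finite} lseq \<Rightarrow> 'f lseq) set"
  assumes \<beta>: "\<beta> \<in> idx" and a: "\<aa> \<in> dcosets \<alpha> \<beta>"
  obtains A where "A \<in> GL2inf" "mat_op A \<in> \<aa>"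
proof -
  obtain g where g: "g \<in> GLbar" "\<aa> = dcoset \<alpha> \<beta> g" using dcosetsE[OF a] .
  obtain A where A: "A \<in> GL2inf" "ginv (mat_op A) \<circ> g \<in> Qbar (fst \<beta>, snd \<beta>)"
    using finitary_approximation[OF g(1), of "fst \<beta>" "snd \<beta>"] \<beta> by (auto simp: idx_def)
  define q where "q = ginv (mat_op A) \<circ> g"
  have q: "q \<in> Qbar \<beta>" using A(2) by (simp add: q_def)
  have Aq: "mat_op A \<circ> q = g"
    by (simp add: q_def fun_eq_iff surj_f_inv_f[OF bij_is_surj[OF GLbarD(2)[OF mat_op_GLbar[OF A(1)]]]])
  have "q \<circ> ginv q = id"
    by (rule surj_iff[THEN iffD1, OF bij_is_surj[OF GLbarD(2)[OF Qbar_GLbar[OF q]]]])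
  then have "mat_op A = id \<circ> g \<circ> ginv q" unfolding Aq[symmetric] by (simp add: comp_assoc)
  then have "mat_op A \<in> dcoset \<alpha> \<beta> g"
    unfolding dcoset_def mem_Collect_eq
    by (intro exI[of _ id] exI[of _ "ginv q"] conjI Qbar_id Qbar_inv[OF q \<beta>])
  then show ?thesis using that A(1) g(2) by simp
qed

text \<open>Admissible data exist, so the choice in the definition of the product is one of admissible data.\<close>

lemma is_star_star:
  fixes \<aa> \<bb> :: "('f::{field, finite} lseq \<Rightarrow> 'f lseq) set"
  assumes "\<beta> \<in> idx" "\<gamma> \<in> idx" "\<aa> \<in> dcosets \<alpha> \<beta>" "\<bb> \<in> dcosets \<beta> \<gamma>"
  shows "is_star \<alpha> \<beta> \<gamma> \<aa> \<bb> (star \<alpha> \<beta> \<gamma> \<aa> \<bb>)"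
proof -
  obtain A where A: "A \<in> GL2inf" "mat_op A \<in> \<aa>" using dcosets_finitary[OF assms(1,3)] .
  obtain B where B: "B \<in> GL2inf" "mat_op B \<in> \<bb>" using dcosets_finitary[OF assms(2,4)] .
  obtain s1 t1 where 1: "id_outside s1 t1 A" using A(1) finitary_id_outside unfolding GL2inf_def by blast
  obtain s2 t2 where 2: "id_outside s2 t2 B" using B(1) finitary_id_outside unfolding GL2inf_def by blast
  define s t where "s = Min {s1, s2, fst \<alpha>, fst \<beta>, fst \<gamma>}" and "t = Max {t1, t2, snd \<alpha>, snd \<beta>, snd \<gamma>}"
  have "id_outside s t A" by (rule id_outside_mono[OF 1]) (simp_all add: s_def t_def)
  moreover have "id_outside s t B" by (rule id_outside_mono[OF 2]) (simp_all add: s_def t_def)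
  moreover have "s \<le> fst \<alpha>" "s \<le> fst \<beta>" "s \<le> fst \<gamma>" "snd \<alpha> \<le> t" "snd \<beta> \<le> t" "snd \<gamma> \<le> t"
    by (simp_all add: s_def t_def)
  ultimately have "is_star \<alpha> \<beta> \<gamma> \<aa> \<bb> (dcoset \<alpha> \<gamma>
      (mat_op (complete_mat (s - (fst \<beta> - s)) (A_circ \<alpha> \<beta> s t A * B_lozenge \<beta> \<gamma> s t B))))"
    unfolding is_star_def
    by (intro exI[of _ A] exI[of _ B] exI[of _ s] exI[of _ t] conjI A B refl)
  then show ?thesis unfolding star_def by (rule someI)
qed

context unitary_representation
begin

lemma rho_op_apply: "v \<in> fixed_space \<rho> \<beta> \<Longrightarrow> rho_op \<rho> \<alpha> \<beta> A v = proj \<alpha> (\<rho> A v)"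
  by (simp add: rho_op_def)

lemma rho_op_funcset: "\<alpha> \<in> idx \<Longrightarrow> rho_op \<rho> \<alpha> \<beta> A \<in> fixed_space \<rho> \<beta> \<rightarrow>\<^sub>E fixed_space \<rho> \<alpha>"
  by (auto simp: rho_op_def proj(1))

lemma rho_op_bi_invariant:
  assumes "\<alpha> \<in> idx" "g \<in> GLbar" "p \<in> Qbar \<alpha>" "q \<in> Qbar \<beta>"
  shows "rho_op \<rho> \<alpha> \<beta> (p \<circ> g \<circ> q) = rho_op \<rho> \<alpha> \<beta> g"
  unfolding rho_op_def
proof (rule restrict_ext)
  fix v assume v: "v \<in> fixed_space \<rho> \<beta>"
  note G = Qbar_GLbar[OF assms(3)] Qbar_GLbar[OF assms(4)]
  have "\<rho> (p \<circ> g \<circ> q) v = \<rho> p (\<rho> g v)"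
    using rho_comp[OF GLbar_comp[OF G(1) assms(2)] G(2)] rho_comp[OF G(1) assms(2)]
      fixed_spaceD[OF v assms(4)] by simp
  then show "proj \<alpha> (\<rho> (p \<circ> g \<circ> q) v) = proj \<alpha> (\<rho> g v)"
    using proj_rho[OF assms(1,3)] by simp
qed

lemma rho_hat_eq:
  assumes "\<alpha> \<in> idx" "\<aa> \<in> dcosets \<alpha> \<beta>" "A \<in> \<aa>"
  shows "rho_hat \<rho> \<alpha> \<beta> \<aa> = rho_op \<rho> \<alpha> \<beta> A"
proof -
  obtain g where g: "g \<in> GLbar" "\<aa> = dcoset \<alpha> \<beta> g" using dcosetsE[OF assms(2)] .
  have "rho_op \<rho> \<alpha> \<beta> C = rho_op \<rho> \<alpha> \<beta> g" if C: "C \<in> \<aa>" for C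
  proof -
    obtain p q where "p \<in> Qbar \<alpha>" "q \<in> Qbar \<beta>" "C = p \<circ> g \<circ> q"
      using dcosetE[OF C[unfolded g(2)]] .
    then show ?thesis using rho_op_bi_invariant[OF assms(1) g(1)] by simp
  qed
  then show ?thesis unfolding rho_hat_def using assms(3) some_mem_dcosets[OF assms(2)] by simp
qed

lemma rho_hat_star:
  assumes idx: "\<alpha> \<in> idx" "\<beta> \<in> idx" "\<gamma> \<in> idx"
    and a: "\<aa> \<in> dcosets \<alpha> \<beta>" and b: "\<bb> \<in> dcosets \<beta> \<gamma>"
  shows "compose (fixed_space \<rho> \<gamma>) (rho_hat \<rho> \<alpha> \<beta> \<aa>) (rho_hat \<rho> \<beta> \<gamma> \<bb>) =
    rho_hat \<rho> \<alpha> \<gamma> (star \<alpha> \<beta> \<gamma> \<aa> \<bb>)"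
proof -
  obtain A B s t where A: "A \<in> GL2inf" "mat_op A \<in> \<aa>" "id_outside s t A"
      and B: "B \<in> GL2inf" "mat_op B \<in> \<bb>" "id_outside s t B"
      and st: "s \<le> fst \<alpha>" "s \<le> fst \<beta>" "s \<le> fst \<gamma>" "snd \<alpha> \<le> t" "snd \<beta> \<le> t" "snd \<gamma> \<le> t"
      and c: "star \<alpha> \<beta> \<gamma> \<aa> \<bb> = dcoset \<alpha> \<gamma>
        (mat_op (complete_mat (s - (fst \<beta> - s)) (A_circ \<alpha> \<beta> s t A * B_lozenge \<beta> \<gamma> s t B)))"
    using is_star_star[OF idx(2,3) a b] unfolding is_star_def by (elim exE conjE) (rule that)
  have le: "fst \<alpha> \<le> snd \<alpha>" "fst \<beta> \<le> snd \<beta>" "fst \<gamma> \<le> snd \<gamma>" using idx by (simp_all add: idx_def)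
  let ?\<theta> = "two_swap s (fst \<beta>) (snd \<beta>) t (fst \<beta> - s) (t - snd \<beta>)"
  let ?\<pi> = "col_perm s (fst \<gamma>) (snd \<gamma>) t (fst \<beta> - s) (t - snd \<beta>)"
  interpret blocks: block_sizes s t \<alpha> \<beta> \<gamma> "nat (fst \<alpha> - s)" "nat (snd \<alpha> - fst \<alpha>)" "nat (t - snd \<alpha>)"
    "nat (fst \<beta> - s)" "nat (snd \<beta> - fst \<beta>)" "nat (t - snd \<beta>)"
    "nat (fst \<gamma> - s)" "nat (snd \<gamma> - fst \<gamma>)" "nat (t - snd \<gamma>)"
    by (rule block_sizes_exist[OF idx st])
  define T :: "'f lseq \<Rightarrow> 'f lseq" where "T = perm_op ?\<theta>"
  define P :: "'f lseq \<Rightarrow> 'f lseq" where "P = perm_op (inv_into UNIV ?\<pi>)"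
  have P: "P \<in> Qbar \<gamma>" unfolding P_def by (rule blocks.perm_op_inv_column_perm_Qbar)
  have TG: "T \<in> GLbar" unfolding T_def by (rule perm_op_GLbar[OF blocks.permutation_row_perm])
  have G: "mat_op A \<circ> T \<circ> mat_op B \<in> GLbar" by (intro GLbar_comp mat_op_GLbar A(1) B(1) TG)
  have star: "star \<alpha> \<beta> \<gamma> \<aa> \<bb> = dcoset \<alpha> \<gamma> (mat_op A \<circ> T \<circ> mat_op B \<circ> P)"
    unfolding c blocks.mat_op_star_matrix[OF A(3) B(3)] T_def P_def ..
  have "star \<alpha> \<beta> \<gamma> \<aa> \<bb> \<in> dcosets \<alpha> \<gamma>"
    unfolding star dcosets_def by (intro imageI GLbar_comp G Qbar_GLbar[OF P])
  then have "rho_hat \<rho> \<alpha> \<gamma> (star \<alpha> \<beta> \<gamma> \<aa> \<bb>) = rho_op \<rho> \<alpha> \<gamma> (mat_op A \<circ> T \<circ> mat_op B \<circ> P)"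
    using mem_dcoset_self unfolding star by (rule rho_hat_eq[OF idx(1)])
  also have "\<dots> = rho_op \<rho> \<alpha> \<gamma> (mat_op A \<circ> T \<circ> mat_op B)"
    using rho_op_bi_invariant[OF idx(1) G Qbar_id P] by simp
  also have "\<dots> = compose (fixed_space \<rho> \<gamma>) (rho_op \<rho> \<alpha> \<beta> (mat_op A)) (rho_op \<rho> \<beta> \<gamma> (mat_op B))"
    unfolding rho_op_def[of _ _ \<gamma> "mat_op A \<circ> T \<circ> mat_op B"] compose_def
  proof (rule restrict_ext)
    fix w assume w: "w \<in> fixed_space \<rho> \<gamma>"
    have "rho_op \<rho> \<alpha> \<beta> (mat_op A) (rho_op \<rho> \<beta> \<gamma> (mat_op B) w) =
        proj \<alpha> (\<rho> (mat_op A) (proj \<beta> (\<rho> (mat_op B) w)))"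
      by (simp add: rho_op_apply w proj(1)[OF idx(2)])
    also have "\<dots> = proj \<alpha> (\<rho> (mat_op A \<circ> T \<circ> mat_op B) w)"
      unfolding T_def
      using multiplicativity[OF mat_op_window[OF A(1,3)] mat_op_window[OF B(1,3)] st(1) le(1) st(4)
          st(2) le(2) st(5) st(3) le(3) st(6) w] by simp
    finally show "proj \<alpha> (\<rho> (mat_op A \<circ> T \<circ> mat_op B) w) =
        rho_op \<rho> \<alpha> \<beta> (mat_op A) (rho_op \<rho> \<beta> \<gamma> (mat_op B) w)" ..
  qed
  finally show ?thesis
    by (simp only: rho_hat_eq[OF idx(1) a A(2)] rho_hat_eq[OF idx(2) b B(2)])
qed

text \<open>For fixed vectors \<open>v\<close>, \<open>w\<close> the two projections drop out of the inner products, and the claim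
becomes the unitarity of \<open>\<rho> A\<close>.\<close>

lemma adjoint_rho_hat:
  assumes idx: "\<alpha> \<in> idx" "\<beta> \<in> idx" and a: "\<aa> \<in> dcosets \<alpha> \<beta>"
  shows "adjoint_on (fixed_space \<rho> \<beta>) (fixed_space \<rho> \<alpha>) (rho_hat \<rho> \<alpha> \<beta> \<aa>) =
    rho_hat \<rho> \<beta> \<alpha> (coset_adj \<alpha> \<beta> \<aa>)"
proof -
  define A where "A = (SOME A. A \<in> \<aa>)"
  have A: "A \<in> \<aa>" unfolding A_def by (rule some_mem_dcosets[OF a])
  have AG: "A \<in> GLbar" by (rule dcosets_GLbar[OF a A])
  have "dcoset \<beta> \<alpha> (ginv A) \<in> dcosets \<beta> \<alpha>"
    unfolding dcosets_def by (intro imageI GLbar_inv AG)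
  then have adj: "rho_hat \<rho> \<beta> \<alpha> (coset_adj \<alpha> \<beta> \<aa>) = rho_op \<rho> \<beta> \<alpha> (ginv A)"
    unfolding coset_adj_def A_def[symmetric] using mem_dcoset_self by (rule rho_hat_eq[OF idx(2)])
  show ?thesis
    unfolding adj rho_hat_eq[OF idx(1) a A] adjoint_on_def rho_op_def[of _ \<beta>]
  proof (rule restrict_ext)
    fix w assume w: "w \<in> fixed_space \<rho> \<alpha>"
    let ?u = "proj \<beta> (\<rho> (ginv A) w)"
    have u: "?u \<in> fixed_space \<rho> \<beta>" by (rule proj(1)[OF idx(2)])
    have eq: "cinner (rho_op \<rho> \<alpha> \<beta> A v) w = cinner v ?u" if v: "v \<in> fixed_space \<rho> \<beta>" for v
    proof -
      have "cinner (rho_op \<rho> \<alpha> \<beta> A v) w = cinner (\<rho> A v) w"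
        using proj(3)[OF idx(1) w] by (simp add: rho_op_apply v)
      also have "\<dots> = cinner v (\<rho> (ginv A) w)" by (rule cinner_rho_left[OF AG])
      also have "\<dots> = cnj (cinner (\<rho> (ginv A) w) v)" by (rule cinner_commute)
      also have "\<dots> = cnj (cinner ?u v)" by (simp only: proj(3)[OF idx(2) v])
      also have "\<dots> = cinner v ?u" by (rule cinner_commute[symmetric])
      finally show ?thesis .
    qed
    show "(THE u. u \<in> fixed_space \<rho> \<beta> \<and>
        (\<forall>v\<in>fixed_space \<rho> \<beta>. cinner (rho_op \<rho> \<alpha> \<beta> A v) w = cinner v u)) = ?u"
    proof (rule the_equality)
      show "?u \<in> fixed_space \<rho> \<beta> \<and>
          (\<forall>v\<in>fixed_space \<rho> \<beta>. cinner (rho_op \<rho> \<alpha> \<beta> A v) w = cinner v ?u)"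
        using u eq by simp
      fix u' assume u': "u' \<in> fixed_space \<rho> \<beta> \<and>
          (\<forall>v\<in>fixed_space \<rho> \<beta>. cinner (rho_op \<rho> \<alpha> \<beta> A v) w = cinner v u')"
      have "cinner u' v = cinner ?u v" if v: "v \<in> fixed_space \<rho> \<beta>" for v
      proof -
        have "cinner v u' = cinner v ?u" using u' eq[OF v] v by simp
        then show ?thesis using cinner_commute[of u' v] cinner_commute[of ?u v] by simp
      qed
      then show "u' = ?u" using fixed_space_diff[of u' \<beta> ?u] u u' by (intro cinner_ext) simp_all
    qed
  qed
qed

lemma onorm_rho_hat_le:
  assumes idx: "\<alpha> \<in> idx" and a: "\<aa> \<in> dcosets \<alpha> \<beta>"
  shows "onorm_on (fixed_space \<rho> \<beta>) (rho_hat \<rho> \<alpha> \<beta> \<aa>) \<le> 1"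
  unfolding onorm_on_def
proof (rule SUP_least)
  fix v assume v: "v \<in> fixed_space \<rho> \<beta>"
  define A where "A = (SOME A. A \<in> \<aa>)"
  have A: "A \<in> \<aa>" unfolding A_def by (rule some_mem_dcosets[OF a])
  have "norm (rho_hat \<rho> \<alpha> \<beta> \<aa> v) \<le> norm v"
    using norm_proj_le[OF idx, of "\<rho> A v"] norm_rho[OF dcosets_GLbar[OF a A], of v]
    by (simp add: rho_hat_eq[OF idx a A] rho_op_apply v)
  then have "norm (rho_hat \<rho> \<alpha> \<beta> \<aa> v) / norm v \<le> 1" by (simp add: divide_le_eq_1)
  then show "ereal (norm (rho_hat \<rho> \<alpha> \<beta> \<aa> v) / norm v) \<le> 1" by simp
qed

end

theorem theorem1p9:
  fixes \<rho> :: "('f::{field, finite} lseq \<Rightarrow> 'f lseq) \<Rightarrow> 'h::complex_hilbert \<Rightarrow> 'h"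
  assumes "separable_space (euclidean :: 'h topology)"
    and "unitary_rep \<rho>"
  shows "(\<forall>\<alpha>\<in>idx. \<forall>\<beta>\<in>idx. \<forall>\<aa>\<in>dcosets \<alpha> \<beta>.
            rho_hat \<rho> \<alpha> \<beta> \<aa> \<in> fixed_space \<rho> \<beta> \<rightarrow>\<^sub>E fixed_space \<rho> \<alpha> \<and>
            (\<forall>A\<in>\<aa>. rho_hat \<rho> \<alpha> \<beta> \<aa> = rho_op \<rho> \<alpha> \<beta> A))
       \<and> (\<forall>\<alpha>\<in>idx. \<forall>\<beta>\<in>idx. \<forall>\<gamma>\<in>idx. \<forall>\<aa>\<in>dcosets \<alpha> \<beta>. \<forall>\<bb>\<in>dcosets \<beta> \<gamma>.
            compose (fixed_space \<rho> \<gamma>) (rho_hat \<rho> \<alpha> \<beta> \<aa>) (rho_hat \<rho> \<beta> \<gamma> \<bb>)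
              = rho_hat \<rho> \<alpha> \<gamma> (star \<alpha> \<beta> \<gamma> \<aa> \<bb>))
       \<and> (\<forall>\<alpha>\<in>idx. \<forall>\<beta>\<in>idx. \<forall>\<aa>\<in>dcosets \<alpha> \<beta>.
            adjoint_on (fixed_space \<rho> \<beta>) (fixed_space \<rho> \<alpha>) (rho_hat \<rho> \<alpha> \<beta> \<aa>)
              = rho_hat \<rho> \<beta> \<alpha> (coset_adj \<alpha> \<beta> \<aa>))
       \<and> (\<forall>\<alpha>\<in>idx. \<forall>\<beta>\<in>idx. \<forall>\<aa>\<in>dcosets \<alpha> \<beta>.
            onorm_on (fixed_space \<rho> \<beta>) (rho_hat \<rho> \<alpha> \<beta> \<aa>) \<le> 1)"
proof -
  interpret unitary_representation \<rho> by (rule unitary_representation.intro) (rule assms(2))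
  show ?thesis
  proof (intro conjI ballI)
    fix \<alpha> \<beta> and \<aa> :: "('f lseq \<Rightarrow> 'f lseq) set"
    assume idx: "\<alpha> \<in> idx" "\<beta> \<in> idx" and a: "\<aa> \<in> dcosets \<alpha> \<beta>"
    show "rho_hat \<rho> \<alpha> \<beta> \<aa> \<in> fixed_space \<rho> \<beta> \<rightarrow>\<^sub>E fixed_space \<rho> \<alpha>"
      unfolding rho_hat_def by (rule rho_op_funcset[OF idx(1)])
    show "rho_hat \<rho> \<alpha> \<beta> \<aa> = rho_op \<rho> \<alpha> \<beta> A" if "A \<in> \<aa>" for A
      by (rule rho_hat_eq[OF idx(1) a that])
    show "adjoint_on (fixed_space \<rho> \<beta>) (fixed_space \<rho> \<alpha>) (rho_hat \<rho> \<alpha> \<beta> \<aa>)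
        = rho_hat \<rho> \<beta> \<alpha> (coset_adj \<alpha> \<beta> \<aa>)"
      by (rule adjoint_rho_hat[OF idx a])
    show "onorm_on (fixed_space \<rho> \<beta>) (rho_hat \<rho> \<alpha> \<beta> \<aa>) \<le> 1"
      by (rule onorm_rho_hat_le[OF idx(1) a])
  qed (rule rho_hat_star)
qed

end
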